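(* Let $n\ge 2$ and let $N_k\triangleleft F_n$, $k\in\mathbb{N}$, be a sequence of non-trivial normal subgroups of the free group $F_n$ such that each quotient graph $\Gamma_{N_k}$ is planar. Let $\ell_k:=\min\{d(\mathrm{id},h)\mid h\in N_k,\ h\neq \mathrm{id}\}$. If $\ell_k\to\infty$ as $k\to\infty$, then $$\lim_{k\to\infty}\delta(N_k)=\frac12\,\delta(F_n)\quad\text{and}\quad \lim_{k\to\infty}\mathrm{growth}(\Gamma_{N_k})=\mathrm{growth}(T_n).$$
   Context: $F_n$ is the free group of rank $n\ge2$ with a fixed free generating set $S$; $T_n$ is its Cayley graph with respect to $S$, and $d$ is the word metric. For a subgroup $G<F_n$, the Poincaré exponent is $\delta(G):=\limsup_{R\to\infty}\frac1R\log \mathrm{card}\{g\in G\mid d(\mathrm{id},g)\le R\}$. One has $\delta(F_n)=\log(2n-1)$. Graphs are unoriented with countable vertex set and bounded vertex degree; loops and multiple edges are allowed. For a subgroup $H<F_n$ acting on $T_n$ by left multiplication, $\Gamma_H:=T_n/H$ is the quotient graph: its vertices are the cosets $Hg$, $g\in F_n$, and for each vertex $Hx$ and each $s\in S$ there is one edge joining $Hx$ and $Hxs$ (so $\Gamma_H$ is $2n$-regular, a loop contributing $2$ to the degree). For a connected graph $\Gamma$ with path metric $d$ and any base vertex $\gamma_0$, $\mathrm{growth}(\Gamma)=\limsup_{m\to\infty}\big(\mathrm{card}\{\gamma\in\Gamma\mid d(\gamma,\gamma_0)\le m\}\big)^{1/m}$, where vertices are counted. One has $\mathrm{growth}(T_n)=2n-1$.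 A graph is planar if it can be embedded in the sphere $S^2$. *)

theory Defs
  imports
    "HOL-Analysis.Analysis"
    "HOL-Algebra.Coset"
    "HOL-Algebra.Generated_Groups"
    "Graph_Theory.Digraph"
begin

section \<open>Free groups and the word metric\<close>

text \<open>
  A word over \<open>S\<close> is a list of letters \<open>(s, b)\<close> with \<open>s \<in> S\<close>; the letter \<open>(s, True)\<close>
  denotes \<open>s\<close> and \<open>(s, False)\<close> denotes its inverse.
\<close>

definition letter_val :: "('a, 'm) monoid_scheme \<Rightarrow> 'a \<times> bool \<Rightarrow> 'a" where
  "letter_val F l = (if snd l then fst l else inv\<^bsub>F\<^esub> (fst l))"

definition word_val :: "('a, 'm) monoid_scheme \<Rightarrow> ('a \<times> bool) list \<Rightarrow> 'a" where
  "word_val F w = foldr (\<lambda>l x. letter_val F l \<otimes>\<^bsub>F\<^esub> x) w \<one>\<^bsub>F\<^esub>"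

definition words :: "'a set \<Rightarrow> ('a \<times> bool) list set" where
  "words S = lists (S \<times> UNIV)"

definition reduced :: "('a \<times> bool) list \<Rightarrow> bool" where
  "reduced w \<longleftrightarrow> successively (\<lambda>l l'. \<not> (fst l = fst l' \<and> snd l \<noteq> snd l')) w"

text \<open>\<open>F\<close> is free on \<open>S\<close>: each element is the value of exactly one reduced word over \<open>S\<close>.\<close>

definition free_generating_set :: "('a, 'm) monoid_scheme \<Rightarrow> 'a set \<Rightarrow> bool" where
  "free_generating_set F S \<longleftrightarrow>
     group F \<and> S \<subseteq> carrier F \<and> bij_betw (word_val F) {w \<in> words S. reduced w} (carrier F)"

definition word_dist :: "('a, 'm) monoid_scheme \<Rightarrow> 'a set \<Rightarrow> 'a \<Rightarrow> 'a \<Rightarrow> nat" where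
  "word_dist F S g h =
     (LEAST m. \<exists>w \<in> words S. length w = m \<and> word_val F w = inv\<^bsub>F\<^esub> g \<otimes>\<^bsub>F\<^esub> h)"

definition poincare_exponent :: "('a, 'm) monoid_scheme \<Rightarrow> 'a set \<Rightarrow> 'a set \<Rightarrow> ereal" where
  "poincare_exponent F S G =
     Limsup at_top (\<lambda>R::real.
       ereal (1 / R * ln (real (card {g \<in> G. real (word_dist F S \<one>\<^bsub>F\<^esub> g) \<le> R}))))"

definition min_displacement :: "('a, 'm) monoid_scheme \<Rightarrow> 'a set \<Rightarrow> 'a set \<Rightarrow> nat" where
  "min_displacement F S G =
     (LEAST l. \<exists>h \<in> G. h \<noteq> \<one>\<^bsub>F\<^esub> \<and> word_dist F S \<one>\<^bsub>F\<^esub> h = l)"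


section \<open>Graphs\<close>

text \<open>
  An unoriented graph, possibly with loops and multiple edges, is represented by a
  \<^typ>\<open>('v, 'e) pre_digraph\<close> with one arc per edge. The direction of the arc is an
  arbitrary choice that only serves to parametrize the edge; paths may traverse arcs in
  both directions.
\<close>

definition path_dist :: "('v, 'e) pre_digraph \<Rightarrow> 'v \<Rightarrow> 'v \<Rightarrow> enat" where
  "path_dist \<Gamma> u v = Inf {enat m | m. (u, v) \<in> symcl (arcs_ends \<Gamma>) ^^ m}"

definition growth :: "('v, 'e) pre_digraph \<Rightarrow> 'v \<Rightarrow> ereal" where
  "growth \<Gamma> v\<^sub>0 =
     limsup (\<lambda>m. ereal (root m (real (card {v \<in> verts \<Gamma>. path_dist \<Gamma> v v\<^sub>0 \<le> enat m}))))"

definition cayley_graph :: "('a, 'm) monoid_scheme \<Rightarrow> 'a set \<Rightarrow> ('a, 'a \<times> 'a) pre_digraph" where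
  "cayley_graph F S =
     \<lparr>verts = carrier F, arcs = carrier F \<times> S,
      tail = fst, head = (\<lambda>(x, s). x \<otimes>\<^bsub>F\<^esub> s)\<rparr>"

definition quotient_graph ::
    "('a, 'm) monoid_scheme \<Rightarrow> 'a set \<Rightarrow> 'a set \<Rightarrow> ('a set, 'a set \<times> 'a) pre_digraph" where
  "quotient_graph F S H =
     \<lparr>verts = rcosets\<^bsub>F\<^esub> H, arcs = (rcosets\<^bsub>F\<^esub> H) \<times> S,
      tail = fst, head = (\<lambda>(C, s). C #>\<^bsub>F\<^esub> s)\<rparr>"


section \<open>Geometric realization and planarity\<close>

text \<open>
  The points of the realization are the vertices and, for each edge \<open>e\<close>, the interior points
  \<open>(e, t)\<close> with \<open>0 < t < 1\<close>. The map \<open>edge_point \<Gamma> e\<close> is the characteristic map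
  \<open>{0..1} \<rightarrow> |\<Gamma>|\<close> of \<open>e\<close>. The topology is the quotient topology of the disjoint union of
  the discrete vertex set and one unit interval per edge.
\<close>

definition realization_points :: "('v, 'e) pre_digraph \<Rightarrow> ('v + 'e \<times> real) set" where
  "realization_points \<Gamma> = Inl ` verts \<Gamma> \<union> Inr ` (arcs \<Gamma> \<times> {0<..<1})"

definition edge_point :: "('v, 'e) pre_digraph \<Rightarrow> 'e \<Rightarrow> real \<Rightarrow> 'v + 'e \<times> real" where
  "edge_point \<Gamma> e t =
     (if t = 0 then Inl (tail \<Gamma> e) else if t = 1 then Inl (head \<Gamma> e) else Inr (e, t))"

definition geometric_realization :: "('v, 'e) pre_digraph \<Rightarrow> ('v + 'e \<times> real) topology" where
  "geometric_realization \<Gamma> = topology (\<lambda>U. U \<subseteq> realization_points \<Gamma> \<and>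
     (\<forall>e \<in> arcs \<Gamma>. openin (top_of_set {0..1}) {t \<in> {0..1}. edge_point \<Gamma> e t \<in> U}))"

lemma openin_geometric_realization:
  "openin (geometric_realization \<Gamma>) U \<longleftrightarrow> U \<subseteq> realization_points \<Gamma> \<and>
     (\<forall>e \<in> arcs \<Gamma>. openin (top_of_set {0..1}) {t \<in> {0..1}. edge_point \<Gamma> e t \<in> U})"
proof -
  let ?I = "top_of_set {0..1::real}"
  let ?pre = "\<lambda>e U. {t \<in> {0..1}. edge_point \<Gamma> e t \<in> U}"
  have "istopology (\<lambda>U. U \<subseteq> realization_points \<Gamma> \<and> (\<forall>e \<in> arcs \<Gamma>. openin ?I (?pre e U)))"
    unfolding istopology_def
  proof (intro conjI allI impI ballI)
    fix U V e
    assume "U \<subseteq> realization_points \<Gamma> \<and> (\<forall>e \<in> arcs \<Gamma>. openin ?I (?pre e U))"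
      and "V \<subseteq> realization_points \<Gamma> \<and> (\<forall>e \<in> arcs \<Gamma>. openin ?I (?pre e V))"
      and "e \<in> arcs \<Gamma>"
    then have "openin ?I (?pre e U \<inter> ?pre e V)"
      by blast
    moreover have "?pre e U \<inter> ?pre e V = ?pre e (U \<inter> V)"
      by auto
    ultimately show "openin ?I (?pre e (U \<inter> V))"
      by simp
  next
    fix \<K> e
    assume "\<forall>K\<in>\<K>. K \<subseteq> realization_points \<Gamma> \<and> (\<forall>e \<in> arcs \<Gamma>. openin ?I (?pre e K))"
      and "e \<in> arcs \<Gamma>"
    then have "openin ?I (\<Union>(?pre e ` \<K>))"
      by (intro openin_Union) blast
    moreover have "\<Union>(?pre e ` \<K>) = ?pre e (\<Union>\<K>)"
      by auto
    ultimately show "openin ?I (?pre e (\<Union>\<K>))"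
      by simp
  qed blast+
  then show ?thesis
    unfolding geometric_realization_def by simp
qed

lemma topspace_geometric_realization:
  assumes "wf_digraph \<Gamma>"
  shows "topspace (geometric_realization \<Gamma>) = realization_points \<Gamma>"
proof -
  have "{t \<in> {0..1}. edge_point \<Gamma> e t \<in> realization_points \<Gamma>} = {0..1}" if "e \<in> arcs \<Gamma>" for e
    using that wf_digraph.tail_in_verts[OF assms that] wf_digraph.head_in_verts[OF assms that]
    by (auto simp: edge_point_def realization_points_def image_iff)
  then have "openin (geometric_realization \<Gamma>) (realization_points \<Gamma>)"
    by (simp add: openin_geometric_realization)
  then show ?thesis
    unfolding topspace_def by (auto simp: openin_geometric_realization)
qed

definition planar :: "('v, 'e) pre_digraph \<Rightarrow> bool" where
  "planar \<Gamma> \<longleftrightarrow>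
     (\<exists>f. embedding_map (geometric_realization \<Gamma>) (top_of_set (sphere (0 :: real ^ 3) 1)) f)"

lemma (in group) wf_cayley_graph:
  assumes "S \<subseteq> carrier G"
  shows "wf_digraph (cayley_graph G S)"
  using assms by unfold_locales (auto simp: cayley_graph_def)

lemma (in group) wf_quotient_graph:
  assumes "S \<subseteq> carrier G" and "subgroup H G"
  shows "wf_digraph (quotient_graph G S H)"
proof
  fix e
  assume e: "e \<in> arcs (quotient_graph G S H)"
  then show "tail (quotient_graph G S H) e \<in> verts (quotient_graph G S H)"
    by (auto simp: quotient_graph_def)
  from e obtain x s where "e = (H #> x, s)" "x \<in> carrier G" "s \<in> S"
    by (auto simp: quotient_graph_def RCOSETS_def)
  moreover have "H #> x #> s = H #> (x \<otimes> s)"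
    using calculation assms by (intro coset_mult_assoc subgroup.subset) auto
  ultimately show "head (quotient_graph G S H) e \<in> verts (quotient_graph G S H)"
    using assms subgroup.subset[OF assms(2)] by (auto simp: quotient_graph_def intro!: rcosetsI)
qed

end

theory Submission
  imports Defs "HOL-Real_Asymp.Real_Asymp"
begin

text \<open>
  Write \<open>q = 2n - 1\<close>. The girth of \<open>\<Gamma>\<^sub>N\<close> is the least length \<open>\<ell>\<close> of a nontrivial element of the normal
  subgroup \<open>N\<close>. If \<open>\<Gamma>\<^sub>N\<close> is planar, then Euler's formula shows that every finite set \<open>X\<close> of vertices
  spans at most \<open>\<kappa> |X|\<close> edges, where \<open>\<kappa>\<close> tends to \<open>1\<close> as \<open>\<ell>\<close> grows: every edge borders at most two
  faces, and unless \<open>X\<close> spans a forest the boundary of every face contains a cycle.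

  By a layer-cake decomposition of \<open>f\<^sup>2\<close>, such a sparsity bound gives
  \<open>|\<langle>P f, f\<rangle>| \<le> \<rho> \<parallel>f\<parallel>\<^sup>2\<close> for the adjacency operator \<open>P\<close> of \<open>\<Gamma>\<^sub>N\<close>, where \<open>\<rho>\<close> tends to the spectral
  radius \<open>2 sqrt q\<close> of the tree. Comparing the Green functions of the tree and of \<open>\<Gamma>\<^sub>N\<close>, the series
  of \<open>t ^ |h|\<close> over \<open>h\<close> in \<open>N\<close> converges as soon as \<open>q t + 1 / t > \<rho>\<close> and \<open>t < 1 / sqrt q\<close>, whence the
  upper bound on \<open>\<delta>(N)\<close>. The lower bound \<open>ln q / 2\<close> comes from the conjugates of a single nontrivial
  element of \<open>N\<close>.

  For the growth, sparsity of the ball of radius \<open>m + 1\<close> around a vertex forces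
  \<open>|B (m + 1)| \<ge> ((q + 1 - \<kappa>) / \<kappa>) |B m|\<close>, since all \<open>(q + 1)\<close>-stars around points of \<open>B m\<close> lie in
  \<open>B (m + 1)\<close>.
\<close>

section \<open>Plane graphs and Euler's inequality\<close>

text \<open>All constants degenerate to those of the tree as \<open>\<kappa>\<close> tends to 1; a
  finite subset of a tree spans fewer edges than it has points. The quadratic form estimate has a
  free parameter s and yields the constant (s - 1 / s) \<open>\<kappa>\<close> + (q + 1) / s. At
  \<open>\<kappa>\<close> = 1 this is s + q / s, least at s = sqrt q with value 2 sqrt q. On the
  other side, q t + 1 / t exceeds 2 sqrt q for every t < 1 / sqrt q. So each such t is admissible
  for all large k, and t can be taken as close to 1 / sqrt q as desired. Likewise (q + 1 -
  \<open>\<kappa>\<close>) / \<open>\<kappa>\<close> tends to q. The topological obstacle is that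
  edges are arbitrary arcs. Euler's formula is needed only as a lower bound for the number of faces
  and is obtained by adding one edge at a time; the effect of an edge on the faces is read off from
  Janiszewski's theorem and the Jordan curve theorem. A drawing on the sphere becomes a plane
  drawing by removing an interior point of one edge, and the resulting inequality has an edge to
  spare to pay for this loss.\<close>

lemma open_not_subset_arc:
  fixes \<gamma> :: "real \<Rightarrow> complex"
  assumes "arc \<gamma>" "open U" "U \<noteq> {}"
  shows "\<not> U \<subseteq> path_image \<gamma>"
proof
  assume U: "U \<subseteq> path_image \<gamma>"
  have "path_image \<gamma> homeomorphic {0..1::real}"
    by (simp add: assms homeomorphic_arc_image_interval)
  then obtain f f' where "homeomorphism (path_image \<gamma>) {0..1::real} f f'"
    by (auto simp: homeomorphic_def)
  then have "continuous_on U f" "inj_on f U"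
    using U by (auto simp: homeomorphism_def inj_on_def intro: continuous_on_subset) (metis subsetD)
  then show False
    using invariance_of_dimension[of U f] assms by simp
qed

text \<open>Edges are arcs, so there are no loops, but parallel edges may occur. The vertex set
  stays fixed while the notions below are taken for arbitrary subsets \<open>A\<close> of
  \<open>E\<close>, so that the drawing can be built up edge by edge.\<close>

locale plane_graph =
  fixes V :: "complex set" and E :: "'e set" and g :: "'e \<Rightarrow> real \<Rightarrow> complex"
  assumes finite_V: "finite V" and finite_E: "finite E"
    and arc_g: "e \<in> E \<Longrightarrow> arc (g e)"
    and ends_g: "e \<in> E \<Longrightarrow> path_image (g e) \<inter> V = {pathstart (g e), pathfinish (g e)}"
    and disjoint_g: "e \<in> E \<Longrightarrow> e' \<in> E \<Longrightarrow> e \<noteq> e' \<Longrightarrow> path_image (g e) \<inter> path_image (g e') \<subseteq> V"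
begin

definition support :: "'e set \<Rightarrow> complex set" where
  "support A = V \<union> (\<Union>e\<in>A. path_image (g e))"

definition faces :: "'e set \<Rightarrow> complex set set" where
  "faces A = components (- support A)"

definition adj :: "'e set \<Rightarrow> complex rel" where
  "adj A = (\<Union>e\<in>A. {(pathstart (g e), pathfinish (g e)), (pathfinish (g e), pathstart (g e))})"

text \<open>Used for \<open>e\<close> inside and outside \<open>A\<close>. In the latter case it
  says that adding \<open>e\<close> to \<open>A\<close> joins two different components.\<close>

definition bridge :: "'e \<Rightarrow> 'e set \<Rightarrow> bool" where
  "bridge e A \<longleftrightarrow> (pathstart (g e), pathfinish (g e)) \<notin> (adj (A - {e}))\<^sup>*"

lemma adj_mono: "A \<subseteq> B \<Longrightarrow> adj A \<subseteq> adj B"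
  by (auto simp: adj_def)

lemma sym_adj: "sym (adj A)"
  by (auto simp: adj_def sym_def)

lemma bridge_antimono: "A \<subseteq> B \<Longrightarrow> bridge e B \<Longrightarrow> bridge e A"
  unfolding bridge_def by (meson Diff_mono adj_mono order_refl rtrancl_mono subsetD)

lemma finite_subset_E: "A \<subseteq> E \<Longrightarrow> finite A"
  using finite_E finite_subset by blast

lemma compact_support: "A \<subseteq> E \<Longrightarrow> compact (support A)"
  unfolding support_def using finite_V finite_subset_E[of A] arc_g
  by (intro compact_Un finite_imp_compact compact_UN ballI compact_arc_image) auto

lemma closed_support: "A \<subseteq> E \<Longrightarrow> closed (support A)"
  by (simp add: compact_support compact_imp_closed)

lemma support_insert: "support (insert e A) = support A \<union> path_image (g e)"
  by (auto simp: support_def)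

lemma support_mono: "A \<subseteq> B \<Longrightarrow> support A \<subseteq> support B"
  by (auto simp: support_def)

lemma ends_in_V: "e \<in> E \<Longrightarrow> pathstart (g e) \<in> V \<and> pathfinish (g e) \<in> V"
  using ends_g by blast

section \<open>Separation of the plane by one more edge\<close>

lemma support_Int_edge:
  assumes "A \<subseteq> E" "e \<in> E - A"
  shows "support A \<inter> path_image (g e) = {pathstart (g e), pathfinish (g e)}"
proof -
  have "path_image (g a) \<inter> path_image (g e) \<subseteq> V" if "a \<in> A" for a
    using disjoint_g[of a e] that assms by auto
  then have "support A \<inter> path_image (g e) = V \<inter> path_image (g e)"
    by (auto simp: support_def)
  then show ?thesis
    using ends_g[of e] assms by auto
qed

lemma path_component_support:
  assumes "A \<subseteq> E" "(u, v) \<in> (adj A)\<^sup>*" "u \<in> V"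
  shows "path_component (support A) u v"
  using assms(2)
proof induction
  case base
  then show ?case
    using assms(3) by (auto simp: support_def intro: path_component_refl)
next
  case (step y z)
  then obtain e where e: "e \<in> A" "{y, z} = {pathstart (g e), pathfinish (g e)}"
    unfolding adj_def by auto
  then have "path (g e)" "path_image (g e) \<subseteq> support A"
    using assms(1) arc_g[of e] by (auto simp: support_def arc_imp_path)
  then have "path_component (support A) (pathstart (g e)) (pathfinish (g e))"
    unfolding path_component_def by blast
  then have "path_component (support A) y z"
    using e(2) path_component_sym by (auto simp: doubleton_eq_iff)
  then show ?case
    using step.IH path_component_trans by blast
qed

text \<open>Janiszewski's theorem: a compact and a closed set with connected intersection, neither
  of which separates two points, do not separate them jointly. Here \<open>support A\<close> falls
  into the disjoint compact sets \<open>K1\<close>, the component at the start of \<open>e\<close>,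
  and \<open>K2\<close>, the rest; each meets the edge in one end only. The theorem adds the edge to
  \<open>K1\<close>, then to \<open>K2\<close>, and finally glues the two results.\<close>

lemma bridge_not_separating:
  assumes "A \<subseteq> E" "e \<in> E - A" "bridge e A"
    and xy: "connected_component (- support A) x y" "x \<notin> path_image (g e)" "y \<notin> path_image (g e)"
  shows "connected_component (- support (insert e A)) x y"
proof -
  let ?s = "pathstart (g e)" and ?f = "pathfinish (g e)"
  let ?P = "path_image (g e)"
  define V1 where "V1 = {v \<in> V. (?s, v) \<in> (adj A)\<^sup>*}"
  define V2 where "V2 = V - V1"
  define A1 where "A1 = {a \<in> A. pathstart (g a) \<in> V1}"
  define A2 where "A2 = A - A1"
  define K1 where "K1 = V1 \<union> (\<Union>a\<in>A1. path_image (g a))"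
  define K2 where "K2 = V2 \<union> (\<Union>a\<in>A2. path_image (g a))"
  have e: "e \<in> E" "e \<notin> A" using assms by auto
  have K: "support A = K1 \<union> K2"
    by (auto simp: support_def K1_def K2_def V2_def A2_def V1_def A1_def)
  have V1s: "?s \<in> V1" and V2f: "?f \<in> V2"
    using ends_in_V[OF e(1)] assms(3) e(2) by (auto simp: V1_def V2_def bridge_def)
  have adjacent: "pathstart (g a) \<in> V1 \<longleftrightarrow> pathfinish (g a) \<in> V1" if "a \<in> A" for a
  proof -
    have "(pathstart (g a), pathfinish (g a)) \<in> adj A" "(pathfinish (g a), pathstart (g a)) \<in> adj A"
      using that by (auto simp: adj_def)
    then show ?thesis
      using ends_in_V[of a] that assms(1) unfolding V1_def
      by (auto intro: rtrancl_into_rtrancl)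
  qed
  have PV1: "path_image (g a) \<inter> V \<subseteq> V1" if "a \<in> A1" for a
  proof -
    have "a \<in> A" "a \<in> E" "pathstart (g a) \<in> V1"
      using that assms(1) by (auto simp: A1_def)
    then show ?thesis
      using ends_g[of a] adjacent[of a] by simp
  qed
  have PV2: "path_image (g a) \<inter> V \<subseteq> V2" if "a \<in> A2" for a
  proof -
    have "a \<in> A" "a \<in> E" "pathstart (g a) \<notin> V1"
      using that assms(1) by (auto simp: A1_def A2_def)
    then show ?thesis
      using ends_g[of a] adjacent[of a] ends_in_V[of a] by (simp add: V2_def)
  qed
  have PP: "path_image (g a) \<inter> path_image (g b) \<subseteq> V" if "a \<in> A" "b \<in> insert e A" "a \<noteq> b" for a b
    using disjoint_g[of a b] that assms by auto
  have KV1: "K1 \<inter> V = V1"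
    using PV1 by (auto simp: K1_def V1_def)
  have KV2: "K2 \<inter> V = V2"
    using PV2 by (auto simp: K2_def V2_def)
  have A12: "a \<in> A" "b \<in> A" "a \<noteq> b" if "a \<in> A1" "b \<in> A2" for a b
    using that by (auto simp: A1_def A2_def)
  have "K1 \<inter> K2 \<subseteq> V"
    using PP A12 by (auto simp: K1_def K2_def V1_def V2_def) blast
  then have dis: "K1 \<inter> K2 = {}"
    using KV1 KV2 by (auto simp: V2_def)
  have "K1 \<inter> ?P \<subseteq> V"
    using PP[of _ e] e(2) by (auto simp: K1_def V1_def A1_def)
  then have K1P: "K1 \<inter> ?P = {?s}"
    using KV1 ends_g[OF e(1)] V1s V2f by (auto simp: V2_def)
  have "K2 \<inter> ?P \<subseteq> V"
    using PP[of _ e] e(2) by (auto simp: K2_def V2_def A2_def)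
  have fin: "finite V1" "finite V2" "finite A1" "finite A2"
    using finite_V finite_subset_E[OF assms(1)] by (auto simp: V1_def V2_def A1_def A2_def)
  have "compact K1" "compact K2"
    unfolding K1_def K2_def using fin arc_g assms(1)
    by (intro compact_Un finite_imp_compact compact_UN ballI compact_arc_image; force simp: A1_def A2_def)+
  have cP: "compact ?P" "connected ?P" "connected (- ?P)"
    using arc_g[OF e(1)] by (auto simp: compact_arc_image connected_arc_image connected_arc_complement)
  have "connected_component (- ?P) x y"
    using cP(3) xy by (auto simp: connected_component_def)
  moreover have "connected_component (- K1) x y" "connected_component (- K2) x y"
    using xy(1) K by (auto intro: connected_component_of_subset)
  ultimately have 1: "connected_component (- (K1 \<union> ?P)) x y" "connected_component (- K2) x y"
    using Janiszewski[of K1 ?P x y] \<open>compact K1\<close> cP K1P compact_imp_closed by auto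
  have "connected_component (- (K2 \<union> ?P)) x y"
  proof (rule Janiszewski)
    have "K2 \<inter> ?P = V2 \<inter> {?s, ?f}"
      using \<open>K2 \<inter> ?P \<subseteq> V\<close> KV2 ends_g[OF e(1)] by blast
    also have "\<dots> = {?f}"
      using V1s V2f by (auto simp: V2_def)
    finally have "K2 \<inter> ?P = {?f}" .
    then show "connected (K2 \<inter> ?P)" by simp
  qed (use \<open>compact K2\<close> cP compact_imp_closed 1 \<open>connected_component (- ?P) x y\<close> in auto)
  \<comment> \<open>As \<open>K1\<close> and \<open>K2\<close> are disjoint, the two enlarged sets
    overlap exactly in the edge, which is connected.\<close>
  moreover have "(K1 \<union> ?P) \<inter> (K2 \<union> ?P) = ?P"
    using dis by auto
  ultimately have "connected_component (- ((K1 \<union> ?P) \<union> (K2 \<union> ?P))) x y"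
    using Janiszewski[of "K1 \<union> ?P" "K2 \<union> ?P" x y] 1 \<open>compact K1\<close> \<open>compact K2\<close> cP
    by (auto simp: compact_Un compact_imp_closed)
  moreover have "(K1 \<union> ?P) \<union> (K2 \<union> ?P) = support (insert e A)"
    by (auto simp: support_insert K)
  ultimately show ?thesis by simp
qed

text \<open>The ends of a non-bridge are joined by a path in \<open>support A\<close>, and an arc
  inside that path closes \<open>e\<close> up to a Jordan curve. The part of the curve in
  \<open>support A\<close> is exactly this arc, whence the connectedness that Janiszewski's theorem
  asks for.\<close>

lemma cycle_through_edge:
  assumes "A \<subseteq> E" "e \<in> E - A" "\<not> bridge e A"
  obtains c where "simple_path c" "pathfinish c = pathstart c"
    "path_image (g e) \<subseteq> path_image c" "path_image c \<subseteq> support (insert e A)"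
    "connected (support A \<inter> path_image c)"
proof -
  let ?s = "pathstart (g e)" and ?f = "pathfinish (g e)"
  have e: "e \<in> E" "e \<notin> A" using assms by auto
  have "(?s, ?f) \<in> (adj A)\<^sup>*"
    using assms(3) e(2) by (auto simp: bridge_def)
  then have "path_component (support A) ?s ?f"
    using path_component_support assms(1) ends_in_V[OF e(1)] by blast
  then obtain p where p: "path p" "path_image p \<subseteq> support A" "pathstart p = ?s" "pathfinish p = ?f"
    by (auto simp: path_component_def)
  obtain h where h: "arc h" "path_image h \<subseteq> path_image p" "pathstart h = ?s" "pathfinish h = ?f"
    using path_contains_arc[OF p(1,3,4)] arc_distinct_ends[OF arc_g[OF e(1)]] by metis
  have int: "support A \<inter> path_image (g e) = {?s, ?f}"
    using support_Int_edge assms by auto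
  have ends: "?s \<in> path_image h" "?f \<in> path_image h"
    using h by (metis pathstart_in_path_image pathfinish_in_path_image)+
  let ?c = "g e +++ reversepath h"
  have im: "path_image ?c = path_image (g e) \<union> path_image h"
    using h by (simp add: path_image_join)
  have inth: "path_image (g e) \<inter> path_image h = {?s, ?f}"
    using int p(2) h(2) ends by auto
  show ?thesis
  proof
    show "simple_path ?c"
      using arc_g[OF e(1)] h inth by (intro simple_path_join_loop) (auto simp: arc_reversepath)
    show "pathfinish ?c = pathstart ?c"
      using h by simp
    show "path_image (g e) \<subseteq> path_image ?c" "path_image ?c \<subseteq> support (insert e A)"
      using im h(2) p(2) by (auto simp: support_insert)
    have "support A \<inter> path_image h = path_image h"
      using p(2) h(2) by auto
    then have "support A \<inter> path_image ?c = path_image h"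
      unfolding im Int_Un_distrib int using ends by auto
    then show "connected (support A \<inter> path_image ?c)"
      using h(1) connected_arc_image by auto
  qed
qed

text \<open>Janiszewski's theorem for \<open>support A\<close> and the Jordan curve
  \<open>c\<close>: their union is the support after adding \<open>e\<close>, and points on the same
  side of \<open>c\<close> are not separated by \<open>c\<close>.\<close>

lemma same_side_not_separated:
  assumes "A \<subseteq> E" "e \<in> E - A"
    and c: "simple_path c" "pathfinish c = pathstart c"
    "path_image (g e) \<subseteq> path_image c" "path_image c \<subseteq> support (insert e A)"
    "connected (support A \<inter> path_image c)"
    and xy: "connected_component (- support A) x y" "x \<notin> path_image (g e)" "y \<notin> path_image (g e)"
      "x \<in> inside (path_image c) \<longleftrightarrow> y \<in> inside (path_image c)"
  shows "connected_component (- support (insert e A)) x y"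
proof -
  have un: "support A \<union> path_image c = support (insert e A)"
    using c(3,4) by (auto simp: support_insert)
  have J: "connected (inside (path_image c))" "connected (outside (path_image c))"
    "inside (path_image c) \<union> outside (path_image c) = - path_image c"
    using Jordan_inside_outside[OF c(1,2)] by auto
  have "x \<notin> support A" "y \<notin> support A"
    using xy(1) connected_component_in by fastforce+
  then have "x \<notin> path_image c" "y \<notin> path_image c"
    using c(4) xy by (auto simp: support_insert)
  then have "connected_component (- path_image c) x y"
    using J xy(4) unfolding connected_component_def
    by (metis ComplI UnE Un_upper1 Un_upper2)
  then have "connected_component (- (support A \<union> path_image c)) x y"
    using xy(1) compact_support[OF assms(1)] c(1,5)
    by (intro Janiszewski) (auto simp: closed_simple_path_image)
  then show ?thesis using un by simp
qed

text \<open>One Boolean tells the pieces of an old face apart: it is constant for a bridge, and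
  otherwise records the side of the Jordan curve through \<open>e\<close>.\<close>

lemma edge_at_most_two_sides:
  assumes "A \<subseteq> E" "e \<in> E - A"
  obtains side :: "complex \<Rightarrow> bool" where
    "\<And>x y. \<lbrakk>connected_component (- support A) x y; x \<notin> path_image (g e); y \<notin> path_image (g e);
       side x = side y\<rbrakk> \<Longrightarrow> connected_component (- support (insert e A)) x y"
proof (cases "bridge e A")
  case True
  then show ?thesis
    using bridge_not_separating[OF assms] that[of "\<lambda>_. True"] by blast
next
  case False
  then obtain c where c: "simple_path c" "pathfinish c = pathstart c"
    "path_image (g e) \<subseteq> path_image c" "path_image c \<subseteq> support (insert e A)"
    "connected (support A \<inter> path_image c)"
    using cycle_through_edge[OF assms False] by metis
  show ?thesis
    using same_side_not_separated[OF assms c] that[of "\<lambda>x. x \<in> inside (path_image c)"] by blast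
qed

section \<open>Faces and their behaviour under insertion of an edge\<close>

lemma open_face: "A \<subseteq> E \<Longrightarrow> W \<in> faces A \<Longrightarrow> open W"
  unfolding faces_def using open_components[of "- support A" W] closed_support[of A] by (simp add: open_Compl)

lemma face_nonempty: "W \<in> faces A \<Longrightarrow> W \<noteq> {}"
  unfolding faces_def by (rule in_components_nonempty)

lemma face_subset: "X \<in> faces A \<Longrightarrow> X \<subseteq> - support A"
  unfolding faces_def by (rule in_components_subset)

lemma face_connected: "X \<in> faces A \<Longrightarrow> connected X"
  unfolding faces_def by (rule in_components_connected)

lemma face_eq_component:
  assumes "X \<in> faces A" "x \<in> X"
  shows "X = connected_component_set (- support A) x"
  using assms connected_component_eq unfolding faces_def components_iff by blast

lemma face_eqI:
  assumes "X \<in> faces A" "Y \<in> faces A" "x \<in> X" "y \<in> Y" "connected_component (- support A) x y"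
  shows "X = Y"
  using face_eq_component[OF assms(1,3)] face_eq_component[OF assms(2,4)] connected_component_eq_eq[of "- support A" x y] assms
  by (metis connected_component_in)

lemma same_face:
  assumes "X \<in> faces A" "x \<in> X" "y \<in> X"
  shows "connected_component (- support A) x y"
  using face_eq_component[OF assms(1,2)] assms(3) by auto

lemma in_some_face:
  assumes "x \<notin> support A"
  obtains X where "X \<in> faces A" "x \<in> X"
proof
  show "connected_component_set (- support A) x \<in> faces A"
    unfolding faces_def by (rule componentsI) (use assms in auto)
  show "x \<in> connected_component_set (- support A) x"
    using assms by auto
qed

lemma face_superset:
  assumes "A \<subseteq> B" "X \<in> faces B"
  obtains W where "W \<in> faces A" "X \<subseteq> W"
proof -
  have "X \<subseteq> - support A" "X \<noteq> {}" "connected X"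
    using assms support_mono[OF assms(1)] face_subset face_connected face_nonempty by blast+
  then show ?thesis
    using exists_component_superset[of X "- support A"] that unfolding faces_def by auto
qed

lemma face_subset_meets:
  assumes "A \<subseteq> B" "X \<in> faces B" "W \<in> faces A" "X \<inter> W \<noteq> {}"
  shows "X \<subseteq> W"
proof -
  obtain W' where "W' \<in> faces A" "X \<subseteq> W'"
    using face_superset assms by metis
  then show ?thesis
    using assms components_nonoverlap[of W "- support A" W'] unfolding faces_def by blast
qed

text \<open>The value of \<open>side\<close> at a chosen point maps the pieces of \<open>W\<close>
  injectively to \<open>bool\<close>.\<close>

lemma subfaces_card:
  assumes "A \<subseteq> E" "e \<in> E - A" "W \<in> faces A"
  shows "finite {X \<in> faces (insert e A). X \<subseteq> W}" "card {X \<in> faces (insert e A). X \<subseteq> W} \<le> 2"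
proof -
  obtain side :: "complex \<Rightarrow> bool" where side:
    "\<And>x y. \<lbrakk>connected_component (- support A) x y; x \<notin> path_image (g e); y \<notin> path_image (g e);
       side x = side y\<rbrakk> \<Longrightarrow> connected_component (- support (insert e A)) x y"
    using edge_at_most_two_sides assms by metis
  let ?F = "{X \<in> faces (insert e A). X \<subseteq> W}"
  let ?s = "\<lambda>X. side (SOME x. x \<in> X)"
  have inj: "inj_on ?s ?F"
  proof (rule inj_onI)
    fix X Y assume XY: "X \<in> ?F" "Y \<in> ?F" "?s X = ?s Y"
    have "X \<noteq> {}" "Y \<noteq> {}"
      using XY face_nonempty by auto
    then have "(SOME x. x \<in> X) \<in> X" "(SOME x. x \<in> Y) \<in> Y"
      by (simp_all add: some_in_eq)
    then obtain x y where xy: "x \<in> X" "y \<in> Y" "side x = side y"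
      using XY(3) by blast
    moreover have "X \<subseteq> - support (insert e A)" "Y \<subseteq> - support (insert e A)"
      using XY face_subset by auto
    moreover have "connected_component (- support A) x y"
      using same_face[OF assms(3)] XY xy by blast
    ultimately have "connected_component (- support (insert e A)) x y"
      using side[of x y] by (auto simp: support_insert)
    then show "X = Y"
      using face_eqI XY xy by blast
  qed
  show "finite ?F"
    using inj_on_finite[OF inj, of UNIV] by simp
  show "card ?F \<le> 2"
    using card_inj_on_le[OF inj, of UNIV] by simp
qed

text \<open>An arc cannot cover the nonempty open set \<open>W\<close>, so some point of
  \<open>W\<close> survives the insertion.\<close>

lemma face_contains_subface:
  assumes "A \<subseteq> E" "e \<in> E - A" "W \<in> faces A"
  shows "\<exists>X \<in> faces (insert e A). X \<subseteq> W"
proof -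
  have "\<not> W \<subseteq> path_image (g e)"
    using open_not_subset_arc[of "g e" W] arc_g[of e] open_face[OF assms(1,3)] face_nonempty[OF assms(3)] assms(2)
    by simp
  then obtain x where x: "x \<in> W" "x \<notin> path_image (g e)" by auto
  then have "x \<notin> support (insert e A)"
    using face_subset[OF assms(3)] by (auto simp: support_insert)
  then obtain X where X: "X \<in> faces (insert e A)" "x \<in> X"
    using in_some_face by blast
  then show ?thesis
    using face_subset_meets[of A "insert e A" X W] x assms by auto
qed

text \<open>A point \<open>p\<close> of the edge off \<open>support A\<close> lies on the Jordan
  curve through \<open>e\<close>, hence in the closure of both its sides. The open old face around
  \<open>p\<close> therefore meets both sides, and no new face can contain points of both.\<close>

lemma face_split:
  assumes "A \<subseteq> E" "e \<in> E - A" "\<not> bridge e A"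
  shows "\<exists>W \<in> faces A. \<exists>X \<in> faces (insert e A). \<exists>Y \<in> faces (insert e A). X \<noteq> Y \<and> X \<subseteq> W \<and> Y \<subseteq> W"
proof -
  obtain c where c: "simple_path c" "pathfinish c = pathstart c"
    "path_image (g e) \<subseteq> path_image c" "path_image c \<subseteq> support (insert e A)"
    using cycle_through_edge[OF assms] by metis
  have J: "inside (path_image c) \<inter> outside (path_image c) = {}"
    "open (inside (path_image c))" "open (outside (path_image c))"
    "inside (path_image c) \<union> outside (path_image c) = - path_image c"
    "frontier (inside (path_image c)) = path_image c" "frontier (outside (path_image c)) = path_image c"
    using Jordan_inside_outside[OF c(1,2)] by auto
  \<comment> \<open>Otherwise the edge would consist of its two ends only, which is not a connected
    set.\<close>
  have "\<not> path_image (g e) \<subseteq> support A"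
  proof
    assume "path_image (g e) \<subseteq> support A"
    then have "path_image (g e) = {pathstart (g e), pathfinish (g e)}"
      using support_Int_edge[OF assms(1,2)] by auto
    moreover have "connected (path_image (g e))" "pathstart (g e) \<noteq> pathfinish (g e)"
      using arc_g[of e] assms(2) connected_arc_image arc_distinct_ends[of "g e"] by auto
    ultimately show False
      using connected_finite_iff_sing[of "path_image (g e)"]
      by (metis doubleton_eq_iff empty_not_insert finite.emptyI finite.insertI insert_absorb2)
  qed
  then obtain p where p: "p \<in> path_image (g e)" "p \<notin> support A" by auto
  then obtain W where W: "W \<in> faces A" "p \<in> W"
    using in_some_face by blast
  have "open W" using open_face assms(1) W by blast
  have pc: "p \<in> closure (inside (path_image c))" "p \<in> closure (outside (path_image c))"
    using J p(1) c(3) by (auto simp: frontier_def)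
  have "W \<inter> inside (path_image c) \<noteq> {}" "W \<inter> outside (path_image c) \<noteq> {}"
    using pc W(2) open_Int_closure_eq_empty[OF \<open>open W\<close>] by (metis IntI empty_iff)+
  then obtain x y where xy: "x \<in> W" "x \<in> inside (path_image c)" "y \<in> W" "y \<in> outside (path_image c)"
    by blast
  have "W \<subseteq> - support A"
    using W(1) by (rule face_subset)
  moreover have "x \<notin> path_image c" "y \<notin> path_image c"
    using xy J(4) by blast+
  ultimately have "x \<notin> support (insert e A)" "y \<notin> support (insert e A)"
    using xy c(3) by (auto simp: support_insert)
  then obtain X Y where XY: "X \<in> faces (insert e A)" "x \<in> X" "Y \<in> faces (insert e A)" "y \<in> Y"
    using in_some_face by metis
  have "X \<subseteq> W" "Y \<subseteq> W"
    using face_subset_meets[of A "insert e A" _ W] XY xy W by blast+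
  moreover have "X \<noteq> Y"
  proof
    assume "X = Y"
    moreover have "connected X" "X \<subseteq> - path_image c"
      using face_connected[OF XY(1)] face_subset[OF XY(1)] c(4) by auto
    ultimately show False
      using connectedD[of X "inside (path_image c)" "outside (path_image c)"] J xy XY by auto
  qed
  ultimately show ?thesis
    using W XY by blast
qed

section \<open>Counting faces: Euler's inequality\<close>

lemma faces_empty: "faces {} = {- V}"
proof -
  have "connected (- V)"
    using path_connected_complement_countable[of V] finite_V
    by (simp add: countable_finite path_connected_imp_connected)
  moreover have "- V \<noteq> {}"
    using finite_V infinite_UNIV_char_0 by (metis Compl_eq_Diff_UNIV Diff_eq_empty_iff finite_subset)
  ultimately show ?thesis
    by (simp add: faces_def support_def components_eq_sing_iff)
qed

lemma finite_faces:
  assumes "A \<subseteq> E"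
  shows "finite (faces A)"
  using finite_subset_E[OF assms] assms
proof (induction A rule: finite_induct)
  case empty
  then show ?case by (simp add: faces_empty)
next
  case (insert e A)
  have "faces (insert e A) \<subseteq> (\<Union>W \<in> faces A. {X \<in> faces (insert e A). X \<subseteq> W})"
    using face_superset[of A "insert e A"] by blast
  moreover have "finite (\<Union>W \<in> faces A. {X \<in> faces (insert e A). X \<subseteq> W})"
    using insert subfaces_card[of A e] by auto
  ultimately show ?case
    by (rule finite_subset)
qed

text \<open>Choosing a piece \<open>\<sigma> W\<close> of every old face \<open>W\<close> is
  injective, because distinct faces are disjoint. If \<open>e\<close> is no bridge, one old face has
  a second piece, which \<open>\<sigma>\<close> misses.\<close>

lemma card_faces_insert:
  assumes "A \<subseteq> E" "e \<in> E - A"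
  shows "card (faces A) + (if bridge e A then 0 else 1) \<le> card (faces (insert e A))"
proof -
  have fin: "finite (faces A)" "finite (faces (insert e A))"
    using finite_faces assms by auto
  have "\<forall>W \<in> faces A. \<exists>X. X \<in> faces (insert e A) \<and> X \<subseteq> W"
    using face_contains_subface[OF assms] by blast
  then obtain \<sigma> where \<sigma>: "\<And>W. W \<in> faces A \<Longrightarrow> \<sigma> W \<in> faces (insert e A) \<and> \<sigma> W \<subseteq> W"
    by metis
  have unique: "W = W'" if "W \<in> faces A" "W' \<in> faces A" "X \<subseteq> W" "X \<subseteq> W'" "X \<in> faces (insert e A)" for X W W'
  proof -
    have "W \<inter> W' \<noteq> {}"
      using that face_nonempty[of X] by blast
    then show ?thesis
      using that components_nonoverlap[of W "- support A" W'] unfolding faces_def by blast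
  qed
  have inj: "inj_on \<sigma> (faces A)"
    using \<sigma> unique by (metis inj_onI)
  have card_image: "card (\<sigma> ` faces A) = card (faces A)"
    using inj by (rule card_image)
  show ?thesis
  proof (cases "bridge e A")
    case True
    have "\<sigma> ` faces A \<subseteq> faces (insert e A)"
      using \<sigma> by auto
    then have "card (\<sigma> ` faces A) \<le> card (faces (insert e A))"
      by (rule card_mono[OF fin(2)])
    then show ?thesis
      using card_image True by simp
  next
    case False
    then obtain W X Y where W: "W \<in> faces A" and XY: "X \<in> faces (insert e A)" "Y \<in> faces (insert e A)"
      "X \<noteq> Y" "X \<subseteq> W" "Y \<subseteq> W"
      using face_split[OF assms] by metis
    obtain Z where Z: "Z \<in> faces (insert e A)" "Z \<subseteq> W" "Z \<noteq> \<sigma> W"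
      using XY by metis
    have "Z \<notin> \<sigma> ` faces A"
      using Z W \<sigma> unique by (metis imageE)
    moreover have "insert Z (\<sigma> ` faces A) \<subseteq> faces (insert e A)"
      using \<sigma> Z by auto
    then have "card (insert Z (\<sigma> ` faces A)) \<le> card (faces (insert e A))"
      by (rule card_mono[OF fin(2)])
    ultimately show ?thesis
      using card_image fin(1) False by simp
  qed
qed

lemma Euler_inequality_labelled:
  fixes f :: "complex \<Rightarrow> nat"
  assumes "A \<subseteq> E" "\<And>u v. (u, v) \<in> adj A \<Longrightarrow> f u = f v"
  shows "card A + card (f ` V) + 1 \<le> card (faces A) + card V"
  using finite_subset_E[OF assms(1)] assms
proof (induction A arbitrary: f rule: finite_induct)
  case empty
  then show ?case
    using card_image_le[OF finite_V] by (simp add: faces_empty)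
next
  case (insert e A)
  have e: "A \<subseteq> E" "e \<in> E - A"
    using insert by auto
  have fA: "f u = f v" if "(u, v) \<in> adj A" for u v
    using insert.prems(2) that adj_mono[of A "insert e A"] by blast
  show ?case
  proof (cases "bridge e A")
    case False
    then show ?thesis
      using insert.IH[OF e(1), of f] fA card_faces_insert[OF e] insert.hyps by simp
  next
    case True
    let ?s = "pathstart (g e)" and ?f = "pathfinish (g e)"
    \<comment> \<open>The component of the start of the bridge \<open>e\<close> gets a fresh label.
      Its old label is still attained at the other end of \<open>e\<close>, so the number of labels
      grows; this pays for an edge that need not create a face.\<close>
    define k where "k = Suc (Max (f ` V))"
    define f' where "f' v = (if (?s, v) \<in> (adj A)\<^sup>* then k else f v)" for v
    have k: "k \<notin> f ` V"
    proof
      assume "k \<in> f ` V"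
      then have "k \<le> Max (f ` V)" using finite_V by simp
      then show False by (simp add: k_def)
    qed
    have "f' u = f' v" if "(u, v) \<in> adj A" for u v
    proof -
      have "(v, u) \<in> adj A" using that sym_adj by (auto dest: symD)
      then show ?thesis
        using that fA[OF that] unfolding f'_def by (auto intro: rtrancl_into_rtrancl)
    qed
    then have IH: "card A + card (f' ` V) + 1 \<le> card (faces A) + card V"
      using insert.IH[OF e(1)] by blast
    have const: "f v = f ?s" if "(?s, v) \<in> (adj A)\<^sup>*" for v
      using that by induction (use fA in auto)
    have "(?s, ?f) \<in> adj (insert e A)"
      by (auto simp: adj_def)
    then have "f ?s = f ?f"
      using insert.prems(2) by blast
    moreover have "(?s, ?f) \<notin> (adj A)\<^sup>*"
      using True e by (simp add: bridge_def)
    ultimately have f'_end: "f' ?f = f ?s"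
      by (simp add: f'_def)
    have ends: "?s \<in> V" "?f \<in> V"
      using ends_in_V e(2) by auto
    have "k = f' ?s"
      by (simp add: f'_def)
    then have "k \<in> f' ` V"
      using ends(1) by (rule image_eqI)
    moreover have "f w \<in> f' ` V" if "w \<in> V" for w
    proof (cases "(?s, w) \<in> (adj A)\<^sup>*")
      case True
      then have "f w = f' ?f" using const[OF True] f'_end by metis
      then show ?thesis using ends(2) by (metis imageI)
    next
      case False
      then have "f w = f' w" by (simp add: f'_def)
      then show ?thesis using that by (metis imageI)
    qed
    ultimately have "insert k (f ` V) \<subseteq> f' ` V"
      by blast
    then have "card (insert k (f ` V)) \<le> card (f' ` V)"
      using finite_V by (intro card_mono) auto
    then have "Suc (card (f ` V)) \<le> card (f' ` V)"
      using k finite_V by simp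
    then show ?thesis
      using IH card_faces_insert[OF e] True insert.hyps by simp
  qed
qed

lemma Euler_inequality: "V \<noteq> {} \<Longrightarrow> card E + 2 \<le> card (faces E) + card V"
  using Euler_inequality_labelled[of E "\<lambda>_. 0"] by (simp add: image_constant_conv)

section \<open>Faces and the edges on their boundary\<close>

definition incident :: "complex set \<Rightarrow> 'e \<Rightarrow> bool" where
  "incident X e \<longleftrightarrow> closure X \<inter> (path_image (g e) - V) \<noteq> {}"

lemma connected_edge_interior:
  assumes "e \<in> E"
  shows "connected (path_image (g e) - V)"
proof -
  have "path_image (g e) - V = path_image (g e) - {pathstart (g e), pathfinish (g e)}"
    using ends_g[OF assms] by auto
  then show ?thesis
    using connected_simple_path_endless arc_g[OF assms] arc_imp_simple_path by metis
qed

text \<open>The edge without its ends is connected, so it lies in one face \<open>U\<close> of the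
  drawing without \<open>e\<close>. Since \<open>U\<close> is open, every face incident with
  \<open>e\<close> meets \<open>U\<close> and is thus a piece of it; there are at most two
  pieces.\<close>

lemma card_incident_faces:
  assumes "e \<in> E"
  shows "card {X \<in> faces E. incident X e} \<le> 2"
proof (cases "{X \<in> faces E. incident X e} = {}")
  case True
  then show ?thesis by (metis card.empty zero_le)
next
  case False
  let ?A = "E - {e}"
  have A: "?A \<subseteq> E" "e \<in> E - ?A" "insert e ?A = E"
    using assms by auto
  have "support ?A \<inter> path_image (g e) \<subseteq> V"
    using support_Int_edge[OF A(1,2)] ends_in_V[OF assms] by simp
  then have sub: "path_image (g e) - V \<subseteq> - support ?A"
    by blast
  have "- support ?A \<noteq> {}"
    using False sub unfolding incident_def by blast
  then obtain U where U: "U \<in> faces ?A" "path_image (g e) - V \<subseteq> U"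
    using exists_component_superset[OF sub] connected_edge_interior[OF assms]
    unfolding faces_def by auto
  have "open U" using open_face[OF A(1) U(1)] .
  have "X \<subseteq> U" if X: "X \<in> faces E" "incident X e" for X
  proof -
    have "closure X \<inter> U \<noteq> {}"
      using X(2) U(2) unfolding incident_def by blast
    then have "X \<inter> U \<noteq> {}"
      using \<open>open U\<close> open_Int_closure_eq_empty by (metis Int_commute)
    then show ?thesis
      using face_subset_meets[of ?A E X U] X U by auto
  qed
  then have "{X \<in> faces E. incident X e} \<subseteq> {X \<in> faces (insert e ?A). X \<subseteq> U}"
    using A by auto
  then show ?thesis
    by (rule order_trans[OF card_mono[OF subfaces_card(1)[OF A(1,2) U(1)]] subfaces_card(2)[OF A(1,2) U(1)]])
qed

text \<open>Adding a bridge separates nothing, and bridges remain bridges in smaller edge sets, so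
  the forest can be built up edge by edge.\<close>

lemma connected_complement_forest:
  assumes "B \<subseteq> E" "\<And>e. e \<in> B \<Longrightarrow> bridge e B"
  shows "connected (- support B)"
  using finite_subset_E[OF assms(1)] assms
proof (induction B rule: finite_induct)
  case empty
  then show ?case
    using faces_empty in_components_connected[of "- V" "- support {}"] by (simp add: faces_def support_def)
next
  case (insert e B)
  have e: "B \<subseteq> E" "e \<in> E - B" "bridge e B"
    using insert bridge_antimono[of B "insert e B" e] by auto
  have "bridge e' B" if "e' \<in> B" for e'
    using insert.prems(2) that bridge_antimono[of B "insert e B" e'] by auto
  then have con: "connected (- support B)"
    using insert.IH e by blast
  show ?case
    unfolding connected_iff_connected_component
  proof (intro ballI)
    fix x y assume xy: "x \<in> - support (insert e B)" "y \<in> - support (insert e B)"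
    then have "connected_component (- support B) x y"
      using con unfolding connected_component_def by (auto simp: support_insert)
    then show "connected_component (- support (insert e B)) x y"
      using bridge_not_separating[OF e] xy by (auto simp: support_insert)
  qed
qed

text \<open>The frontier of \<open>X\<close> lies on its incident edges and the vertices. If these
  edges formed a forest, the complement of their support would be connected, would meet
  \<open>X\<close> but not its frontier, and so would lie in \<open>X\<close>, making
  \<open>X\<close> the only face.\<close>

lemma incident_edges_not_forest:
  assumes "X \<in> faces E" "card (faces E) \<noteq> 1"
  shows "\<exists>e \<in> {e \<in> E. incident X e}. \<not> bridge e {e \<in> E. incident X e}"
proof (rule ccontr)
  let ?B = "{e \<in> E. incident X e}"
  assume "\<not> ?thesis"
  then have con: "connected (- support ?B)"
    by (intro connected_complement_forest) auto
  have X: "X \<noteq> {}" "X \<subseteq> - support E"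
    using face_nonempty face_subset assms by auto
  have "frontier X \<subseteq> support ?B"
  proof
    fix x assume x: "x \<in> frontier X"
    have "frontier X \<subseteq> support E"
      using frontier_of_components_closed_complement[of "support E" X] closed_support[of E] assms(1)
      by (simp add: faces_def)
    then consider "x \<in> V" | e where "e \<in> E" "x \<in> path_image (g e)" "x \<notin> V"
      using x by (auto simp: support_def)
    then show "x \<in> support ?B"
    proof cases
      case 1
      then show ?thesis by (simp add: support_def)
    next
      case 2
      then have "incident X e"
        using x unfolding incident_def frontier_def by blast
      then show ?thesis
        using 2 by (auto simp: support_def)
    qed
  qed
  then have "- support ?B \<inter> frontier X = {}" by auto
  moreover have "- support ?B \<inter> X \<noteq> {}"
    using X support_mono[of ?B E] by blast
  ultimately have "- support ?B \<subseteq> X"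
    using connected_Int_frontier[OF con, of X] by blast
  then have "- support E = X"
    using X support_mono[of ?B E] by blast
  then have "faces E = {X}"
    using assms(1) in_components_connected[of X "- support E"] X(1)
    unfolding faces_def by (simp add: components_eq_sing_iff)
  then show False
    using assms(2) by simp
qed

text \<open>Each face has at least \<open>l\<close> incident edges, since these contain a cycle, and
  each edge is incident with at most two faces. Hence \<open>l\<close> times the number of faces is
  at most \<open>2 * card E\<close>, and Euler's inequality eliminates the faces. The summand 1 on
  the left restores the edge given up when the sphere is punctured.\<close>

theorem edge_bound_girth:
  assumes girth: "\<And>B e. \<lbrakk>B \<subseteq> E; e \<in> B; \<not> bridge e B\<rbrakk> \<Longrightarrow> l \<le> card B"
    and "V \<noteq> {}"
  shows "real (card E + 1) * (real l - 2) \<le> real (card V) * real l"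
proof (cases "card (faces E) = 1")
  \<comment> \<open>With a single face there may be no cycle at all; Euler's inequality alone then
    gives the bound for a forest.\<close>
  case True
  then have "real (card E + 1) \<le> real (card V)"
    using Euler_inequality assms by simp
  then have "real (card E + 1) * real l \<le> real (card V) * real l"
    by (rule mult_right_mono) simp
  then show ?thesis
    by (simp add: algebra_simps)
next
  case False
  have "l * card (faces E) = (\<Sum>X \<in> faces E. l)" by simp
  also have "\<dots> \<le> (\<Sum>X \<in> faces E. card {e \<in> E. incident X e})"
  proof (rule sum_mono)
    fix X assume "X \<in> faces E"
    then obtain e where "e \<in> {e \<in> E. incident X e}" "\<not> bridge e {e \<in> E. incident X e}"
      using incident_edges_not_forest[OF _ False] by blast
    then show "l \<le> card {e \<in> E. incident X e}"
      using girth[of "{e \<in> E. incident X e}" e] by auto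
  qed
  also have "\<dots> = (\<Sum>e \<in> E. card {X \<in> faces E. incident X e})"
    using finite_faces finite_E by (intro sum_multicount_gen) auto
  also have "\<dots> \<le> (\<Sum>e \<in> E. 2)"
    using card_incident_faces by (intro sum_mono)
  finally have "l * card (faces E) \<le> 2 * card E" by simp
  moreover have "l * (card E + 2) \<le> l * (card (faces E) + card V)"
    by (rule mult_le_mono2[OF Euler_inequality[OF assms(2)]])
  ultimately have "l * (card E + 2) \<le> 2 * card E + l * card V"
    by (simp add: algebra_simps)
  then have "real (l * (card E + 2)) \<le> real (2 * card E + l * card V)"
    by (simp only: of_nat_le_iff)
  then show ?thesis
    by (simp add: algebra_simps)
qed

end

section \<open>Planar graphs of large girth are sparse\<close>

definition adjacency :: "('v, 'e) pre_digraph \<Rightarrow> 'e set \<Rightarrow> 'v rel" where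
  "adjacency \<Gamma> A = (\<Union>e\<in>A. {(tail \<Gamma> e, head \<Gamma> e), (head \<Gamma> e, tail \<Gamma> e)})"

lemma continuous_map_edge_point:
  assumes "wf_digraph \<Gamma>" "e \<in> arcs \<Gamma>"
  shows "continuous_map (top_of_set {0..1}) (geometric_realization \<Gamma>) (edge_point \<Gamma> e)"
  unfolding continuous_map_def
proof (intro conjI allI impI)
  show "edge_point \<Gamma> e \<in> topspace (top_of_set {0..1}) \<rightarrow> topspace (geometric_realization \<Gamma>)"
    using assms wf_digraph.tail_in_verts[OF assms] wf_digraph.head_in_verts[OF assms]
    by (auto simp: topspace_geometric_realization edge_point_def realization_points_def)
  fix U assume "openin (geometric_realization \<Gamma>) U"
  then show "openin (top_of_set {0..1}) {x \<in> topspace (top_of_set {0..1}). edge_point \<Gamma> e x \<in> U}"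
    using assms(2) by (simp add: openin_geometric_realization)
qed

lemma punctured_sphere_plane:
  fixes p :: "real ^ 3"
  assumes "p \<in> sphere 0 1"
  obtains h :: "real ^ 3 \<Rightarrow> complex" where
    "continuous_on (sphere 0 1 - {p}) h" "inj_on h (sphere 0 1 - {p})"
proof -
  have "(sphere 0 1 - {p}) homeomorphic (UNIV :: complex set)"
    using assms by (intro homeomorphic_punctured_sphere_affine) (auto simp: aff_dim_UNIV)
  then obtain h k where "homeomorphism (sphere 0 1 - {p}) (UNIV :: complex set) h k"
    by (auto simp: homeomorphic_def)
  then show ?thesis
    using that[of h] unfolding homeomorphism_def by (metis inj_on_inverseI)
qed

text \<open>Puncturing the sphere at an interior point of an edge \<open>e0\<close> in
  \<open>A\<close> leaves a plane drawing of the other edges of \<open>A\<close>. The cycle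
  condition is combinatorial and carries over because vertices are drawn injectively.\<close>

theorem planar_edge_bound:
  assumes "wf_digraph \<Gamma>" "planar \<Gamma>"
    and X: "finite X" "X \<subseteq> verts \<Gamma>"
    and A: "finite A" "A \<subseteq> arcs \<Gamma>" "\<And>e. e \<in> A \<Longrightarrow> tail \<Gamma> e \<in> X \<and> head \<Gamma> e \<in> X"
    and girth: "\<And>B e. \<lbrakk>B \<subseteq> A; e \<in> B; (tail \<Gamma> e, head \<Gamma> e) \<in> (adjacency \<Gamma> (B - {e}))\<^sup>*\<rbrakk> \<Longrightarrow> l \<le> card B"
    and "l \<ge> 2"
  shows "real (card A) * (real l - 2) \<le> real (card X) * real l"
proof (cases "A = {}")
  case True
  then show ?thesis by simp
next
  case False
  then obtain e0 where e0: "e0 \<in> A" by auto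
  let ?T = "geometric_realization \<Gamma>" and ?S = "sphere (0 :: real ^ 3) 1"
  obtain f where f: "embedding_map ?T (top_of_set ?S) f"
    using assms(2) unfolding planar_def by auto
  have top: "topspace ?T = realization_points \<Gamma>"
    using topspace_geometric_realization assms(1) by blast
  have contf: "continuous_map ?T (top_of_set ?S) f"
    using f homeomorphic_imp_continuous_map continuous_map_into_fulltopology unfolding embedding_map_def by metis
  have injf: "inj_on f (realization_points \<Gamma>)"
    using f homeomorphic_imp_injective_map top unfolding embedding_map_def by metis
  have rp: "edge_point \<Gamma> e t \<in> realization_points \<Gamma>" if "e \<in> arcs \<Gamma>" "t \<in> {0..1}" for e t
    using continuous_map_edge_point[OF assms(1) that(1)] that(2) top
    by (auto simp: continuous_map_def)
  \<comment> \<open>The midpoint of \<open>e0\<close> is no vertex and lies on no other edge, so the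
    puncture destroys \<open>e0\<close> only.\<close>
  define p where "p = f (edge_point \<Gamma> e0 (1/2))"
  have fS: "f z \<in> ?S" if "z \<in> realization_points \<Gamma>" for z
    using contf that top by (auto simp: continuous_map_def)
  have e0p: "edge_point \<Gamma> e0 (1/2) = Inr (e0, 1/2)"
    by (simp add: edge_point_def)
  have e0rp: "Inr (e0, 1/2) \<in> realization_points \<Gamma>"
    using rp[of e0 "1/2"] e0 A(2) e0p by auto
  have "p \<in> ?S"
    using fS e0rp e0p by (simp add: p_def)
  then obtain h :: "real ^ 3 \<Rightarrow> complex" where h: "continuous_on (?S - {p}) h" "inj_on h (?S - {p})"
    using punctured_sphere_plane by blast
  define \<Phi> where "\<Phi> z = h (f z)" for z
  have fSp: "f z \<in> ?S - {p}" if "z \<in> realization_points \<Gamma>" "z \<noteq> Inr (e0, 1/2)" for z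
    using fS[OF that(1)] inj_onD[OF injf _ that(1) e0rp] that e0p unfolding p_def by auto
  have inj\<Phi>: "inj_on \<Phi> (realization_points \<Gamma> - {Inr (e0, 1/2)})"
  proof (rule inj_onI)
    fix y z assume y: "y \<in> realization_points \<Gamma> - {Inr (e0, 1/2)}" and z: "z \<in> realization_points \<Gamma> - {Inr (e0, 1/2)}"
      and eq: "\<Phi> y = \<Phi> z"
    have "f y = f z"
      using inj_onD[OF h(2)] eq fSp y z unfolding \<Phi>_def by auto
    then show "y = z"
      using inj_onD[OF injf] y z by auto
  qed
  have Inl_rp: "Inl v \<in> realization_points \<Gamma> - {Inr (e0, 1/2)}" if "v \<in> X" for v
    using that X by (auto simp: realization_points_def)
  define V where "V = (\<lambda>v. \<Phi> (Inl v)) ` X"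
  define E where "E = A - {e0}"
  define g where "g e t = \<Phi> (edge_point \<Gamma> e t)" for e t
  have E: "e \<in> arcs \<Gamma>" "tail \<Gamma> e \<in> X" "head \<Gamma> e \<in> X" "e \<noteq> e0" if "e \<in> E" for e
    using that A by (auto simp: E_def)
  have rp': "edge_point \<Gamma> e t \<in> realization_points \<Gamma> - {Inr (e0, 1/2)}" if "e \<in> E" "t \<in> {0..1}" for e t
    using rp[OF E(1)[OF that(1)] that(2)] E(4)[OF that(1)] by (auto simp: edge_point_def)
  have injV: "inj_on (\<lambda>v. \<Phi> (Inl v)) X"
    using inj_onD[OF inj\<Phi>] Inl_rp by (intro inj_onI) blast
  \<comment> \<open>A loop is a cycle with one edge, excluded by \<open>l \<ge> 2\<close>; this is
    what makes the drawn edges arcs.\<close>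
  have no_loop: "tail \<Gamma> e \<noteq> head \<Gamma> e" if "e \<in> A" for e
    using girth[of "{e}" e] that \<open>l \<ge> 2\<close> by auto
  have g_ends: "pathstart (g e) = \<Phi> (Inl (tail \<Gamma> e))" "pathfinish (g e) = \<Phi> (Inl (head \<Gamma> e))" for e
    by (simp_all add: pathstart_def pathfinish_def g_def edge_point_def)
  have path_g: "path (g e)" if "e \<in> E" for e
  proof -
    have "continuous_map (top_of_set {0..1}) (top_of_set ?S) (f \<circ> edge_point \<Gamma> e)"
      using continuous_map_compose continuous_map_edge_point[OF assms(1) E(1)[OF that]] contf by blast
    then have "continuous_on {0..1} (f \<circ> edge_point \<Gamma> e)"
      by (simp add: continuous_map_in_subtopology)
    moreover have "(f \<circ> edge_point \<Gamma> e) ` {0..1} \<subseteq> ?S - {p}"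
    proof (rule image_subsetI)
      fix t :: real assume "t \<in> {0..1}"
      then show "(f \<circ> edge_point \<Gamma> e) t \<in> ?S - {p}"
        using fSp[of "edge_point \<Gamma> e t"] rp'[OF that] by simp
    qed
    ultimately have "continuous_on {0..1} (h \<circ> (f \<circ> edge_point \<Gamma> e))"
      using h(1) continuous_on_compose continuous_on_subset by blast
    moreover have "g e = h \<circ> (f \<circ> edge_point \<Gamma> e)"
      by (auto simp: g_def \<Phi>_def)
    ultimately show ?thesis
      by (simp add: path_def)
  qed
  have g_eqD: "edge_point \<Gamma> e s = edge_point \<Gamma> e' t"
    if "g e s = g e' t" "e \<in> E" "e' \<in> E" "s \<in> {0..1}" "t \<in> {0..1}" for e e' s t
    using inj_onD[OF inj\<Phi>] that rp' unfolding g_def by blast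
  have g_VD: "edge_point \<Gamma> e s \<in> {Inl (tail \<Gamma> e), Inl (head \<Gamma> e)}"
    if gV: "g e s \<in> V" "e \<in> E" "s \<in> {0..1}" for e s
  proof -
    obtain v where "v \<in> X" "\<Phi> (edge_point \<Gamma> e s) = \<Phi> (Inl v)"
      using gV(1) unfolding V_def g_def image_iff by blast
    then have "edge_point \<Gamma> e s = Inl v"
      using inj_onD[OF inj\<Phi>] rp'[OF gV(2,3)] Inl_rp by blast
    then show ?thesis
      by (auto simp: edge_point_def split: if_splits)
  qed
  interpret plane_graph V E g
  proof
    show "finite V" "finite E"
      using X A by (auto simp: V_def E_def)
  next
    fix e assume e: "e \<in> E"
    have "inj_on (g e) {0..1}"
    proof (rule inj_onI)
      fix s t :: real assume "s \<in> {0..1}" "t \<in> {0..1}" "g e s = g e t"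
      then have "edge_point \<Gamma> e s = edge_point \<Gamma> e t"
        using g_eqD e by blast
      then show "s = t"
        using no_loop[of e] e by (auto simp: edge_point_def E_def split: if_splits)
    qed
    then show "arc (g e)"
      using path_g[OF e] by (simp add: arc_def)
    show "path_image (g e) \<inter> V = {pathstart (g e), pathfinish (g e)}"
    proof
      show "path_image (g e) \<inter> V \<subseteq> {pathstart (g e), pathfinish (g e)}"
      proof
        fix z assume "z \<in> path_image (g e) \<inter> V"
        then obtain s where s: "s \<in> {0..1}" "z = g e s" "g e s \<in> V"
          by (auto simp: path_image_def)
        then show "z \<in> {pathstart (g e), pathfinish (g e)}"
          using g_VD[OF s(3) e s(1)] unfolding g_ends by (auto simp: g_def)
      qed
      show "{pathstart (g e), pathfinish (g e)} \<subseteq> path_image (g e) \<inter> V"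
        using E[OF e] pathstart_in_path_image[of "g e"] pathfinish_in_path_image[of "g e"]
        by (simp add: V_def g_ends)
    qed
  next
    fix e e' assume e: "e \<in> E" "e' \<in> E" "e \<noteq> e'"
    show "path_image (g e) \<inter> path_image (g e') \<subseteq> V"
    proof
      fix z assume "z \<in> path_image (g e) \<inter> path_image (g e')"
      then obtain s t where st: "s \<in> {0..1}" "t \<in> {0..1}" "z = g e s" "z = g e' t"
        by (auto simp: path_image_def)
      then have "edge_point \<Gamma> e s = edge_point \<Gamma> e' t"
        using g_eqD e by metis
      then have "s = 0 \<or> s = 1"
        using e(3) by (auto simp: edge_point_def split: if_splits)
      then show "z \<in> V"
        using st(3) E[OF e(1)] by (auto simp: V_def g_def edge_point_def)
    qed
  qed
  \<comment> \<open>Walks between drawn vertices come from walks in \<open>\<Gamma>\<close>, so a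
    non-bridge of the drawing closes a cycle in \<open>\<Gamma>\<close>.\<close>
  have lift: "\<exists>v \<in> X. w = \<Phi> (Inl v) \<and> (u, v) \<in> (adjacency \<Gamma> B)\<^sup>*"
    if "(\<Phi> (Inl u), w) \<in> (adj B)\<^sup>*" "u \<in> X" "B \<subseteq> E" for u w B
    using that(1)
  proof induction
    case base
    then show ?case using that by auto
  next
    case (step y z)
    then obtain v where v: "v \<in> X" "y = \<Phi> (Inl v)" "(u, v) \<in> (adjacency \<Gamma> B)\<^sup>*"
      by auto
    obtain e where e: "e \<in> B" "(y, z) \<in> {(\<Phi> (Inl (tail \<Gamma> e)), \<Phi> (Inl (head \<Gamma> e))), (\<Phi> (Inl (head \<Gamma> e)), \<Phi> (Inl (tail \<Gamma> e)))}"
      using step.hyps(2) unfolding adj_def g_ends by auto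
    have "e \<in> E" using e that by auto
    then obtain v' where "v' \<in> X" "z = \<Phi> (Inl v')" "(v, v') \<in> adjacency \<Gamma> B"
      using e v E[of e] inj_onD[OF injV] unfolding adjacency_def by auto
    then show ?case
      using v by (auto intro: rtrancl_into_rtrancl)
  qed
  have "real (card E + 1) * (real l - 2) \<le> real (card V) * real l"
  proof (rule edge_bound_girth)
    show "V \<noteq> {}"
      using A(3)[OF e0] by (auto simp: V_def)
    fix B e assume B: "B \<subseteq> E" "e \<in> B" "\<not> bridge e B"
    then have e: "e \<in> E" by auto
    have "(\<Phi> (Inl (tail \<Gamma> e)), \<Phi> (Inl (head \<Gamma> e))) \<in> (adj (B - {e}))\<^sup>*"
      using B(3) unfolding bridge_def g_ends by simp
    then obtain v where "v \<in> X" "\<Phi> (Inl (head \<Gamma> e)) = \<Phi> (Inl v)" "(tail \<Gamma> e, v) \<in> (adjacency \<Gamma> (B - {e}))\<^sup>*"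
      using lift[of "tail \<Gamma> e" _ "B - {e}"] E[OF e] B by blast
    then have "(tail \<Gamma> e, head \<Gamma> e) \<in> (adjacency \<Gamma> (B - {e}))\<^sup>*"
      using inj_onD[OF injV, of "head \<Gamma> e" v] E[OF e] by simp
    then show "l \<le> card B"
      using girth[of B e] B by (auto simp: E_def)
  qed
  moreover have "card E + 1 = card A"
    using e0 A(1) unfolding E_def by (simp add: card_Suc_Diff1 del: card_Diff_insert)
  moreover have "card V = card X"
    unfolding V_def using injV by (rule card_image)
  ultimately show ?thesis by (simp only:)
qed

section \<open>Walks and balls in sparse regular graphs\<close>

lemma limsup_root_le:
  assumes "\<And>m. a m \<le> 2 * (real m + 1) * r ^ m" "r \<ge> 0"
  shows "limsup (\<lambda>m. ereal (root m (a m))) \<le> ereal r"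
proof -
  have "(\<lambda>m. root m 4 * root m (real m) * r) \<longlonglongrightarrow> 1 * 1 * r"
    by (intro tendsto_intros LIMSEQ_root LIMSEQ_root_const) simp
  then have lim: "limsup (\<lambda>m. ereal (root m 4 * root m (real m) * r)) = ereal r"
    by (intro lim_imp_Limsup) auto
  have "eventually (\<lambda>m. ereal (root m (a m)) \<le> ereal (root m 4 * root m (real m) * r)) sequentially"
    using eventually_gt_at_top[of 0]
  proof eventually_elim
    case (elim m)
    have "a m \<le> 2 * (real m + 1) * r ^ m" by fact
    also have "\<dots> \<le> (4 * real m) * r ^ m"
      using elim assms(2) by (intro mult_right_mono) auto
    finally have "root m (a m) \<le> root m (4 * real m * r ^ m)"
      using elim by simp
    also have "\<dots> = root m 4 * root m (real m) * r"
      using elim assms(2) by (simp add: real_root_mult real_root_power_cancel)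
    finally show ?case by simp
  qed
  then show ?thesis
    unfolding lim[symmetric] by (rule Limsup_mono)
qed

lemma limsup_root_ge:
  assumes "\<And>m. r ^ m \<le> a m" "r \<ge> 0"
  shows "ereal r \<le> limsup (\<lambda>m. ereal (root m (a m)))"
proof (rule le_Limsup)
  show "eventually (\<lambda>m. ereal r \<le> ereal (root m (a m))) sequentially"
    using eventually_gt_at_top[of 0]
  proof eventually_elim
    case (elim m)
    have "r = root m (r ^ m)"
      using elim assms(2) by (simp add: real_root_power_cancel)
    also have "\<dots> \<le> root m (a m)"
      using elim assms(1) by simp
    finally show ?case by simp
  qed
qed simp

lemma relpow_sym:
  assumes "sym R" "(x, y) \<in> R ^^ k"
  shows "(y, x) \<in> R ^^ k"
  using assms(2)
proof (induction k arbitrary: y)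
  case (Suc k)
  then obtain z where "(x, z) \<in> R ^^ k" "(z, y) \<in> R" by auto
  then show ?case
    using Suc.IH symD[OF assms(1)] relpow_Suc_I2 by metis
qed simp

text \<open>Edges are encoded by labels at each vertex, with \<open>bar\<close> as reversal, so that
  walks are sequences of labels. The tree and its quotients are both of this kind with the letters
  as labels, and the covering map preserves labels.\<close>

locale labelled_graph =
  fixes W :: "'v set" and L :: "'l set" and act :: "'v \<Rightarrow> 'l \<Rightarrow> 'v" and bar :: "'l \<Rightarrow> 'l"
  assumes finite_L: "finite L"
    and act_closed: "x \<in> W \<Longrightarrow> l \<in> L \<Longrightarrow> act x l \<in> W"
    and bar_closed: "l \<in> L \<Longrightarrow> bar l \<in> L"
    and bar_bar: "l \<in> L \<Longrightarrow> bar (bar l) = l"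
    and act_bar: "x \<in> W \<Longrightarrow> l \<in> L \<Longrightarrow> act (act x l) (bar l) = x"
begin

text \<open>Oriented edges inside \<open>X\<close>. In the graphs used here every edge, loops
  included, gives two of them, which explains the factor 2 in the sparsity condition.\<close>

definition darts :: "'v set \<Rightarrow> ('v \<times> 'l) set" where
  "darts X = {(x, l) \<in> X \<times> L. act x l \<in> X}"

definition flip :: "'v \<times> 'l \<Rightarrow> 'v \<times> 'l" where
  "flip = (\<lambda>(x, l). (act x l, bar l))"

lemma finite_darts: "finite X \<Longrightarrow> finite (darts X)"
  unfolding darts_def using finite_L by (auto intro: finite_subset[of _ "X \<times> L"])

lemma flip_flip: "x \<in> W \<Longrightarrow> l \<in> L \<Longrightarrow> flip (flip (x, l)) = (x, l)"
  by (simp add: flip_def act_bar bar_bar)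

lemma bij_flip: "X \<subseteq> W \<Longrightarrow> bij_betw flip (darts X) (darts X)"
  by (rule bij_betw_byWitness[where f' = flip])
    (auto simp: darts_def flip_def act_bar bar_bar bar_closed subset_iff)

lemma sum_darts_swap:
  assumes "X \<subseteq> W"
  shows "(\<Sum>(x, l) \<in> darts X. h x (act x l)) = (\<Sum>(x, l) \<in> darts X. h (act x l) x)"
proof -
  have "(\<Sum>(x, l) \<in> darts X. h x (act x l)) = (\<Sum>p \<in> darts X. (\<lambda>(x, l). h x (act x l)) (flip p))"
    using sum.reindex_bij_betw[OF bij_flip[OF assms]] by (rule sym)
  also have "\<dots> = (\<Sum>(x, l) \<in> darts X. h (act x l) x)"
    using assms by (intro sum.cong) (auto simp: darts_def flip_def act_bar subset_iff)
  finally show ?thesis .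
qed

lemma sum_darts:
  fixes h :: "'v \<Rightarrow> 'v \<Rightarrow> real"
  assumes "finite X" "X \<subseteq> W" "\<And>x y. x \<in> X \<Longrightarrow> y \<in> W - X \<Longrightarrow> h x y = 0"
  shows "(\<Sum>x\<in>X. \<Sum>l\<in>L. h x (act x l)) = (\<Sum>(x, l) \<in> darts X. h x (act x l))"
proof -
  have "(\<Sum>x\<in>X. \<Sum>l\<in>L. h x (act x l)) = (\<Sum>(x, l) \<in> X \<times> L. h x (act x l))"
    by (rule sum.cartesian_product)
  also have "\<dots> = (\<Sum>(x, l) \<in> darts X. h x (act x l))"
  proof (rule sum.mono_neutral_right)
    show "finite (X \<times> L)" using assms(1) finite_L by simp
    show "darts X \<subseteq> X \<times> L" by (auto simp: darts_def)
    show "\<forall>i\<in>X \<times> L - darts X. (case i of (x, l) \<Rightarrow> h x (act x l)) = 0"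
    proof
      fix i assume i: "i \<in> X \<times> L - darts X"
      obtain x l where xl: "i = (x, l)" by force
      then have "x \<in> X" "act x l \<in> W - X"
        using i assms(2) act_closed[of x l] by (auto simp: darts_def)
      then show "(case i of (x, l) \<Rightarrow> h x (act x l)) = 0"
        using assms(3) xl by simp
    qed
  qed
  finally show ?thesis .
qed

section \<open>Balls and walk counts\<close>

primrec ball_at :: "'v \<Rightarrow> nat \<Rightarrow> 'v set" where
  "ball_at v 0 = {v}"
| "ball_at v (Suc m) = ball_at v m \<union> (\<lambda>(x, l). act x l) ` (ball_at v m \<times> L)"

lemma ball_at_subset: "v \<in> W \<Longrightarrow> ball_at v m \<subseteq> W"
  by (induction m) (auto simp: act_closed)

lemma finite_ball_at: "finite (ball_at v m)"
  by (induction m) (auto simp: finite_L)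

lemma centre_in_ball_at: "v \<in> ball_at v m"
  by (induction m) auto

lemma ball_at_step_back:
  assumes "v \<in> W" "x \<in> W" "l \<in> L" "act x l \<in> ball_at v m"
  shows "x \<in> ball_at v (Suc m)"
proof -
  have "act (act x l) (bar l) \<in> ball_at v (Suc m)"
    using assms bar_closed by force
  then show ?thesis using act_bar assms by simp
qed

lemma ball_at_mono: "m \<le> k \<Longrightarrow> ball_at v m \<subseteq> ball_at v k"
  by (induction k) (auto simp: le_Suc_eq)

text \<open>The number of walks of length \<open>k\<close> from \<open>x\<close> to
  \<open>v\<close>, that is, the \<open>k\<close>-th power of the adjacency operator applied to the
  indicator of \<open>v\<close>.\<close>

primrec walks :: "'v \<Rightarrow> nat \<Rightarrow> 'v \<Rightarrow> real" where
  "walks v 0 x = (if x = v then 1 else 0)"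
| "walks v (Suc k) x = (\<Sum>l\<in>L. walks v k (act x l))"

lemma walks_outside_ball:
  assumes "v \<in> W" "x \<in> W" "x \<notin> ball_at v k"
  shows "walks v k x = 0"
  using assms(2,3)
proof (induction k arbitrary: x)
  case (Suc k)
  then have "act x l \<notin> ball_at v k" if "l \<in> L" for l
    using ball_at_step_back[of v x l k] assms that by blast
  then show ?case
    using Suc act_closed by (simp add: sum.neutral)
qed simp

lemma walks_nonneg: "walks v k x \<ge> 0"
  by (induction k arbitrary: x) (auto intro: sum_nonneg)

definition steps :: "'v rel" where
  "steps = {(x, act x l) | x l. x \<in> W \<and> l \<in> L}"

lemma sym_steps: "sym steps"
proof (rule symI)
  fix x y assume "(x, y) \<in> steps"
  then obtain l where "x \<in> W" "l \<in> L" "y = act x l"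
    by (auto simp: steps_def)
  then have "y \<in> W" "bar l \<in> L" "act y (bar l) = x"
    using act_closed bar_closed act_bar by auto
  moreover from this have "(y, act y (bar l)) \<in> steps"
    unfolding steps_def by blast
  ultimately show "(y, x) \<in> steps" by simp
qed

lemma ball_at_iff_steps:
  assumes "v \<in> W"
  shows "x \<in> ball_at v m \<longleftrightarrow> (\<exists>j\<le>m. (v, x) \<in> steps ^^ j)"
proof
  assume "x \<in> ball_at v m"
  then show "\<exists>j\<le>m. (v, x) \<in> steps ^^ j"
  proof (induction m arbitrary: x)
    case (Suc m)
    show ?case
    proof (cases "x \<in> ball_at v m")
      case True
      then show ?thesis using Suc.IH le_SucI by blast
    next
      case False
      then obtain y l where y: "y \<in> ball_at v m" "l \<in> L" "x = act y l"
        using Suc.prems by auto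
      then obtain j where "j \<le> m" "(v, y) \<in> steps ^^ j"
        using Suc.IH by blast
      moreover have "(y, x) \<in> steps"
        using y ball_at_subset[OF assms] by (auto simp: steps_def)
      ultimately show ?thesis
        by (intro exI[of _ "Suc j"]) auto
    qed
  qed auto
next
  assume "\<exists>j\<le>m. (v, x) \<in> steps ^^ j"
  then obtain j where j: "j \<le> m" "(v, x) \<in> steps ^^ j" by blast
  have "x \<in> ball_at v j"
    using j(2)
  proof (induction j arbitrary: x)
    case (Suc j)
    then obtain y where y: "(v, y) \<in> steps ^^ j" "(y, x) \<in> steps" by auto
    then show ?case
      using Suc.IH[OF y(1)] by (auto simp: steps_def)
  qed simp
  then show "x \<in> ball_at v m"
    using ball_at_mono[OF j(1)] by blast
qed

text \<open>\<open>path_dist\<close> is an infimum in \<open>enat\<close>, infinite for the empty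
  set. A finite bound therefore yields a path attaining the infimum.\<close>

lemma growth_eq_ball_at:
  fixes \<Gamma> :: "('v, 'e) pre_digraph"
  assumes "verts \<Gamma> = W" "symcl (arcs_ends \<Gamma>) = steps" "v \<in> W"
  shows "growth \<Gamma> v = limsup (\<lambda>m. ereal (root m (real (card (ball_at v m)))))"
proof -
  have "path_dist \<Gamma> x v \<le> enat m \<longleftrightarrow> (\<exists>j\<le>m. (x, v) \<in> steps ^^ j)" for x m
  proof
    let ?A = "{enat m | m. (x, v) \<in> steps ^^ m}"
    assume "path_dist \<Gamma> x v \<le> enat m"
    then have le: "Inf ?A \<le> enat m"
      by (simp add: path_dist_def assms(2))
    then have "?A \<noteq> {}"
      by (auto simp: Inf_enat_def split: if_splits)
    then have "Inf ?A \<in> ?A"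
      unfolding Inf_enat_def by (metis (mono_tags, lifting) LeastI ex_in_conv)
    then show "\<exists>j\<le>m. (x, v) \<in> steps ^^ j"
      using le by auto
  next
    assume "\<exists>j\<le>m. (x, v) \<in> steps ^^ j"
    then obtain j where "j \<le> m" "(x, v) \<in> steps ^^ j" by blast
    then have "Inf {enat m | m. (x, v) \<in> steps ^^ m} \<le> enat j"
      by (intro Inf_lower) auto
    also have "\<dots> \<le> enat m"
      using \<open>j \<le> m\<close> by simp
    finally show "path_dist \<Gamma> x v \<le> enat m"
      unfolding path_dist_def assms(2) .
  qed
  moreover have "(x, v) \<in> steps ^^ j \<longleftrightarrow> (v, x) \<in> steps ^^ j" for x j
    using relpow_sym[OF sym_steps] by blast
  ultimately have "path_dist \<Gamma> x v \<le> enat m \<longleftrightarrow> x \<in> ball_at v m" for x m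
    using ball_at_iff_steps[OF assms(3)] by simp
  then have "{x \<in> verts \<Gamma>. path_dist \<Gamma> x v \<le> enat m} = ball_at v m" for m
    using ball_at_subset[OF assms(3)] assms(1) by blast
  then show ?thesis
    by (simp add: growth_def)
qed

end

locale sparse_graph = labelled_graph +
  fixes \<kappa> :: real
  assumes sparse: "finite X \<Longrightarrow> X \<subseteq> W \<Longrightarrow> real (card (darts X)) \<le> 2 * \<kappa> * real (card X)"
begin

text \<open>Layer cake: the minimum over a dart is the total height of the layers containing both
  its ends, and on each superlevel set sparsity compares darts with points. The induction removes
  the lowest layer: with \<open>m\<close> the least value, \<open>f = m + f'\<close> on
  \<open>X\<close>, and \<open>f'\<close> is positive only on the smaller set
  \<open>Y\<close>.\<close>

lemma sum_min_le:
  fixes f :: "'a \<Rightarrow> real"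
  assumes "finite X" "X \<subseteq> W" "\<And>x. x \<in> W \<Longrightarrow> f x \<ge> 0" "\<And>x. x \<in> W \<Longrightarrow> f x > 0 \<longleftrightarrow> x \<in> X"
  shows "(\<Sum>(x, l) \<in> darts X. min (f x) (f (act x l))) \<le> 2 * \<kappa> * (\<Sum>x\<in>X. f x)"
  using assms
proof (induction X arbitrary: f rule: finite_psubset_induct)
  case (psubset X)
  show ?case
  proof (cases "X = {}")
    case True
    then show ?thesis by (simp add: darts_def)
  next
    case False
    define m where "m = Min (f ` X)"
    have m: "m > 0" "\<And>x. x \<in> X \<Longrightarrow> m \<le> f x"
      using psubset False by (auto simp: m_def Min_gr_iff)
    have "m \<in> f ` X"
      unfolding m_def using psubset(1) False by (intro Min_in) auto
    then obtain x0 where x0: "x0 \<in> X" "f x0 = m"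
      by blast
    define Y where "Y = {x \<in> X. f x > m}"
    define f' where "f' x = (if x \<in> X then f x - m else 0)" for x
    have YX: "Y \<subset> X"
      using x0 by (auto simp: Y_def)
    have finY: "finite Y"
      using YX psubset(1) finite_subset by blast
    have f'0: "f' x \<ge> 0" for x
      using m by (simp add: f'_def)
    have IH: "(\<Sum>(x, l) \<in> darts Y. min (f' x) (f' (act x l))) \<le> 2 * \<kappa> * (\<Sum>x\<in>Y. f' x)"
      by (rule psubset.IH[OF YX]) (use psubset YX m f'0 in \<open>auto simp: f'_def Y_def\<close>)
    have "(\<Sum>(x, l) \<in> darts X. min (f' x) (f' (act x l))) = (\<Sum>(x, l) \<in> darts Y. min (f' x) (f' (act x l)))"
    proof (rule sum.mono_neutral_right)
      show "finite (darts X)" using finite_darts psubset(1) .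
      show "darts Y \<subseteq> darts X" using YX by (auto simp: darts_def)
      show "\<forall>i\<in>darts X - darts Y. (case i of (x, l) \<Rightarrow> min (f' x) (f' (act x l))) = 0"
      proof
        fix i assume i: "i \<in> darts X - darts Y"
        obtain x l where xl: "i = (x, l)" by force
        then have "x \<in> X - Y \<or> act x l \<in> X - Y"
          using i by (auto simp: darts_def)
        then have "f' x = 0 \<or> f' (act x l) = 0"
          using m by (auto simp: f'_def Y_def antisym)
        then show "(case i of (x, l) \<Rightarrow> min (f' x) (f' (act x l))) = 0"
          using f'0[of x] f'0[of "act x l"] xl by auto
      qed
    qed
    moreover have "(\<Sum>x\<in>X. f' x) = (\<Sum>x\<in>Y. f' x)"
      using psubset(1) YX
    proof (intro sum.mono_neutral_right)
      show "\<forall>x\<in>X - Y. f' x = 0"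
        using m(2) unfolding f'_def Y_def by (simp add: order.antisym not_less)
    qed auto
    ultimately have *: "(\<Sum>(x, l) \<in> darts X. min (f' x) (f' (act x l))) \<le> 2 * \<kappa> * (\<Sum>x\<in>X. f' x)"
      using IH by simp
    have "(\<Sum>(x, l) \<in> darts X. min (f x) (f (act x l))) = (\<Sum>(x, l) \<in> darts X. m + min (f' x) (f' (act x l)))"
      by (intro sum.cong) (auto simp: darts_def f'_def)
    also have "\<dots> = m * real (card (darts X)) + (\<Sum>(x, l) \<in> darts X. min (f' x) (f' (act x l)))"
      by (simp add: sum.distrib case_prod_unfold)
    also have "\<dots> \<le> m * (2 * \<kappa> * real (card X)) + 2 * \<kappa> * (\<Sum>x\<in>X. f' x)"
      using * sparse[OF psubset(1)] psubset.prems(1) m(1) by (intro add_mono mult_left_mono) auto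
    also have "\<dots> = 2 * \<kappa> * (\<Sum>x\<in>X. m + f' x)"
      by (simp add: sum.distrib algebra_simps)
    also have "(\<Sum>x\<in>X. m + f' x) = (\<Sum>x\<in>X. f x)"
      by (intro sum.cong) (auto simp: f'_def)
    finally show ?thesis .
  qed
qed

text \<open>Expand (|a| - s |b|)^2 \<ge> 0, where b is the smaller in absolute value. Sparsity
  controls the \<open>min\<close> term, the degree controls the rest, and \<open>s\<close> balances
  the two.\<close>

lemma abs_mult_le_min:
  fixes a b s :: real
  assumes "s \<ge> 1"
  shows "\<bar>a * b\<bar> \<le> (s - 1 / s) / 2 * min (a\<^sup>2) (b\<^sup>2) + (a\<^sup>2 + b\<^sup>2) / (2 * s)"
proof -
  have *: "\<bar>a * b\<bar> \<le> (s - 1 / s) / 2 * b\<^sup>2 + (a\<^sup>2 + b\<^sup>2) / (2 * s)" for a b :: real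
  proof -
    have "0 \<le> (\<bar>a\<bar> - s * \<bar>b\<bar>)\<^sup>2 / (2 * s)"
      using assms by simp
    also have "\<dots> = (a\<^sup>2 + s\<^sup>2 * b\<^sup>2) / (2 * s) - \<bar>a * b\<bar>"
      using assms by (simp add: power2_diff power_mult_distrib abs_mult field_simps power2_eq_square)
    also have "(a\<^sup>2 + s\<^sup>2 * b\<^sup>2) / (2 * s) = (s - 1 / s) / 2 * b\<^sup>2 + (a\<^sup>2 + b\<^sup>2) / (2 * s)"
      using assms by (simp add: field_simps power2_eq_square)
    finally show ?thesis by simp
  qed
  show ?thesis
    using *[of a b] *[of b a] by (simp add: min_def mult.commute add.commute)
qed

text \<open>The two contributions of \<open>abs_mult_le_min\<close>: half of
  \<open>s - 1 / s\<close> times \<open>2 * \<kappa>\<close> from the \<open>min\<close> term, and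
  the degree divided by \<open>s\<close> from the other.\<close>

definition \<rho> :: "real \<Rightarrow> real" where
  "\<rho> s = (s - 1 / s) * \<kappa> + real (card L) / s"

lemma quadratic_form_bound:
  fixes f :: "'a \<Rightarrow> real"
  assumes "finite X" "X \<subseteq> W" "\<And>x. x \<in> W - X \<Longrightarrow> f x = 0" "s \<ge> 1"
  shows "\<bar>\<Sum>x\<in>X. \<Sum>l\<in>L. f x * f (act x l)\<bar> \<le> \<rho> s * (\<Sum>x\<in>X. (f x)\<^sup>2)"
proof -
  define Y where "Y = {x \<in> X. f x \<noteq> 0}"
  have Y: "finite Y" "Y \<subseteq> W" "Y \<subseteq> X" "\<And>x. x \<in> W - Y \<Longrightarrow> f x = 0"
    using assms by (auto simp: Y_def)
  have sumY: "(\<Sum>x\<in>X. (f x)\<^sup>2) = (\<Sum>x\<in>Y. (f x)\<^sup>2)"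
    unfolding Y_def using assms(1) by (intro sum.mono_neutral_right) auto
  have "(\<Sum>x\<in>X. \<Sum>l\<in>L. f x * f (act x l)) = (\<Sum>x\<in>Y. \<Sum>l\<in>L. f x * f (act x l))"
    unfolding Y_def using assms(1) by (intro sum.mono_neutral_right) auto
  also have "\<dots> = (\<Sum>(x, l) \<in> darts Y. f x * f (act x l))"
    using Y by (intro sum_darts[where h = "\<lambda>x y. f x * f y"]) auto
  finally have "\<bar>\<Sum>x\<in>X. \<Sum>l\<in>L. f x * f (act x l)\<bar> = \<bar>\<Sum>(x, l) \<in> darts Y. f x * f (act x l)\<bar>"
    by simp
  also have "\<dots> \<le> (\<Sum>(x, l) \<in> darts Y. \<bar>f x * f (act x l)\<bar>)"
    by (rule order_trans[OF sum_abs]) (simp add: case_prod_unfold)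
  also have "\<dots> \<le> (\<Sum>(x, l) \<in> darts Y. (s - 1 / s) / 2 * min ((f x)\<^sup>2) ((f (act x l))\<^sup>2)
      + ((f x)\<^sup>2 + (f (act x l))\<^sup>2) / (2 * s))"
    using abs_mult_le_min[OF assms(4)] by (intro sum_mono) auto
  also have "\<dots> = (s - 1 / s) / 2 * (\<Sum>(x, l) \<in> darts Y. min ((f x)\<^sup>2) ((f (act x l))\<^sup>2))
      + ((\<Sum>(x, l) \<in> darts Y. (f x)\<^sup>2) + (\<Sum>(x, l) \<in> darts Y. (f (act x l))\<^sup>2)) / (2 * s)"
    by (simp add: sum.distrib case_prod_unfold sum_distrib_left sum_divide_distrib add_divide_distrib)
  also have "(\<Sum>(x, l) \<in> darts Y. (f (act x l))\<^sup>2) = (\<Sum>(x, l) \<in> darts Y. (f x)\<^sup>2)"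
    using sum_darts_swap[OF Y(2), where h = "\<lambda>x y. (f y)\<^sup>2"] .
  also have "(s - 1 / s) / 2 * (\<Sum>(x, l) \<in> darts Y. min ((f x)\<^sup>2) ((f (act x l))\<^sup>2))
      + ((\<Sum>(x, l) \<in> darts Y. (f x)\<^sup>2) + (\<Sum>(x, l) \<in> darts Y. (f x)\<^sup>2)) / (2 * s)
      \<le> (s - 1 / s) / 2 * (2 * \<kappa> * (\<Sum>x\<in>Y. (f x)\<^sup>2))
        + (real (card L) * (\<Sum>x\<in>Y. (f x)\<^sup>2) + real (card L) * (\<Sum>x\<in>Y. (f x)\<^sup>2)) / (2 * s)"
  proof (intro add_mono mult_left_mono divide_right_mono)
    show "(\<Sum>(x, l) \<in> darts Y. min ((f x)\<^sup>2) ((f (act x l))\<^sup>2)) \<le> 2 * \<kappa> * (\<Sum>x\<in>Y. (f x)\<^sup>2)"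
    proof (rule sum_min_le[OF Y(1,2)])
      show "0 < (f x)\<^sup>2 \<longleftrightarrow> x \<in> Y" if "x \<in> W" for x
        using that assms(3)[of x] by (auto simp: Y_def)
    qed simp
    have "1 / s \<le> 1" using assms(4) by simp
    then have "1 / s \<le> s" using assms(4) by linarith
    then show "0 \<le> (s - 1 / s) / 2" "0 \<le> 2 * s" using assms(4) by simp_all
    have "(\<Sum>(x, l) \<in> darts Y. (f x)\<^sup>2) \<le> (\<Sum>(x, l) \<in> Y \<times> L. (f x)\<^sup>2)"
      using Y(1) finite_L by (intro sum_mono2) (auto simp: darts_def)
    also have "\<dots> = (\<Sum>x\<in>Y. \<Sum>l\<in>L. (f x)\<^sup>2)"
      by (rule sum.cartesian_product[symmetric])
    finally show "(\<Sum>(x, l) \<in> darts Y. (f x)\<^sup>2) \<le> real (card L) * (\<Sum>x\<in>Y. (f x)\<^sup>2)"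
      "(\<Sum>(x, l) \<in> darts Y. (f x)\<^sup>2) \<le> real (card L) * (\<Sum>x\<in>Y. (f x)\<^sup>2)"
      by (simp_all add: sum_distrib_left)
  qed
  also have "\<dots> = \<rho> s * (\<Sum>x\<in>Y. (f x)\<^sup>2)"
    using assms(4) by (simp add: \<rho>_def field_simps)
  finally show ?thesis
    using sumY by simp
qed

text \<open>Polarisation turns the form bound into a norm bound. Let u be the old walk function, r =
  \<open>\<rho> s\<close>, f = r u and g the adjacency operator applied to u. Then b(f, g) = b(g, f)
  = r N(g), and comparing the form at f + g and f - g gives 4 r N(g) \<le> 2 r (N(f) + N(g)), so
  N(g) \<le> N(f) = r^2 N(u). The larger ball contains the supports of both functions.\<close>

lemma walks_norm_step:
  assumes "v \<in> W" "s \<ge> 1" "\<rho> s > 0"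
  shows "(\<Sum>x\<in>ball_at v (Suc k). (walks v (Suc k) x)\<^sup>2) \<le> (\<rho> s)\<^sup>2 * (\<Sum>x\<in>ball_at v k. (walks v k x)\<^sup>2)"
proof -
  let ?X = "ball_at v (Suc k)" and ?r = "\<rho> s"
  let ?f = "\<lambda>x. ?r * walks v k x" and ?g = "walks v (Suc k)"
  have X: "finite ?X" "?X \<subseteq> W"
    using finite_ball_at ball_at_subset assms by blast+
  have f0: "?f x = 0" if "x \<in> W - ?X" for x
    using that walks_outside_ball[of v x k] assms(1) by auto
  have g0: "?g x = 0" if "x \<in> W - ?X" for x
    using that walks_outside_ball[of v x "Suc k"] assms(1) by auto
  define b where "b h h' = (\<Sum>x\<in>?X. \<Sum>l\<in>L. h x * h' (act x l))" for h h' :: "'a \<Rightarrow> real"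
  define N where "N h = (\<Sum>x\<in>?X. (h x)\<^sup>2)" for h :: "'a \<Rightarrow> real"
  have b_darts: "b h h' = (\<Sum>(x, l) \<in> darts ?X. h x * h' (act x l))" if "\<And>x. x \<in> W - ?X \<Longrightarrow> h' x = 0" for h h'
    unfolding b_def using that by (intro sum_darts[OF X, where h = "\<lambda>x y. h x * h' y"]) auto
  have "b ?f ?g = (\<Sum>(x, l) \<in> darts ?X. ?f x * ?g (act x l))"
    using g0 by (rule b_darts)
  also have "\<dots> = (\<Sum>(x, l) \<in> darts ?X. ?f (act x l) * ?g x)"
    using sum_darts_swap[OF X(2), where h = "\<lambda>x y. ?f x * ?g y"] .
  also have "\<dots> = b ?g ?f"
    by (subst b_darts[OF f0]) (simp_all add: mult.commute case_prod_unfold)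
  finally have sym: "b ?f ?g = b ?g ?f" .
  have bgf: "b ?g ?f = ?r * N ?g"
    unfolding b_def N_def by (simp add: sum_distrib_left power2_eq_square mult_ac)
  have plus: "b (\<lambda>x. ?f x + ?g x) (\<lambda>x. ?f x + ?g x) \<le> ?r * N (\<lambda>x. ?f x + ?g x)"
    using quadratic_form_bound[OF X _ assms(2), of "\<lambda>x. ?f x + ?g x"] f0 g0
    unfolding b_def N_def by (smt (verit))
  have minus: "- b (\<lambda>x. ?f x - ?g x) (\<lambda>x. ?f x - ?g x) \<le> ?r * N (\<lambda>x. ?f x - ?g x)"
    using quadratic_form_bound[OF X _ assms(2), of "\<lambda>x. ?f x - ?g x"] f0 g0
    unfolding b_def N_def by (smt (verit))
  have "b (\<lambda>x. ?f x + ?g x) (\<lambda>x. ?f x + ?g x) - b (\<lambda>x. ?f x - ?g x) (\<lambda>x. ?f x - ?g x)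
      = 2 * b ?f ?g + 2 * b ?g ?f"
    unfolding b_def sum_subtractf[symmetric] sum_distrib_left sum.distrib[symmetric]
    by (intro sum.cong) (auto simp: algebra_simps)
  moreover have "N (\<lambda>x. ?f x + ?g x) + N (\<lambda>x. ?f x - ?g x) = 2 * N ?f + 2 * N ?g"
    unfolding N_def sum_distrib_left sum.distrib[symmetric]
    by (intro sum.cong) (auto simp: power2_eq_square algebra_simps)
  moreover have "b (\<lambda>x. ?f x + ?g x) (\<lambda>x. ?f x + ?g x) - b (\<lambda>x. ?f x - ?g x) (\<lambda>x. ?f x - ?g x)
      \<le> ?r * (N (\<lambda>x. ?f x + ?g x) + N (\<lambda>x. ?f x - ?g x))"
    using add_mono[OF plus minus] by (simp only: distrib_left diff_conv_add_uminus)
  ultimately have "2 * b ?f ?g + 2 * b ?g ?f \<le> ?r * (2 * N ?f + 2 * N ?g)"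
    by simp
  then have "?r * N ?g \<le> ?r * N ?f"
    unfolding sym bgf by (simp only: distrib_left)
  then have "N ?g \<le> N ?f"
    using assms(3) by simp
  moreover have "N ?f = ?r\<^sup>2 * (\<Sum>x\<in>ball_at v k. (walks v k x)\<^sup>2)"
  proof -
    have "N ?f = ?r\<^sup>2 * (\<Sum>x\<in>?X. (walks v k x)\<^sup>2)"
      by (simp only: N_def sum_distrib_left power_mult_distrib)
    also have "(\<Sum>x\<in>?X. (walks v k x)\<^sup>2) = (\<Sum>x\<in>ball_at v k. (walks v k x)\<^sup>2)"
    proof (rule sum.mono_neutral_right)
      show "\<forall>x\<in>?X - ball_at v k. (walks v k x)\<^sup>2 = 0"
      proof
        fix x assume "x \<in> ?X - ball_at v k"
        then have "walks v k x = 0"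
          using X(2) by (intro walks_outside_ball[OF assms(1)]) auto
        then show "(walks v k x)\<^sup>2 = 0" by simp
      qed
      show "finite ?X" using X(1) .
      show "ball_at v k \<subseteq> ?X" by simp
    qed
    finally show ?thesis .
  qed
  ultimately show ?thesis
    by (simp only: N_def)
qed

lemma walks_bound:
  assumes "v \<in> W" "s \<ge> 1" "\<rho> s > 0"
  shows "walks v k v \<le> \<rho> s ^ k"
proof -
  have "(\<Sum>x\<in>ball_at v k. (walks v k x)\<^sup>2) \<le> (\<rho> s ^ k)\<^sup>2"
  proof (induction k)
    case (Suc k)
    have "(\<Sum>x\<in>ball_at v (Suc k). (walks v (Suc k) x)\<^sup>2) \<le> (\<rho> s)\<^sup>2 * (\<Sum>x\<in>ball_at v k. (walks v k x)\<^sup>2)"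
      by (rule walks_norm_step[OF assms])
    also have "\<dots> \<le> (\<rho> s)\<^sup>2 * (\<rho> s ^ k)\<^sup>2"
      using Suc.IH by (rule mult_left_mono) simp
    finally show ?case
      by (simp only: power_mult_distrib power_Suc)
  qed simp
  moreover have "(walks v k v)\<^sup>2 \<le> (\<Sum>x\<in>ball_at v k. (walks v k x)\<^sup>2)"
    using finite_ball_at centre_in_ball_at by (intro member_le_sum) auto
  ultimately have "(walks v k v)\<^sup>2 \<le> (\<rho> s ^ k)\<^sup>2" by linarith
  then show ?thesis
    using assms(3) by (simp add: power2_le_iff_abs_le)
qed

text \<open>All darts leaving the smaller ball \<open>?Y\<close>, and their reversals, lie inside
  the larger ball \<open>?X\<close>; a dart counted both ways has both ends in \<open>?Y\<close>. So
  twice the number of leaving darts is at most \<open>card (darts ?X) + card (darts ?Y)\<close>, and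
  sparsity applies to both terms.\<close>

lemma card_ball_at_Suc:
  assumes "v \<in> W"
  shows "(real (card L) - \<kappa>) * real (card (ball_at v m)) \<le> \<kappa> * real (card (ball_at v (Suc m)))"
proof -
  let ?Y = "ball_at v m" and ?X = "ball_at v (Suc m)"
  have X: "finite ?X" "?X \<subseteq> W" and Y: "finite ?Y" "?Y \<subseteq> W" "?Y \<subseteq> ?X"
    using finite_ball_at ball_at_subset[OF assms] ball_at_mono[of m "Suc m" v]
    by (blast intro: le_SucI)+
  have inj: "inj_on flip (?Y \<times> L)"
    using flip_flip Y(2) by (intro inj_on_inverseI[where g = flip]) auto
  have sub: "?Y \<times> L \<subseteq> darts ?X"
    using Y(3) by (auto simp: darts_def)
  then have "flip ` (?Y \<times> L) \<subseteq> darts ?X"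
    using bij_flip[OF X(2)] by (auto simp: bij_betw_def)
  moreover have "(?Y \<times> L) \<inter> flip ` (?Y \<times> L) \<subseteq> darts ?Y"
  proof
    fix p assume p: "p \<in> (?Y \<times> L) \<inter> flip ` (?Y \<times> L)"
    then obtain y k where "p = flip (y, k)" "y \<in> ?Y" "k \<in> L"
      by auto
    moreover obtain x l where "p = (x, l)" "x \<in> ?Y" "l \<in> L"
      using p by auto
    moreover have "act x l = y"
      using calculation Y(2) act_bar by (auto simp: flip_def)
    ultimately show "p \<in> darts ?Y"
      by (auto simp: darts_def)
  qed
  then have "card ((?Y \<times> L) \<inter> flip ` (?Y \<times> L)) \<le> card (darts ?Y)"
    by (rule card_mono[OF finite_darts[OF Y(1)]])
  moreover have "card ((?Y \<times> L) \<union> flip ` (?Y \<times> L)) \<le> card (darts ?X)"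
    using sub calculation(1) finite_darts X(1) by (intro card_mono) auto
  moreover have "card (?Y \<times> L) + card (flip ` (?Y \<times> L)) =
      card ((?Y \<times> L) \<union> flip ` (?Y \<times> L)) + card ((?Y \<times> L) \<inter> flip ` (?Y \<times> L))"
    using Y(1) finite_L by (intro card_Un_Int) auto
  moreover have "card (flip ` (?Y \<times> L)) = card (?Y \<times> L)"
    using inj by (rule card_image)
  ultimately have "2 * card (?Y \<times> L) \<le> card (darts ?X) + card (darts ?Y)"
    by linarith
  then have "2 * (real (card ?Y) * real (card L)) \<le> real (card (darts ?X)) + real (card (darts ?Y))"
    by (simp only: card_cartesian_product of_nat_add[symmetric] of_nat_mult[symmetric] of_nat_le_iff)
  then show ?thesis
    using sparse[OF X] sparse[OF Y(1,2)] by (simp add: algebra_simps)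
qed

lemma card_ball_at_ge:
  assumes "v \<in> W" "\<kappa> > 0" "\<kappa> \<le> real (card L)"
  shows "((real (card L) - \<kappa>) / \<kappa>) ^ m \<le> real (card (ball_at v m))"
proof (induction m)
  case (Suc m)
  have "((real (card L) - \<kappa>) / \<kappa>) ^ Suc m \<le> ((real (card L) - \<kappa>) / \<kappa>) * real (card (ball_at v m))"
    using Suc assms by (simp add: mult_left_mono divide_right_mono del: ball_at.simps)
  also have "\<dots> \<le> real (card (ball_at v (Suc m)))"
    using card_ball_at_Suc[OF assms(1), of m] assms(2) by (simp add: divide_simps mult.commute del: ball_at.simps)
  finally show ?case .
qed simp

end

section \<open>Free groups\<close>

definition inv_letter :: "'a \<times> bool \<Rightarrow> 'a \<times> bool" where
  "inv_letter l = (fst l, \<not> snd l)"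

lemma inv_letter_inv_letter [simp]: "inv_letter (inv_letter l) = l"
  by (simp add: inv_letter_def)

lemma cancelling_iff: "(fst l = fst l' \<and> snd l \<noteq> snd l') \<longleftrightarrow> l' = inv_letter l"
  by (auto simp: inv_letter_def prod_eq_iff)

lemma reduced_Nil [simp]: "reduced []"
  by (simp add: reduced_def)

lemma reduced_append:
  "reduced (u @ w) \<longleftrightarrow> reduced u \<and> reduced w \<and> (u \<noteq> [] \<longrightarrow> w \<noteq> [] \<longrightarrow> hd w \<noteq> inv_letter (last u))"
  unfolding reduced_def successively_append_iff cancelling_iff by auto

lemma reduced_singleton [simp]: "reduced [l]"
  by (simp add: reduced_def)

lemma reduced_Cons: "reduced (l # w) \<longleftrightarrow> reduced w \<and> (w \<noteq> [] \<longrightarrow> hd w \<noteq> inv_letter l)"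
  using reduced_append[of "[l]" w] by auto

lemma reduced_snoc: "reduced (w @ [l]) \<longleftrightarrow> reduced w \<and> (w \<noteq> [] \<longrightarrow> l \<noteq> inv_letter (last w))"
  using reduced_append[of w "[l]"] by auto

definition inv_word :: "('a \<times> bool) list \<Rightarrow> ('a \<times> bool) list" where
  "inv_word w = rev (map inv_letter w)"

lemma inv_word_simps [simp]:
  "inv_word [] = []" "inv_word (l # w) = inv_word w @ [inv_letter l]"
  "length (inv_word w) = length w" "inv_word (u @ w) = inv_word w @ inv_word u"
  by (simp_all add: inv_word_def)

lemma last_inv_word: "w \<noteq> [] \<Longrightarrow> last (inv_word w) = inv_letter (hd w)"
  by (simp add: inv_word_def last_rev hd_map)

lemma reduced_inv_word: "reduced w \<Longrightarrow> reduced (inv_word w)"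
proof (induction w)
  case (Cons l w)
  then show ?case
    by (cases "w = []") (auto simp: reduced_Cons reduced_append last_inv_word)
qed simp

text \<open>Arcs exist for positive letters only; their reversals supply the inverse
  letters.\<close>

lemma symcl_arcs_ends_eq_steps:
  assumes "labelled_graph W (S \<times> (UNIV :: bool set)) act inv_letter"
    and "arcs \<Gamma> = W \<times> S" "tail \<Gamma> = fst" "head \<Gamma> = (\<lambda>(x, s). act x (s, True))"
  shows "symcl (arcs_ends \<Gamma>) = labelled_graph.steps W (S \<times> UNIV) act"
proof -
  interpret labelled_graph W "S \<times> (UNIV :: bool set)" act inv_letter by fact
  have ends: "arcs_ends \<Gamma> = {(x, act x (s, True)) | x s. x \<in> W \<and> s \<in> S}"
    by (auto simp: arcs_ends_conv assms(2-4) image_iff)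
  have sub: "arcs_ends \<Gamma> \<subseteq> steps"
    unfolding ends steps_def by blast
  then have "(arcs_ends \<Gamma>)\<inverse> \<subseteq> steps"
    using sym_steps by (auto dest: symD)
  moreover have "steps \<subseteq> arcs_ends \<Gamma> \<union> (arcs_ends \<Gamma>)\<inverse>"
  proof (rule subrelI)
    fix x y assume "(x, y) \<in> steps"
    then obtain s b where s: "x \<in> W" "s \<in> S" "y = act x (s, b)"
      by (auto simp: steps_def)
    show "(x, y) \<in> arcs_ends \<Gamma> \<union> (arcs_ends \<Gamma>)\<inverse>"
    proof (cases b)
      case True
      then show ?thesis using s unfolding ends by auto
    next
      case False
      then have "y \<in> W" "act y (s, True) = x"
        using s act_closed[of x "(s, b)"] act_bar[of x "(s, b)"] by (auto simp: inv_letter_def)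
      then have "(y, x) \<in> arcs_ends \<Gamma>"
        using s(2) unfolding ends by auto
      then show ?thesis by simp
    qed
  qed
  ultimately show ?thesis
    using sub by (auto simp: symcl_def)
qed

locale free_basis = group F for F :: "('a, 'm) monoid_scheme" (structure) +
  fixes S :: "'a set"
  assumes free: "free_generating_set F S" and card_S: "card S \<ge> 2"
begin

abbreviation val where "val \<equiv> word_val F"

abbreviation letters :: "('a \<times> bool) set" where "letters \<equiv> S \<times> UNIV"

definition q :: real where "q = 2 * real (card S) - 1"

lemma q_ge: "q \<ge> 3"
  using card_S by (simp add: q_def)

lemma finite_S: "finite S"
  using card_S by (metis card.infinite not_numeral_le_zero)

lemma finite_letters: "finite letters"
  using finite_S by simp

lemma card_letters: "real (card letters) = q + 1"
  by (simp add: q_def card_cartesian_product)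

lemma S_subset: "S \<subseteq> carrier F"
  using free by (simp add: free_generating_set_def)

lemma bij_val: "bij_betw val {w \<in> words S. reduced w} (carrier F)"
  using free by (simp add: free_generating_set_def)

lemma inv_letter_letters [simp]: "inv_letter l \<in> letters \<longleftrightarrow> l \<in> letters"
  by (auto simp: inv_letter_def mem_Times_iff)

lemma letter_val_closed [simp]: "l \<in> letters \<Longrightarrow> letter_val F l \<in> carrier F"
  using S_subset by (auto simp: letter_val_def)

lemma letter_val_inv: "l \<in> letters \<Longrightarrow> letter_val F (inv_letter l) = inv (letter_val F l)"
  using S_subset by (auto simp: letter_val_def inv_letter_def)

lemma words_simps [simp]:
  "[] \<in> words S" "l # w \<in> words S \<longleftrightarrow> l \<in> letters \<and> w \<in> words S"
  "u @ w \<in> words S \<longleftrightarrow> u \<in> words S \<and> w \<in> words S"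
  by (auto simp: words_def)

lemma words_last: "w \<in> words S \<Longrightarrow> w \<noteq> [] \<Longrightarrow> last w \<in> letters"
  by (metis append_butlast_last_id words_simps(2,3))

lemma words_butlast: "w \<in> words S \<Longrightarrow> butlast w \<in> words S"
  by (auto simp: words_def dest: in_set_butlastD)

lemma words_inv_word: "w \<in> words S \<Longrightarrow> inv_word w \<in> words S"
  by (induction w) auto

lemma val_Nil [simp]: "val [] = \<one>"
  by (simp add: word_val_def)

lemma val_Cons: "val (l # w) = letter_val F l \<otimes> val w"
  by (simp add: word_val_def)

lemma val_closed [simp]: "w \<in> words S \<Longrightarrow> val w \<in> carrier F"
  by (induction w) (simp_all add: val_Cons)

lemma val_append: "u \<in> words S \<Longrightarrow> w \<in> words S \<Longrightarrow> val (u @ w) = val u \<otimes> val w"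
  by (induction u) (simp_all add: val_Cons m_assoc)

lemma val_snoc: "w \<in> words S \<Longrightarrow> l \<in> letters \<Longrightarrow> val (w @ [l]) = val w \<otimes> letter_val F l"
  by (simp add: val_append val_Cons)

lemma val_inv_word: "w \<in> words S \<Longrightarrow> val (inv_word w) = inv (val w)"
  by (induction w) (simp_all add: val_Cons val_append words_inv_word letter_val_inv inv_mult_group)

section \<open>Normal forms and word length\<close>

definition nf :: "'a \<Rightarrow> ('a \<times> bool) list" where
  "nf = the_inv_into {w \<in> words S. reduced w} val"

abbreviation len :: "'a \<Rightarrow> nat" where "len g \<equiv> length (nf g)"

lemma nf_val: "w \<in> words S \<Longrightarrow> reduced w \<Longrightarrow> nf (val w) = w"
  unfolding nf_def using bij_val by (intro the_inv_into_f_f) (auto simp: bij_betw_def)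

lemma nf_props:
  assumes "g \<in> carrier F"
  shows "nf g \<in> words S" "reduced (nf g)" "val (nf g) = g"
proof -
  have g: "g \<in> val ` {w \<in> words S. reduced w}" and inj: "inj_on val {w \<in> words S. reduced w}"
    using bij_val assms by (auto simp: bij_betw_def)
  show "val (nf g) = g"
    unfolding nf_def using f_the_inv_into_f[OF inj g] .
  have "nf g \<in> {w \<in> words S. reduced w}"
    unfolding nf_def using the_inv_into_into[OF inj g order_refl] .
  then show "nf g \<in> words S" "reduced (nf g)" by auto
qed

lemma nf_one [simp]: "nf \<one> = []"
  using nf_val[of "[]"] by simp

lemma len_eq_0: "g \<in> carrier F \<Longrightarrow> len g = 0 \<longleftrightarrow> g = \<one>"
  using nf_props[of g] by (metis length_0_conv nf_one val_Nil)

lemma nf_mult_letter: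
  assumes "g \<in> carrier F" "l \<in> letters"
  shows "nf (g \<otimes> letter_val F l) =
    (if nf g \<noteq> [] \<and> last (nf g) = inv_letter l then butlast (nf g) else nf g @ [l])"
proof (cases "nf g \<noteq> [] \<and> last (nf g) = inv_letter l")
  case True
  let ?u = "butlast (nf g)"
  have w: "nf g = ?u @ [inv_letter l]"
    using True by (metis append_butlast_last_id)
  have u: "?u \<in> words S" "reduced ?u"
    using nf_props[OF assms(1)] words_butlast w reduced_snoc by metis+
  have "g = val ?u \<otimes> inv (letter_val F l)"
    using w nf_props(3)[OF assms(1)] val_snoc[OF u(1), of "inv_letter l"] assms(2) letter_val_inv
    by simp
  then have "g \<otimes> letter_val F l = val ?u"
    using u(1) assms inv_solve_right[of g "val ?u" "letter_val F l"] by simp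
  then show ?thesis
    using True nf_val[OF u] by simp
next
  case False
  have "reduced (nf g @ [l])"
    using False nf_props[OF assms(1)] by (auto simp: reduced_snoc)
  moreover have "val (nf g @ [l]) = g \<otimes> letter_val F l"
    using val_snoc nf_props[OF assms(1)] assms(2) by simp
  moreover have "nf g @ [l] \<in> words S"
    using nf_props[OF assms(1)] assms(2) by simp
  ultimately show ?thesis
    using nf_val[of "nf g @ [l]"] False by auto
qed

lemma len_val_le: "w \<in> words S \<Longrightarrow> len (val w) \<le> length w"
proof (induction w rule: rev_induct)
  case (snoc l w)
  then have "len (val (w @ [l])) \<le> Suc (len (val w))"
    by (auto simp: val_snoc nf_mult_letter)
  then show ?case using snoc by auto
qed simp

lemma word_dist_one: "g \<in> carrier F \<Longrightarrow> word_dist F S \<one> g = len g"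
  unfolding word_dist_def
  by (rule Least_equality) (use nf_props len_val_le in force)+

text \<open>Exactly one letter cancels against a nontrivial \<open>g\<close>, the inverse of its
  last letter, so one neighbour in the tree is closer to the identity and \<open>q\<close> are
  farther away.\<close>

lemma sum_letters_len:
  fixes \<phi> :: "nat \<Rightarrow> real"
  assumes "g \<in> carrier F"
  shows "(\<Sum>l\<in>letters. \<phi> (len (g \<otimes> letter_val F l))) =
    (if g = \<one> then (q + 1) * \<phi> 1 else \<phi> (len g - 1) + q * \<phi> (len g + 1))"
proof (cases "g = \<one>")
  case True
  have "\<phi> (len (g \<otimes> letter_val F l)) = \<phi> 1" if "l \<in> letters" for l
    unfolding nf_mult_letter[OF assms that] using True by simp
  then have "(\<Sum>l\<in>letters. \<phi> (len (g \<otimes> letter_val F l))) = (\<Sum>l\<in>letters. \<phi> 1)"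
    by (rule sum.cong[OF refl])
  then show ?thesis
    using True card_letters by simp
next
  case False
  then have ne: "nf g \<noteq> []"
    using len_eq_0[OF assms] by auto
  define a where "a = inv_letter (last (nf g))"
  have a: "a \<in> letters"
    using words_last[OF nf_props(1)[OF assms] ne] by (simp add: a_def del: mem_Sigma_iff)
  have 1: "\<phi> (len (g \<otimes> letter_val F a)) = \<phi> (len g - 1)"
    unfolding nf_mult_letter[OF assms a] using ne by (simp add: a_def)
  have 2: "\<phi> (len (g \<otimes> letter_val F l)) = \<phi> (len g + 1)" if "l \<in> letters - {a}" for l
  proof -
    have "last (nf g) \<noteq> inv_letter l"
      using that by (auto simp: a_def)
    then show ?thesis
      using nf_mult_letter[OF assms, of l] that by simp
  qed
  have "card letters = Suc (card (letters - {a}))"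
    using a finite_letters by (metis card.remove)
  then have c: "real (card (letters - {a})) = q"
    using card_letters by simp
  have "(\<Sum>l\<in>letters. \<phi> (len (g \<otimes> letter_val F l))) =
      \<phi> (len g - 1) + (\<Sum>l\<in>letters - {a}. \<phi> (len (g \<otimes> letter_val F l)))"
    using sum.remove[OF finite_letters a, of "\<lambda>l. \<phi> (len (g \<otimes> letter_val F l))"] 1 by simp
  also have "(\<Sum>l\<in>letters - {a}. \<phi> (len (g \<otimes> letter_val F l))) = (\<Sum>l\<in>letters - {a}. \<phi> (len g + 1))"
    using 2 by (rule sum.cong[OF refl])
  also have "\<dots> = q * \<phi> (len g + 1)"
    using c by simp
  finally show ?thesis using False by simp
qed

section \<open>Counting reduced words\<close>

definition reduced_words :: "nat \<Rightarrow> ('a \<times> bool) list set" where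
  "reduced_words m = {w \<in> words S. reduced w \<and> length w = m}"

lemma finite_reduced_words: "finite (reduced_words m)"
proof (rule finite_subset)
  show "reduced_words m \<subseteq> {w. set w \<subseteq> letters \<and> length w = m}"
    by (auto simp: reduced_words_def words_def)
qed (rule finite_lists_length_eq[OF finite_letters])

lemma reduced_words_Suc:
  "reduced_words (Suc m) = (\<lambda>(w, l). w @ [l]) `
     Sigma (reduced_words m) (\<lambda>w. {l \<in> letters. w \<noteq> [] \<longrightarrow> l \<noteq> inv_letter (last w)})"
proof (intro equalityI subsetI)
  fix v assume v: "v \<in> reduced_words (Suc m)"
  then obtain w l where "v = w @ [l]"
    by (metis (mono_tags, lifting) length_Suc_conv_rev mem_Collect_eq reduced_words_def)
  then show "v \<in> (\<lambda>(w, l). w @ [l]) `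
     Sigma (reduced_words m) (\<lambda>w. {l \<in> letters. w \<noteq> [] \<longrightarrow> l \<noteq> inv_letter (last w)})"
    using v by (auto simp: reduced_words_def reduced_snoc image_iff)
qed (auto simp: reduced_words_def reduced_snoc)

lemma card_reduced_words_Suc:
  "card (reduced_words (Suc m)) =
     (\<Sum>w \<in> reduced_words m. card {l \<in> letters. w \<noteq> [] \<longrightarrow> l \<noteq> inv_letter (last w)})"
proof -
  have "card (reduced_words (Suc m)) =
      card (Sigma (reduced_words m) (\<lambda>w. {l \<in> letters. w \<noteq> [] \<longrightarrow> l \<noteq> inv_letter (last w)}))"
    unfolding reduced_words_Suc by (rule card_image) (auto simp: inj_on_def)
  also have "\<dots> = (\<Sum>w \<in> reduced_words m. card {l \<in> letters. w \<noteq> [] \<longrightarrow> l \<noteq> inv_letter (last w)})"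
    using finite_reduced_words finite_letters by (intro card_SigmaI) auto
  finally show ?thesis .
qed

lemma card_letters_avoiding: "a \<in> letters \<Longrightarrow> real (card {l \<in> letters. l \<noteq> a}) = q"
proof -
  assume a: "a \<in> letters"
  have "{l \<in> letters. l \<noteq> a} = letters - {a}" by auto
  moreover have "card letters = Suc (card (letters - {a}))"
    using a finite_letters by (metis card.remove)
  ultimately show ?thesis using card_letters by simp
qed

lemma card_reduced_words: "real (card (reduced_words (Suc m))) = (q + 1) * q ^ m"
proof (induction m)
  case 0
  have "reduced_words 0 = {[]}"
    by (auto simp: reduced_words_def)
  then show ?case
    using card_reduced_words_Suc[of 0] card_letters by simp
next
  case (Suc m)
  have "real (card (reduced_words (Suc (Suc m)))) =
      (\<Sum>w \<in> reduced_words (Suc m). real (card {l \<in> letters. w \<noteq> [] \<longrightarrow> l \<noteq> inv_letter (last w)}))"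
    by (simp only: card_reduced_words_Suc[of "Suc m"] of_nat_sum)
  also have "\<dots> = (\<Sum>w \<in> reduced_words (Suc m). q)"
  proof (rule sum.cong[OF refl])
    fix w assume w: "w \<in> reduced_words (Suc m)"
    then have w': "w \<noteq> []" "w \<in> words S"
      by (auto simp: reduced_words_def)
    then have "inv_letter (last w) \<in> letters"
      using words_last by (simp del: mem_Sigma_iff)
    with w'(1) show "real (card {l \<in> letters. w \<noteq> [] \<longrightarrow> l \<noteq> inv_letter (last w)}) = q"
      using card_letters_avoiding by simp
  qed
  finally show ?case
    using Suc by simp
qed

definition len_ball :: "nat \<Rightarrow> 'a set" where
  "len_ball m = {g \<in> carrier F. len g \<le> m}"

lemma len_ball_eq: "len_ball m = val ` (\<Union>k\<le>m. reduced_words k)"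
proof (intro equalityI subsetI)
  fix g assume "g \<in> len_ball m"
  then have "g = val (nf g)" "nf g \<in> reduced_words (len g)" "len g \<le> m"
    using nf_props[of g] by (auto simp: len_ball_def reduced_words_def)
  then show "g \<in> val ` (\<Union>k\<le>m. reduced_words k)" by blast
next
  fix g assume "g \<in> val ` (\<Union>k\<le>m. reduced_words k)"
  then show "g \<in> len_ball m"
    by (auto simp: len_ball_def reduced_words_def nf_val)
qed

lemma finite_len_ball: "finite (len_ball m)"
  unfolding len_ball_eq using finite_reduced_words by auto

lemma card_reduced_words_le: "real (card (reduced_words m)) \<le> 2 * q ^ m"
proof (cases m)
  case 0
  have "reduced_words 0 = {[]}"
    by (auto simp: reduced_words_def)
  then show ?thesis using 0 by simp
next
  case (Suc k)
  have "(q + 1) * q ^ k \<le> (2 * q) * q ^ k"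
    using q_ge by (intro mult_right_mono) auto
  then show ?thesis
    using Suc card_reduced_words by simp
qed

text \<open>Bounding every sphere by the bound for the largest one costs a factor
  \<open>m + 1\<close>, invisible to exponential rates.\<close>

lemma card_len_ball_le: "real (card (len_ball m)) \<le> 2 * (real m + 1) * q ^ m"
proof -
  have "card (len_ball m) \<le> card (\<Union>k\<le>m. reduced_words k)"
    unfolding len_ball_eq using finite_reduced_words by (intro card_image_le) auto
  also have "\<dots> \<le> (\<Sum>k\<le>m. card (reduced_words k))"
    by (rule card_UN_le) simp
  finally have "real (card (len_ball m)) \<le> (\<Sum>k\<le>m. real (card (reduced_words k)))"
    by (metis of_nat_le_iff of_nat_sum)
  also have "\<dots> \<le> (\<Sum>k\<le>m. 2 * q ^ m)"
  proof (rule sum_mono)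
    fix k assume "k \<in> {..m}"
    then have "q ^ k \<le> q ^ m"
      using q_ge by (intro power_increasing) auto
    then show "real (card (reduced_words k)) \<le> 2 * q ^ m"
      using card_reduced_words_le[of k] by linarith
  qed
  finally show ?thesis
    by (simp add: algebra_simps)
qed

lemma card_len_ball_ge: "q ^ m \<le> real (card (len_ball m))"
proof -
  have inj: "inj_on val (reduced_words m)"
    using bij_val by (auto simp: bij_betw_def reduced_words_def inj_on_def)
  have "val ` reduced_words m \<subseteq> len_ball m"
    unfolding len_ball_eq by auto
  then have "card (reduced_words m) \<le> card (len_ball m)"
    using card_image[OF inj] card_mono[OF finite_len_ball] by metis
  moreover have "q ^ m \<le> real (card (reduced_words m))"
  proof (cases m)
    case 0
    have "reduced_words 0 = {[]}"
      by (auto simp: reduced_words_def)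
    then show ?thesis using 0 by simp
  next
    case (Suc k)
    have "q * q ^ k \<le> (q + 1) * q ^ k"
      using q_ge by (intro mult_right_mono) auto
    then show ?thesis
      using Suc card_reduced_words by simp
  qed
  ultimately show ?thesis by linarith
qed

sublocale cay: labelled_graph "carrier F" letters "\<lambda>g l. g \<otimes> letter_val F l" inv_letter
  by unfold_locales (simp_all add: finite_S m_assoc letter_val_inv del: mem_Sigma_iff)

section \<open>Poincare exponents\<close>

lemma poincare_exponent_eq:
  assumes "G \<subseteq> carrier F"
  shows "poincare_exponent F S G =
    Limsup at_top (\<lambda>R::real. ereal (1 / R * ln (real (card {g \<in> G. real (len g) \<le> R}))))"
proof -
  have "{g \<in> G. real (word_dist F S \<one> g) \<le> R} = {g \<in> G. real (len g) \<le> R}" for R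
    using assms word_dist_one by auto
  then show ?thesis
    by (simp add: poincare_exponent_def)
qed

lemma finite_len_le: "G \<subseteq> carrier F \<Longrightarrow> finite {g \<in> G. len g \<le> m}"
  by (rule finite_subset[OF _ finite_len_ball[of m]]) (auto simp: len_ball_def)

lemma poincare_exponent_le:
  assumes G: "G \<subseteq> carrier F" "\<one> \<in> G"
    and bound: "\<And>m. real (card {g \<in> G. len g \<le> m}) \<le> C * (real m + 1) * r ^ m"
    and "C > 0" "r \<ge> 1"
  shows "poincare_exponent F S G \<le> ereal (ln r)"
proof -
  have "((\<lambda>R. (ln C + ln (R + 1)) / R + ln r) \<longlongrightarrow> ln r) at_top"
    by real_asymp
  then have lim: "Limsup at_top (\<lambda>R. ereal ((ln C + ln (R + 1)) / R + ln r)) = ereal (ln r)"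
    by (intro lim_imp_Limsup) auto
  have "eventually (\<lambda>R. ereal (1 / R * ln (real (card {g \<in> G. real (len g) \<le> R})))
      \<le> ereal ((ln C + ln (R + 1)) / R + ln r)) at_top"
    using eventually_ge_at_top[of 1]
  proof eventually_elim
    case (elim R)
    define m where "m = nat \<lfloor>R\<rfloor>"
    have mR: "real m \<le> R"
      using elim by (simp add: m_def)
    have eq: "{g \<in> G. real (len g) \<le> R} = {g \<in> G. len g \<le> m}"
      using elim by (auto simp: m_def le_nat_iff le_floor_iff)
    have "{g \<in> G. len g \<le> m} \<noteq> {}"
      using G(2) by auto
    then have pos: "0 < real (card {g \<in> G. len g \<le> m})"
      using finite_len_le[OF G(1)] by (simp add: card_gt_0_iff)
    have "real (card {g \<in> G. len g \<le> m}) \<le> C * (real m + 1) * r ^ m"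
      by (rule bound)
    also have "\<dots> \<le> C * (R + 1) * r ^ m"
      using mR assms by (intro mult_right_mono mult_left_mono) auto
    finally have "ln (real (card {g \<in> G. len g \<le> m})) \<le> ln (C * (R + 1) * r ^ m)"
      using pos by simp
    also have "\<dots> = ln C + ln (R + 1) + real m * ln r"
      using assms elim by (simp add: ln_mult ln_realpow)
    also have "\<dots> \<le> ln C + ln (R + 1) + R * ln r"
      using mR assms by (simp add: mult_right_mono)
    finally have "1 / R * ln (real (card {g \<in> G. len g \<le> m})) \<le> 1 / R * (ln C + ln (R + 1) + R * ln r)"
      using elim by (intro mult_left_mono) auto
    also have "\<dots> = (ln C + ln (R + 1)) / R + ln r"
      using elim by (simp add: field_simps)
    finally show ?case
      by (simp add: eq)
  qed
  then show ?thesis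
    unfolding poincare_exponent_eq[OF G(1)] lim[symmetric] by (rule Limsup_mono)
qed

text \<open>A bound along the radii \<open>a * m + b\<close> suffices; as \<open>m\<close> grows
  like \<open>R / a\<close>, the rate is divided by \<open>a\<close>. For conjugates
  \<open>a = 2\<close>, the source of the factor one half.\<close>

lemma poincare_exponent_ge:
  fixes a b :: nat
  assumes G: "G \<subseteq> carrier F" and "a > 0"
    and bound: "\<And>m. r ^ m \<le> real (card {g \<in> G. len g \<le> a * m + b})"
    and "r \<ge> 1"
  shows "ereal (ln r / real a) \<le> poincare_exponent F S G"
proof -
  have "((\<lambda>R. 1 / R * (((R - real b) / real a - 1) * ln r)) \<longlongrightarrow> inverse (real a) * ln r) at_top"
    using \<open>a > 0\<close> by real_asymp
  then have "((\<lambda>R. 1 / R * (((R - real b) / real a - 1) * ln r)) \<longlongrightarrow> ln r / real a) at_top"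
    by (simp add: divide_inverse mult.commute)
  then have lim: "Limsup at_top (\<lambda>R. ereal (1 / R * (((R - real b) / real a - 1) * ln r))) = ereal (ln r / real a)"
    by (intro lim_imp_Limsup) auto
  have "eventually (\<lambda>R. ereal (1 / R * (((R - real b) / real a - 1) * ln r))
      \<le> ereal (1 / R * ln (real (card {g \<in> G. real (len g) \<le> R})))) at_top"
    using eventually_ge_at_top[of "real b + 1"]
  proof eventually_elim
    case (elim R)
    \<comment> \<open>The largest \<open>m\<close> with \<open>a * m + b \<le> R\<close>. Rounding
      down costs less than 1, hence the \<open>- 1\<close> in the comparison function.\<close>
    define m where "m = nat \<lfloor>(R - real b) / real a\<rfloor>"
    have nonneg: "(R - real b) / real a \<ge> 0"
      using elim by simp
    then have m: "real m \<le> (R - real b) / real a" "(R - real b) / real a - 1 \<le> real m"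
      by (simp_all add: m_def)
    have mR: "real (a * m + b) \<le> R"
      using m(1) \<open>a > 0\<close> by (simp add: field_simps)
    have fin: "finite {g \<in> G. real (len g) \<le> R}"
      by (rule finite_subset[OF _ finite_len_le[OF G, of "nat \<lfloor>R\<rfloor>"]]) (auto intro: le_nat_floor)
    have "r ^ m \<le> real (card {g \<in> G. len g \<le> a * m + b})"
      by (rule bound)
    also have "\<dots> \<le> real (card {g \<in> G. real (len g) \<le> R})"
    proof (intro of_nat_mono card_mono[OF fin] Collect_mono impI conjI; elim conjE)
      fix g assume "len g \<le> a * m + b"
      then have "real (len g) \<le> real (a * m + b)" by (rule of_nat_mono)
      then show "real (len g) \<le> R" using mR by linarith
    qed
    finally have le: "r ^ m \<le> real (card {g \<in> G. real (len g) \<le> R})" .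
    have "((R - real b) / real a - 1) * ln r \<le> real m * ln r"
      using m(2) assms by (intro mult_right_mono) auto
    also have "\<dots> = ln (r ^ m)"
      using assms by (simp add: ln_realpow)
    also have "\<dots> \<le> ln (real (card {g \<in> G. real (len g) \<le> R}))"
      using le assms by (intro ln_mono) (auto intro: less_le_trans[of 0 "r ^ m"])
    finally have "1 / R * (((R - real b) / real a - 1) * ln r) \<le> 1 / R * ln (real (card {g \<in> G. real (len g) \<le> R}))"
      using elim by (intro mult_left_mono) auto
    then show ?case by simp
  qed
  then show ?thesis
    unfolding poincare_exponent_eq[OF G] lim[symmetric] by (rule Limsup_mono)
qed

lemma poincare_exponent_carrier: "poincare_exponent F S (carrier F) = ereal (ln q)"
proof (rule antisym)
  show "poincare_exponent F S (carrier F) \<le> ereal (ln q)"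
    using card_len_ball_le q_ge unfolding len_ball_def by (intro poincare_exponent_le[where C = 2]) auto
  have "ereal (ln q / real 1) \<le> poincare_exponent F S (carrier F)"
    using card_len_ball_ge q_ge unfolding len_ball_def by (intro poincare_exponent_ge[where b = 0]) auto
  then show "ereal (ln q) \<le> poincare_exponent F S (carrier F)" by simp
qed

lemma card_reduced_words_hd:
  assumes "c \<in> letters"
  shows "q ^ m \<le> real (card {v \<in> reduced_words (Suc m). hd v = c})"
proof (induction m)
  case 0
  have "[c] \<in> {v \<in> reduced_words (Suc 0). hd v = c}"
    using assms by (auto simp: reduced_words_def)
  then have "card {v \<in> reduced_words (Suc 0). hd v = c} > 0"
    using finite_reduced_words[of "Suc 0"] by (auto simp: card_gt_0_iff)
  then show ?case by simp
next
  case (Suc m)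
  let ?B = "\<lambda>m. {v \<in> reduced_words (Suc m). hd v = c}"
  let ?T = "\<lambda>w. {l \<in> letters. l \<noteq> inv_letter (last w)}"
  have fin: "finite (?B m)" for m
    using finite_reduced_words by simp
  have T: "real (card (?T w)) = q" if "w \<in> ?B m" for w
  proof -
    have "w \<noteq> []" "w \<in> words S"
      using that by (auto simp: reduced_words_def)
    then have "inv_letter (last w) \<in> letters"
      using words_last by (simp del: mem_Sigma_iff)
    then show ?thesis by (rule card_letters_avoiding)
  qed
  have "q ^ Suc m \<le> (\<Sum>w \<in> ?B m. q)"
    using Suc q_ge by (simp add: mult.commute mult_left_mono)
  also have "\<dots> = (\<Sum>w \<in> ?B m. real (card (?T w)))"
    using T by (intro sum.cong) auto
  also have "\<dots> = real (card (Sigma (?B m) ?T))"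
    using fin finite_letters by (subst card_SigmaI) auto
  also have "\<dots> = real (card ((\<lambda>(w, l). w @ [l]) ` Sigma (?B m) ?T))"
    by (subst card_image) (auto simp: inj_on_def)
  also have "\<dots> \<le> real (card (?B (Suc m)))"
    by (intro of_nat_mono card_mono fin) (auto simp: reduced_words_def reduced_snoc hd_append)
  finally show ?case .
qed

text \<open>
  A nontrivial \<open>h\<close> with reduced word \<open>w\<close> has the conjugates \<open>v\<inverse> w v\<close>, which are reduced as
  written as soon as the first letter of \<open>v\<close> avoids two letters.
\<close>

lemma poincare_exponent_normal_ge:
  assumes N: "N \<lhd> F" "N \<noteq> {\<one>}"
  shows "ereal (ln q / 2) \<le> poincare_exponent F S N"
proof -
  interpret N: normal N F by (rule N(1))
  obtain h where h: "h \<in> N" "h \<noteq> \<one>"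
    using N(2) N.one_closed by auto
  then have hF: "h \<in> carrier F" using N.subset by auto
  define w where "w = nf h"
  have w: "w \<in> words S" "reduced w" "val w = h" "w \<noteq> []"
    using nf_props[OF hF] len_eq_0[OF hF] h(2) by (auto simp: w_def)
  \<comment> \<open>There are at least four letters and two to avoid: one cancels between
    \<open>inv_word v\<close> and \<open>w\<close>, the other between \<open>w\<close> and
    \<open>v\<close>.\<close>
  have "\<not> letters \<subseteq> {hd w, inv_letter (last w)}"
  proof
    assume "letters \<subseteq> {hd w, inv_letter (last w)}"
    then have "card letters \<le> card {hd w, inv_letter (last w)}"
      by (intro card_mono) auto
    also have "\<dots> \<le> 2" by (simp add: card_insert_if)
    finally show False
      using card_S by (simp add: card_cartesian_product)
  qed
  then obtain c where c: "c \<in> letters" "c \<noteq> hd w" "c \<noteq> inv_letter (last w)"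
    by blast
  let ?B = "\<lambda>m. {v \<in> reduced_words (Suc m). hd v = c}"
  let ?u = "\<lambda>v. inv_word v @ w @ v"
  have u: "?u v \<in> words S" "reduced (?u v)" "length (?u v) = 2 * m + (2 + length w)" "val (?u v) \<in> N"
    if "v \<in> ?B m" for v m
  proof -
    have v: "v \<in> words S" "reduced v" "length v = Suc m" "hd v = c" "v \<noteq> []"
      using that by (auto simp: reduced_words_def)
    show "?u v \<in> words S"
      using v w words_inv_word by simp
    show "reduced (?u v)"
      using v w c reduced_inv_word by (auto simp: reduced_append last_inv_word)
    show "length (?u v) = 2 * m + (2 + length w)"
      using v by simp
    have "val (?u v) = inv (val v) \<otimes> h \<otimes> val v"
      using v w hF words_inv_word by (simp add: val_append val_inv_word m_assoc)
    then show "val (?u v) \<in> N"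
      using N.inv_op_closed1[of "val v" h] v h by simp
  qed
  have "q ^ m \<le> real (card {g \<in> N. len g \<le> 2 * m + (2 + length w)})" for m
  proof -
    \<comment> \<open>The conjugate is already in normal form, and \<open>v\<close> is its suffix of
      length \<open>Suc m\<close>.\<close>
    have "inj_on (\<lambda>v. val (?u v)) (?B m)"
    proof (rule inj_onI)
      fix v v' assume v: "v \<in> ?B m" "v' \<in> ?B m" "val (?u v) = val (?u v')"
      then have "?u v = ?u v'"
        using nf_val[OF u(1,2)[OF v(1)]] nf_val[OF u(1,2)[OF v(2)]] by metis
      then show "v = v'"
        using v(1,2) by (auto simp: reduced_words_def)
    qed
    then have "card (?B m) = card ((\<lambda>v. val (?u v)) ` ?B m)"
      by (rule card_image[symmetric])
    also have "\<dots> \<le> card {g \<in> N. len g \<le> 2 * m + (2 + length w)}"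
    proof (intro card_mono finite_len_le N.subset image_subsetI)
      fix v assume v: "v \<in> ?B m"
      then have "len (val (?u v)) = 2 * m + (2 + length w)"
        using nf_val[OF u(1,2)[OF v]] u(3)[OF v] by simp
      then show "val (?u v) \<in> {g \<in> N. len g \<le> 2 * m + (2 + length w)}"
        using u(4)[OF v] by simp
    qed
    finally show ?thesis
      using card_reduced_words_hd[OF c(1), of m] by linarith
  qed
  then have "ereal (ln q / real 2) \<le> poincare_exponent F S N"
    using q_ge N.subset by (intro poincare_exponent_ge[where b = "2 + length w"]) auto
  then show ?thesis by simp
qed

section \<open>Powers of the length on the tree compared with walk counts\<close>

lemma q_pos: "q > 0" "sqrt q > 1" "1 / sqrt q < sqrt q"
proof -
  show "q > 0" "sqrt q > 1" using q_ge by auto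
  then have "1 / sqrt q < 1" by simp
  then show "1 / sqrt q < sqrt q" using \<open>sqrt q > 1\<close> by linarith
qed

text \<open>
  Iterates the identity \<open>\<mu> \<phi> = P \<phi> + (1/t - t) \<delta>\<close> for \<open>\<phi> g = t ^ len g\<close> and the adjacency
  operator \<open>P\<close> of the tree; the remainder is controlled by the supersolution \<open>(1 / sqrt q) ^ len g\<close>,
  whose eigenvalue is \<open>2 sqrt q\<close>.
\<close>

lemma power_len_le_walks:
  assumes t: "0 < t" "t \<le> 1 / sqrt q" and g: "g \<in> carrier F"
  defines "\<mu> \<equiv> q * t + 1 / t"
  shows "t ^ len g \<le> (1 / t - t) * (\<Sum>k<K. cay.walks \<one> k g / \<mu> ^ Suc k)
      + (2 * sqrt q / \<mu>) ^ K * (1 / sqrt q) ^ len g"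
  using g
proof (induction K arbitrary: g)
  case 0
  then show ?case
    using t by (simp add: power_mono)
next
  case (Suc K)
  let ?c = "1 / t - t" and ?\<theta> = "2 * sqrt q / \<mu>" and ?s = "1 / sqrt q"
  have \<mu>: "\<mu> > 0"
    using t q_pos by (simp add: \<mu>_def add_pos_pos)
  have s: "?s > 0" "q * ?s = sqrt q" "1 / ?s = sqrt q" "?s \<le> 1"
    using q_pos by (simp_all add: real_div_sqrt)
  have closed: "g \<otimes> letter_val F l \<in> carrier F" if "l \<in> letters" for l
    using that Suc.prems by simp
  \<comment> \<open>Away from the identity \<open>\<mu>\<close> is an exact eigenvalue. At the
    identity all \<open>q + 1\<close> neighbours have length 1, and \<open>\<mu>\<close> exceeds
    their sum \<open>(q + 1) * t\<close> by \<open>1 / t - t\<close>.\<close>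
  have sum_t: "\<mu> * t ^ len g = (\<Sum>l\<in>letters. t ^ len (g \<otimes> letter_val F l)) + (if g = \<one> then ?c else 0)"
  proof (cases "g = \<one>")
    case True
    then show ?thesis
      using sum_letters_len[OF Suc.prems, of "\<lambda>k. t ^ k"] t by (simp add: \<mu>_def algebra_simps)
  next
    case False
    then obtain j where "len g = Suc j"
      using len_eq_0[OF Suc.prems] not0_implies_Suc by blast
    then show ?thesis
      using sum_letters_len[OF Suc.prems, of "\<lambda>k. t ^ k"] t False by (simp add: \<mu>_def algebra_simps)
  qed
  \<comment> \<open>Equality off the identity; at the identity the sum is sqrt q + 1 / sqrt q, which
    is smaller than 2 sqrt q.\<close>
  have sum_s: "(\<Sum>l\<in>letters. ?s ^ len (g \<otimes> letter_val F l)) \<le> 2 * sqrt q * ?s ^ len g"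
  proof (cases "g = \<one>")
    case True
    have "(q + 1) * ?s = sqrt q + ?s"
      using s(2) by (simp only: distrib_right mult_1_left)
    also have "\<dots> \<le> 2 * sqrt q"
      using q_pos(3) by linarith
    finally show ?thesis
      using sum_letters_len[OF Suc.prems, of "\<lambda>k. ?s ^ k"] True by simp
  next
    case False
    then obtain j where j: "len g = Suc j"
      using len_eq_0[OF Suc.prems] not0_implies_Suc by blast
    have "(\<Sum>l\<in>letters. ?s ^ len (g \<otimes> letter_val F l)) = ?s ^ j + (q * ?s) * ?s ^ Suc j"
      using sum_letters_len[OF Suc.prems, of "\<lambda>k. ?s ^ k"] False by (simp add: j)
    also have "?s ^ j = sqrt q * ?s ^ Suc j"
      using q_pos by simp
    finally show ?thesis
      unfolding s(2) j by simp
  qed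
  have "\<mu> * t ^ len g = (\<Sum>l\<in>letters. t ^ len (g \<otimes> letter_val F l)) + (if g = \<one> then ?c else 0)"
    by (rule sum_t)
  also have "\<dots> \<le> (\<Sum>l\<in>letters. ?c * (\<Sum>k<K. cay.walks \<one> k (g \<otimes> letter_val F l) / \<mu> ^ Suc k)
      + ?\<theta> ^ K * ?s ^ len (g \<otimes> letter_val F l)) + (if g = \<one> then ?c else 0)"
    using Suc.IH[OF closed] by (intro add_right_mono sum_mono)
  also have "\<dots> = ?c * (\<Sum>l\<in>letters. \<Sum>k<K. cay.walks \<one> k (g \<otimes> letter_val F l) / \<mu> ^ Suc k)
      + ?\<theta> ^ K * (\<Sum>l\<in>letters. ?s ^ len (g \<otimes> letter_val F l)) + (if g = \<one> then ?c else 0)"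
    by (simp only: sum.distrib sum_distrib_left)
  also have "(\<Sum>l\<in>letters. \<Sum>k<K. cay.walks \<one> k (g \<otimes> letter_val F l) / \<mu> ^ Suc k) =
      (\<Sum>k<K. cay.walks \<one> (Suc k) g / \<mu> ^ Suc k)"
    by (subst sum.swap) (simp add: sum_divide_distrib)
  also have "?c * (\<Sum>k<K. cay.walks \<one> (Suc k) g / \<mu> ^ Suc k)
      + ?\<theta> ^ K * (\<Sum>l\<in>letters. ?s ^ len (g \<otimes> letter_val F l)) + (if g = \<one> then ?c else 0)
      \<le> ?c * (\<Sum>k<K. cay.walks \<one> (Suc k) g / \<mu> ^ Suc k)
      + ?\<theta> ^ K * (2 * sqrt q * ?s ^ len g) + (if g = \<one> then ?c else 0)"
    using sum_s \<mu> q_pos by (intro add_mono mult_left_mono order_refl) auto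
  also have "\<dots> = \<mu> * (?c * (\<Sum>k<Suc K. cay.walks \<one> k g / \<mu> ^ Suc k) + ?\<theta> ^ Suc K * ?s ^ len g)"
  proof -
    have "(\<Sum>k<Suc K. cay.walks \<one> k g / \<mu> ^ Suc k) =
        cay.walks \<one> 0 g / \<mu> + (\<Sum>k<K. cay.walks \<one> (Suc k) g / \<mu> ^ Suc (Suc k))"
      by (simp only: sum.lessThan_Suc_shift power_Suc0_right One_nat_def[symmetric] power_one_right)
    also have "\<mu> * \<dots> = (if g = \<one> then 1 else 0) + (\<Sum>k<K. cay.walks \<one> (Suc k) g / \<mu> ^ Suc k)"
    proof -
      have "\<mu> * (\<Sum>k<K. cay.walks \<one> (Suc k) g / \<mu> ^ Suc (Suc k)) = (\<Sum>k<K. cay.walks \<one> (Suc k) g / \<mu> ^ Suc k)"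
        unfolding sum_distrib_left using \<mu> by (intro sum.cong) (auto simp del: labelled_graph.walks.simps)
      then show ?thesis
        using \<mu> by (simp add: distrib_left del: cay.walks.simps(2))
    qed
    finally have "\<mu> * (\<Sum>k<Suc K. cay.walks \<one> k g / \<mu> ^ Suc k) =
        (if g = \<one> then 1 else 0) + (\<Sum>k<K. cay.walks \<one> (Suc k) g / \<mu> ^ Suc k)" .
    moreover have "\<mu> * ?\<theta> ^ Suc K = ?\<theta> ^ K * (2 * sqrt q)"
      using \<mu> by simp
    \<comment> \<open>Ring identities in plain variables, so that the final rewriting leaves the
      walk sums and powers intact.\<close>
    moreover have "m * (c * a + x * w) = c * (m * a) + (m * x) * w" for m c a x w :: real
      by (simp add: algebra_simps)
    moreover have "c * b + y * (r * w) + (if P then c else 0) = c * ((if P then 1 else 0) + b) + (y * r) * w"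
      for c b y r w :: real and P
      by (simp add: algebra_simps)
    ultimately show ?thesis
      by (simp only:)
  qed
  finally show ?case
    using \<mu> by (simp only: mult_le_cancel_left_pos)
qed

section \<open>Balls and growth of the Cayley graph\<close>

lemma len_mult_letter_le: "g \<in> carrier F \<Longrightarrow> l \<in> letters \<Longrightarrow> len (g \<otimes> letter_val F l) \<le> Suc (len g)"
  by (auto simp: nf_mult_letter intro: le_SucI)

lemma cayley_ball_at_subset:
  assumes "v \<in> carrier F"
  shows "cay.ball_at v m \<subseteq> (\<lambda>g. v \<otimes> g) ` len_ball m"
proof (induction m)
  case 0
  have "\<one> \<in> len_ball 0" by (simp add: len_ball_def)
  then show ?case using assms by (auto intro: rev_image_eqI)
next
  case (Suc m)
  show ?case
  proof
    fix x assume "x \<in> cay.ball_at v (Suc m)"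
    then consider "x \<in> cay.ball_at v m"
      | y l where "y \<in> cay.ball_at v m" "l \<in> letters" "x = y \<otimes> letter_val F l"
      by auto
    then show "x \<in> (\<lambda>g. v \<otimes> g) ` len_ball (Suc m)"
    proof cases
      case 1
      moreover have "len_ball m \<subseteq> len_ball (Suc m)"
        by (auto simp: len_ball_def)
      ultimately show ?thesis using Suc.IH by blast
    next
      case 2
      then obtain g where g: "g \<in> len_ball m" "y = v \<otimes> g"
        using Suc.IH by blast
      then have gF: "g \<in> carrier F" "len g \<le> m" by (auto simp: len_ball_def)
      have "g \<otimes> letter_val F l \<in> len_ball (Suc m)"
        using len_mult_letter_le[OF gF(1) 2(2)] gF 2(2) by (simp add: len_ball_def)
      moreover have "x = v \<otimes> (g \<otimes> letter_val F l)"
        using 2 g gF assms by (simp add: m_assoc)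
      ultimately show ?thesis by (rule rev_image_eqI)
    qed
  qed
qed

lemma val_in_cayley_ball_at:
  assumes "v \<in> carrier F" "w \<in> words S"
  shows "v \<otimes> val w \<in> cay.ball_at v (length w)"
  using assms(2)
proof (induction w rule: rev_induct)
  case Nil
  then show ?case using assms(1) by simp
next
  case (snoc l w)
  then have w: "w \<in> words S" "l \<in> letters" by simp_all
  have "v \<otimes> val (w @ [l]) = (v \<otimes> val w) \<otimes> letter_val F l"
    using w assms(1) by (simp add: val_snoc m_assoc)
  moreover have "(v \<otimes> val w, l) \<in> cay.ball_at v (length w) \<times> letters"
    using snoc.IH[OF w(1)] w(2) by simp
  ultimately show ?case
    by (auto simp del: mem_Sigma_iff intro: rev_image_eqI)
qed

lemma card_cayley_ball_at:
  assumes "v \<in> carrier F"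
  shows "card (cay.ball_at v m) = card (len_ball m)"
proof -
  have "(\<lambda>g. v \<otimes> g) ` len_ball m \<subseteq> cay.ball_at v m"
  proof (rule image_subsetI)
    fix g assume "g \<in> len_ball m"
    then have g: "g \<in> carrier F" "len g \<le> m" by (auto simp: len_ball_def)
    have "v \<otimes> val (nf g) \<in> cay.ball_at v (len g)"
      using val_in_cayley_ball_at assms nf_props[OF g(1)] by blast
    then show "v \<otimes> g \<in> cay.ball_at v m"
      using cay.ball_at_mono[OF g(2), of v] nf_props(3)[OF g(1)] by auto
  qed
  then have "cay.ball_at v m = (\<lambda>g. v \<otimes> g) ` len_ball m"
    using cayley_ball_at_subset[OF assms] by blast
  moreover have "inj_on (\<lambda>g. v \<otimes> g) (len_ball m)"
    using assms by (auto simp: inj_on_def len_ball_def)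
  ultimately show ?thesis
    by (simp add: card_image)
qed

lemma growth_cayley_graph:
  assumes "v \<in> carrier F"
  shows "growth (cayley_graph F S) v = ereal q"
proof -
  have "symcl (arcs_ends (cayley_graph F S)) = cay.steps"
    by (rule symcl_arcs_ends_eq_steps[OF cay.labelled_graph_axioms])
      (auto simp: cayley_graph_def letter_val_def)
  then have eq: "growth (cayley_graph F S) v = limsup (\<lambda>m. ereal (root m (real (card (len_ball m)))))"
    using cay.growth_eq_ball_at[of "cayley_graph F S" v] assms card_cayley_ball_at[OF assms]
    by (simp add: cayley_graph_def)
  show ?thesis
    unfolding eq using card_len_ball_le card_len_ball_ge q_pos
    by (intro antisym limsup_root_le limsup_root_ge) auto
qed

end

section \<open>Quotients by normal subgroups\<close>

locale free_quotient = free_basis +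
  fixes N :: "'a set"
  assumes normal_N: "N \<lhd> F"
begin

sublocale N: normal N F
  by (rule normal_N)

lemma subgroup_N: "subgroup N F"
  by (rule N.is_subgroup)

lemma rcosets_subset: "C \<in> rcosets N \<Longrightarrow> C \<subseteq> carrier F"
  using N.rcosets_carrier is_group by blast

lemma rcosets_mult: "C \<in> rcosets N \<Longrightarrow> a \<in> carrier F \<Longrightarrow> b \<in> carrier F \<Longrightarrow> C #> a #> b = C #> (a \<otimes> b)"
  using rcosets_subset by (intro coset_mult_assoc)

lemma rcosets_closed: "C \<in> rcosets N \<Longrightarrow> a \<in> carrier F \<Longrightarrow> C #> a \<in> rcosets N"
  unfolding RCOSETS_def using coset_mult_assoc[OF N.subset] by fastforce

lemma N_in_rcosets: "N \<in> rcosets N"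
  using rcosetsI[OF N.subset one_closed] N.subset by simp

text \<open>The stabiliser of \<open>N #> c\<close> is the conjugate of \<open>N\<close> by
  \<open>c\<close>, which is \<open>N\<close> by normality. So a closed path at any vertex of the
  quotient spells an element of \<open>N\<close>.\<close>

lemma fixed_rcoset:
  assumes "C \<in> rcosets N" "g \<in> carrier F" "C #> g = C"
  shows "g \<in> N"
proof -
  obtain c where c: "c \<in> carrier F" "C = N #> c"
    using assms(1) by (auto simp: RCOSETS_def)
  have "c \<in> C"
    using rcos_self[OF c(1) subgroup_N] c(2) by simp
  then have "c \<otimes> g \<in> C #> g"
    by (auto simp: r_coset_def)
  then have "c \<otimes> g \<in> N #> c"
    using assms(3) c(2) by simp
  then obtain h where h: "h \<in> N" "c \<otimes> g = h \<otimes> c"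
    by (auto simp: r_coset_def)
  have hF: "h \<in> carrier F" using h(1) N.subset by auto
  have "g = inv c \<otimes> (c \<otimes> g)"
    using c assms by (simp add: m_assoc[symmetric])
  also have "\<dots> = inv c \<otimes> h \<otimes> c"
    using h c hF by (simp add: m_assoc)
  finally show ?thesis
    using N.inv_op_closed1[OF c(1) h(1)] by simp
qed

sublocale quo: labelled_graph "rcosets N" letters "\<lambda>C l. C #> letter_val F l" inv_letter
proof unfold_locales
  fix C l assume C: "C \<in> rcosets N" and l: "l \<in> letters"
  show "C #> letter_val F l \<in> rcosets N"
    using rcosets_closed C l by simp
  have "C #> letter_val F l #> letter_val F (inv_letter l) = C #> \<one>"
    using C l by (simp add: rcosets_mult letter_val_inv del: mem_Sigma_iff)
  then show "C #> letter_val F l #> letter_val F (inv_letter l) = C"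
    using rcosets_subset[OF C] by simp
qed (simp_all add: finite_S del: mem_Sigma_iff)

text \<open>Walks in the tree from points of the fibre of \<open>N #> g\<close> to the identity
  project, with their labels, to walks from \<open>N #> g\<close> to \<open>N\<close>. A label
  sequence determines the starting point above, so nothing is counted twice. Finite \<open>H\<close>
  avoids infinite sums over the fibre.\<close>

lemma sum_walks_le_quotient_walks:
  assumes "finite H" "H \<subseteq> N" "g \<in> carrier F"
  shows "(\<Sum>h\<in>H. cay.walks \<one> k (h \<otimes> g)) \<le> quo.walks N k (N #> g)"
  using assms(3)
proof (induction k arbitrary: g)
  case 0
  have HF: "h \<in> carrier F" if "h \<in> H" for h
    using that assms(2) N.subset by auto
  show ?case
  proof (cases "\<exists>h\<in>H. h \<otimes> g = \<one>")
    case True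
    then obtain h where h: "h \<in> H" "h \<otimes> g = \<one>" by blast
    then have "g = inv h"
      using HF 0 inv_equality inv_inv by (metis inv_equality inv_closed r_inv l_inv inv_comm)
    then have "g \<in> N"
      using h assms(2) by auto
    then have "N #> g = N"
      using coset_join2[OF 0 subgroup_N] by simp
    moreover have "(\<Sum>h'\<in>H. cay.walks \<one> 0 (h' \<otimes> g)) = (\<Sum>h'\<in>H. if h' = h then 1 else 0)"
    proof (rule sum.cong[OF refl])
      fix h' assume "h' \<in> H"
      then have "h' \<otimes> g = \<one> \<longleftrightarrow> h' = h"
        using h HF 0 by (metis right_cancel)
      then show "cay.walks \<one> 0 (h' \<otimes> g) = (if h' = h then 1 else 0)" by simp
    qed
    ultimately show ?thesis
      using assms(1) h(1) by simp
  next
    case False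
    then have "(\<Sum>h\<in>H. cay.walks \<one> 0 (h \<otimes> g)) = 0"
      by (intro sum.neutral) auto
    then show ?thesis
      using quo.walks_nonneg[of N 0 "N #> g"] by simp
  qed
next
  case (Suc k)
  have HF: "h \<in> carrier F" if "h \<in> H" for h
    using that assms(2) N.subset by auto
  have "(\<Sum>h\<in>H. cay.walks \<one> (Suc k) (h \<otimes> g)) = (\<Sum>h\<in>H. \<Sum>l\<in>letters. cay.walks \<one> k (h \<otimes> (g \<otimes> letter_val F l)))"
    using Suc.prems HF by (simp add: m_assoc)
  also have "\<dots> = (\<Sum>l\<in>letters. \<Sum>h\<in>H. cay.walks \<one> k (h \<otimes> (g \<otimes> letter_val F l)))"
    by (rule sum.swap)
  also have "\<dots> \<le> (\<Sum>l\<in>letters. quo.walks N k (N #> (g \<otimes> letter_val F l)))"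
    using Suc.prems by (intro sum_mono Suc.IH) simp
  also have "\<dots> = quo.walks N (Suc k) (N #> g)"
    using Suc.prems coset_mult_assoc[OF N.subset] by simp
  finally show ?case .
qed

text \<open>Summing \<open>power_len_le_walks\<close> over finite parts of \<open>N\<close> replaces
  tree walks by closed walks in the quotient, of which there are at most \<open>\<rho> ^ k\<close>.
  The series then converges geometrically with ratio \<open>\<rho> / \<mu>\<close>, giving a bound
  independent of the finite part.\<close>

lemma poincare_exponent_le_of_sparse:
  assumes "sparse_graph (rcosets N) letters (\<lambda>C l. C #> letter_val F l) inv_letter \<kappa>" "\<kappa> > 0"
    and t: "0 < t" "t < 1 / sqrt q"
    and gap: "(sqrt q - 1 / sqrt q) * \<kappa> + (q + 1) / sqrt q < q * t + 1 / t"
  shows "poincare_exponent F S N \<le> ereal (ln (1 / t))"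
proof -
  interpret sp: sparse_graph "rcosets N" letters "\<lambda>C l. C #> letter_val F l" inv_letter \<kappa>
    by fact
  define \<mu> where "\<mu> = q * t + 1 / t"
  define \<rho> where "\<rho> = sp.\<rho> (sqrt q)"
  define \<theta> where "\<theta> = 2 * sqrt q / \<mu>"
  have s: "sqrt q > 1" "1 / sqrt q < 1" using q_pos by auto
  have \<rho>_eq: "\<rho> = (sqrt q - 1 / sqrt q) * \<kappa> + (q + 1) / sqrt q"
    unfolding \<rho>_def sp.\<rho>_def card_letters ..
  have "(sqrt q - 1 / sqrt q) * \<kappa> > 0"
    using q_pos(3) assms(2) by simp
  moreover have "(q + 1) / sqrt q > 0"
    using q_pos by simp
  ultimately have \<rho>: "\<rho> > 0" "\<rho> < \<mu>"
    using gap by (simp_all add: \<rho>_eq \<mu>_def)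
  then have \<mu>: "\<mu> > 0" by simp
  have c: "1 / t - t > 0"
  proof -
    have "t < 1" using t s by linarith
    moreover have "1 < 1 / t" using \<open>t < 1\<close> t by simp
    ultimately show ?thesis by linarith
  qed
  have \<theta>: "0 \<le> \<theta>" "\<theta> < 1"
  proof -
    show "0 \<le> \<theta>" using \<mu> q_pos by (simp add: \<theta>_def)
    \<comment> \<open>Strict arithmetic-geometric mean inequality: \<open>\<mu>\<close> exceeds 2
      sqrt q unless t = 1 / sqrt q.\<close>
    have "sqrt q * t \<noteq> 1"
      using t s by (auto simp: field_simps)
    then have "0 < (sqrt q * t - 1)\<^sup>2 / t"
      using t by simp
    also have "\<dots> = \<mu> - 2 * sqrt q"
      using t q_pos by (simp add: \<mu>_def power2_eq_square field_simps)
    finally show "\<theta> < 1"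
      using \<mu> by (simp add: \<theta>_def)
  qed
  have bound: "(\<Sum>h\<in>H. t ^ len h) \<le> (1 / t - t) / (\<mu> - \<rho>)" if H: "finite H" "H \<subseteq> N" for H
  proof -
    have HF: "h \<in> carrier F" if "h \<in> H" for h
      using that H N.subset by auto
    have geometric: "(\<Sum>k<K. \<rho> ^ k / \<mu> ^ Suc k) \<le> 1 / (\<mu> - \<rho>)" for K
    proof -
      have "(\<Sum>k<K. \<rho> ^ k / \<mu> ^ Suc k) = (\<Sum>k<K. (\<rho> / \<mu>) ^ k) / \<mu>"
        by (simp add: sum_divide_distrib power_divide mult.commute)
      also have "(\<Sum>k<K. (\<rho> / \<mu>) ^ k) = (1 - (\<rho> / \<mu>) ^ K) / (1 - \<rho> / \<mu>)"
        using \<rho> \<mu> by (subst sum_gp_strict) (auto simp: field_simps)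
      also have "\<dots> \<le> 1 / (1 - \<rho> / \<mu>)"
        using \<rho> \<mu> by (intro divide_right_mono) auto
      finally have "(\<Sum>k<K. \<rho> ^ k / \<mu> ^ Suc k) \<le> 1 / (1 - \<rho> / \<mu>) / \<mu>"
        using \<mu> by (simp add: divide_right_mono)
      also have "\<dots> = 1 / (\<mu> - \<rho>)"
        using \<rho> \<mu> by (simp add: field_simps)
      finally show ?thesis .
    qed
    have le: "(\<Sum>h\<in>H. t ^ len h) \<le> (1 / t - t) / (\<mu> - \<rho>) + \<theta> ^ K * real (card H)" for K
    proof -
      have "(\<Sum>h\<in>H. t ^ len h) \<le> (\<Sum>h\<in>H. (1 / t - t) * (\<Sum>k<K. cay.walks \<one> k h / \<mu> ^ Suc k) + \<theta> ^ K * 1)"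
      proof (rule sum_mono)
        fix h assume h: "h \<in> H"
        have "t ^ len h \<le> (1 / t - t) * (\<Sum>k<K. cay.walks \<one> k h / \<mu> ^ Suc k) + \<theta> ^ K * (1 / sqrt q) ^ len h"
          unfolding \<mu>_def \<theta>_def using t HF[OF h] by (intro power_len_le_walks) auto
        also have "\<theta> ^ K * (1 / sqrt q) ^ len h \<le> \<theta> ^ K * 1"
          using \<theta> s q_pos by (intro mult_left_mono power_le_one zero_le_power) auto
        finally show "t ^ len h \<le> (1 / t - t) * (\<Sum>k<K. cay.walks \<one> k h / \<mu> ^ Suc k) + \<theta> ^ K * 1"
          by simp
      qed
      also have "\<dots> = (1 / t - t) * (\<Sum>k<K. (\<Sum>h\<in>H. cay.walks \<one> k h) / \<mu> ^ Suc k) + \<theta> ^ K * real (card H)"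
      proof -
        have "(\<Sum>h\<in>H. \<Sum>k<K. cay.walks \<one> k h / \<mu> ^ Suc k) = (\<Sum>k<K. (\<Sum>h\<in>H. cay.walks \<one> k h) / \<mu> ^ Suc k)"
          by (subst sum.swap) (simp only: sum_divide_distrib)
        then show ?thesis
          by (simp add: sum.distrib sum_distrib_left[symmetric])
      qed
      also have "\<dots> \<le> (1 / t - t) * (\<Sum>k<K. \<rho> ^ k / \<mu> ^ Suc k) + \<theta> ^ K * real (card H)"
      proof (intro add_right_mono mult_left_mono sum_mono divide_right_mono)
        fix k
        have "(\<Sum>h\<in>H. cay.walks \<one> k h) = (\<Sum>h\<in>H. cay.walks \<one> k (h \<otimes> \<one>))"
          using HF by (intro sum.cong) auto
        also have "\<dots> \<le> quo.walks N k (N #> \<one>)"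
          by (rule sum_walks_le_quotient_walks[OF H one_closed])
        also have "\<dots> = quo.walks N k N"
          using N.subset by simp
        also have "\<dots> \<le> \<rho> ^ k"
          unfolding \<rho>_def using s \<rho>(1) N_in_rcosets by (intro sp.walks_bound) (auto simp: \<rho>_def)
        finally show "(\<Sum>h\<in>H. cay.walks \<one> k h) \<le> \<rho> ^ k" .
      qed (use c \<mu> in auto)
      also have "\<dots> \<le> (1 / t - t) * (1 / (\<mu> - \<rho>)) + \<theta> ^ K * real (card H)"
        using geometric c by (intro add_right_mono mult_left_mono) auto
      finally show ?thesis by simp
    qed
    \<comment> \<open>For fixed finite \<open>H\<close> the remainder vanishes as \<open>K\<close>
      grows, because \<open>\<theta> < 1\<close>.\<close>
    have "(\<lambda>K. (1 / t - t) / (\<mu> - \<rho>) + \<theta> ^ K * real (card H)) \<longlonglongrightarrow> (1 / t - t) / (\<mu> - \<rho>) + 0 * real (card H)"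
      using \<theta> by (intro tendsto_intros LIMSEQ_realpow_zero) auto
    then show ?thesis
      using le by (intro LIMSEQ_le_const[where X = "\<lambda>K. (1 / t - t) / (\<mu> - \<rho>) + \<theta> ^ K * real (card H)"]) auto
  qed
  define M where "M = (1 / t - t) / (\<mu> - \<rho>)"
  have M: "M > 0" using c \<rho> by (simp add: M_def)
  have t1: "t \<le> 1" using t s by linarith
  show ?thesis
  proof (rule poincare_exponent_le[where C = M])
    fix m
    let ?H = "{g \<in> N. len g \<le> m}"
    have "real (card ?H) * t ^ m = (\<Sum>h\<in>?H. t ^ m)" by simp
    also have "\<dots> \<le> (\<Sum>h\<in>?H. t ^ len h)"
      using t t1 by (intro sum_mono power_decreasing) auto
    also have "\<dots> \<le> M"
      unfolding M_def using finite_len_le[OF N.subset] by (intro bound) auto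
    finally have "real (card ?H) \<le> M * (1 / t) ^ m"
      using t by (simp add: power_divide pos_le_divide_eq)
    also have "\<dots> \<le> M * (real m + 1) * (1 / t) ^ m"
      using M t by (intro mult_right_mono) auto
    finally show "real (card ?H) \<le> M * (real m + 1) * (1 / t) ^ m" .
  qed (use N.subset M t t1 in auto)
qed

section \<open>Girth and sparsity of the quotient graph\<close>

lemma min_displacement_le:
  assumes "h \<in> N" "h \<noteq> \<one>"
  shows "min_displacement F S N \<le> len h"
  unfolding min_displacement_def using assms word_dist_one[of h] N.subset by (intro Least_le) auto

text \<open>Arcs point along generators, so an inverse letter traverses the arc based at the other endpoint.\<close>

definition dart_edge :: "'a set \<Rightarrow> 'a \<times> bool \<Rightarrow> 'a set \<times> 'a" where
  "dart_edge C l = (if snd l then (C, fst l) else (C #> letter_val F l, fst l))"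

lemma adjacency_letter:
  assumes "B \<subseteq> arcs (quotient_graph F S N)" "(x, z) \<in> adjacency (quotient_graph F S N) B"
  obtains l where "l \<in> letters" "x \<in> rcosets N" "z = x #> letter_val F l" "dart_edge x l \<in> B"
proof -
  obtain C s where e: "(C, s) \<in> B" "(x, z) = (C, C #> s) \<or> (x, z) = (C #> s, C)"
    using assms(2) by (auto simp: adjacency_def quotient_graph_def)
  then have C: "C \<in> rcosets N" "s \<in> S" "s \<in> carrier F"
    using assms(1) S_subset by (auto simp: quotient_graph_def)
  show ?thesis
    using e(2)
  proof
    assume "(x, z) = (C, C #> s)"
    then show ?thesis
      using that[of "(s, True)"] C e(1) by (simp add: letter_val_def dart_edge_def)
  next
    assume xz: "(x, z) = (C #> s, C)"
    then have "x #> inv s = C"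
      using rcosets_mult[OF C(1)] C rcosets_subset[OF C(1)] by simp
    then show ?thesis
      using that[of "(s, False)"] C e(1) xz rcosets_closed by (simp add: letter_val_def dart_edge_def)
  qed
qed

text \<open>A shortest path does not backtrack, so its word is reduced. The clause on the first
  letter serves the induction: if that letter undid the preceding step, the path would be back at
  its origin with only \<open>k - 1\<close> steps to go. It also records that the first edge lies in
  \<open>B\<close>.\<close>

lemma shortest_path_reduced_word:
  assumes "B \<subseteq> arcs (quotient_graph F S N)"
    and "(x, y) \<in> adjacency (quotient_graph F S N) B ^^ k"
    and "\<And>j. j < k \<Longrightarrow> (x, y) \<notin> adjacency (quotient_graph F S N) B ^^ j"
    and "x \<in> rcosets N"
  shows "\<exists>w \<in> words S. reduced w \<and> length w = k \<and> y = x #> val w \<and>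
    (w \<noteq> [] \<longrightarrow> dart_edge x (hd w) \<in> B \<and>
      (x #> letter_val F (hd w), y) \<in> adjacency (quotient_graph F S N) B ^^ (k - 1))"
  using assms(2-4)
proof (induction k arbitrary: x)
  case 0
  then show ?case
    using rcosets_subset[of x] by (intro bexI[of _ "[]"]) auto
next
  case (Suc k)
  let ?R = "adjacency (quotient_graph F S N) B"
  obtain z where z: "(x, z) \<in> ?R" "(z, y) \<in> ?R ^^ k"
    using relpow_Suc_D2[OF Suc.prems(1)] by blast
  obtain l where l: "l \<in> letters" "z = x #> letter_val F l" "dart_edge x l \<in> B"
    using adjacency_letter[OF assms(1) z(1)] by metis
  have zN: "z \<in> rcosets N"
    using l Suc.prems(3) rcosets_closed by simp
  have "(z, y) \<notin> ?R ^^ j" if "j < k" for j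
    using Suc.prems(2)[of "Suc j"] that relpow_Suc_I2[OF z(1)] by auto
  then obtain w where w: "w \<in> words S" "reduced w" "length w = k" "y = z #> val w"
    "w \<noteq> [] \<Longrightarrow> (z #> letter_val F (hd w), y) \<in> ?R ^^ (k - 1)"
    using Suc.IH[OF z(2) _ zN] by blast
  have "hd w \<noteq> inv_letter l" if ne: "w \<noteq> []"
  proof
    assume "hd w = inv_letter l"
    then have "z #> letter_val F (hd w) = x"
      using l Suc.prems(3) quo.act_bar by simp
    then have "(x, y) \<in> ?R ^^ (k - 1)"
      using w(5)[OF ne] by simp
    moreover have "k - 1 < Suc k" by linarith
    ultimately show False
      using Suc.prems(2) by blast
  qed
  then have "reduced (l # w)"
    using w(2) by (simp add: reduced_Cons)
  moreover have "y = x #> val (l # w)"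
    using w(1,4) l Suc.prems(3) rcosets_mult by (simp add: val_Cons)
  ultimately show ?case
    using w(1,3) l z by (intro bexI[of _ "l # w"]) auto
qed

text \<open>The step along \<open>e\<close> followed by a shortest way back through
  \<open>B - {e}\<close> is a closed path with a nonempty reduced word, hence a nontrivial element
  of \<open>N\<close>. The length of the way back is bounded by the number of pairs in the relation,
  two per edge; this accounts for \<open>div 2\<close>.\<close>

lemma girth_bound:
  assumes "finite B" "B \<subseteq> arcs (quotient_graph F S N)" "e \<in> B"
    and cycle: "(tail (quotient_graph F S N) e, head (quotient_graph F S N) e)
      \<in> (adjacency (quotient_graph F S N) (B - {e}))\<^sup>*"
  shows "min_displacement F S N div 2 \<le> card B"
proof -
  let ?R = "adjacency (quotient_graph F S N) (B - {e})"
  obtain C s where e: "e = (C, s)" by force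
  then have C: "C \<in> rcosets N" "s \<in> S" "s \<in> carrier F" "(s, True) \<in> letters"
    using assms(2,3) S_subset by (auto simp: quotient_graph_def)
  have symR: "sym ?R"
    by (auto simp: adjacency_def sym_def)
  have finR: "finite ?R"
    using assms(1) by (auto simp: adjacency_def)
  have card2: "card {p, p'} \<le> 2" for p p' :: "'a set \<times> 'a set"
    by (simp add: card_insert_if)
  have "finite (B - {e})" using assms(1) by simp
  then have "card ?R \<le> (\<Sum>a\<in>B - {e}. card {(tail (quotient_graph F S N) a, head (quotient_graph F S N) a),
      (head (quotient_graph F S N) a, tail (quotient_graph F S N) a)})"
    unfolding adjacency_def by (rule card_UN_le)
  also have "\<dots> \<le> (\<Sum>a\<in>B - {e}. 2)"
    by (intro sum_mono card2)
  finally have cardR: "card ?R \<le> 2 * (card B - 1)"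
    using assms(1,3) by simp
  have "(C, C #> s) \<in> ?R\<^sup>*"
    using cycle by (simp add: e quotient_graph_def)
  then have "(C #> s, C) \<in> ?R\<^sup>*"
    using sym_rtrancl[OF symR] by (auto dest: symD)
  then obtain k0 where k0: "k0 \<le> card ?R" "(C #> s, C) \<in> ?R ^^ k0"
    using rtrancl_finite_eq_relpow[OF finR] by auto
  define k where "k = (LEAST k. (C #> s, C) \<in> ?R ^^ k)"
  have k: "(C #> s, C) \<in> ?R ^^ k" "k \<le> card ?R"
    using LeastI[of "\<lambda>k. (C #> s, C) \<in> ?R ^^ k", OF k0(2)] Least_le[of "\<lambda>k. (C #> s, C) \<in> ?R ^^ k", OF k0(2)] k0(1)
    by (auto simp: k_def)
  have "(C #> s, C) \<notin> ?R ^^ j" if "j < k" for j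
    using not_less_Least that unfolding k_def by blast
  moreover have "B - {e} \<subseteq> arcs (quotient_graph F S N)" "C #> s \<in> rcosets N"
    using assms(2) rcosets_closed C by auto
  ultimately have "\<exists>w \<in> words S. reduced w \<and> length w = k \<and> C = C #> s #> val w \<and>
    (w \<noteq> [] \<longrightarrow> dart_edge (C #> s) (hd w) \<in> B - {e} \<and>
      (C #> s #> letter_val F (hd w), C) \<in> ?R ^^ (k - 1))"
    using k(1) by (intro shortest_path_reduced_word)
  then obtain w where w: "w \<in> words S" "reduced w" "length w = k" "C = C #> s #> val w"
    "w \<noteq> [] \<Longrightarrow> dart_edge (C #> s) (hd w) \<in> B - {e}"
    by blast
  let ?v = "(s, True) # w"
  \<comment> \<open>A cancellation at the junction would mean going back along \<open>e\<close>
    itself, which \<open>B - {e}\<close> does not contain.\<close>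
  have "hd w \<noteq> inv_letter (s, True)" if "w \<noteq> []"
  proof
    assume hd: "hd w = inv_letter (s, True)"
    have "dart_edge (C #> s) (s, False) = e"
      using C rcosets_mult[OF C(1)] rcosets_subset[OF C(1)] by (simp add: dart_edge_def letter_val_def e)
    then show False
      using w(5)[OF that] hd by (simp add: inv_letter_def)
  qed
  then have v: "?v \<in> words S" "reduced ?v"
    using w C by (auto simp: reduced_Cons)
  have "C #> val ?v = C"
    using w(1,4) C rcosets_mult by (simp add: val_Cons letter_val_def)
  then have "val ?v \<in> N"
    using fixed_rcoset C(1) v(1) by simp
  moreover have "nf (val ?v) = ?v"
    using nf_val v by blast
  moreover from this have "val ?v \<noteq> \<one>"
    using nf_one by (metis list.distinct(1))
  ultimately have "min_displacement F S N \<le> length ?v"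
    using min_displacement_le[of "val ?v"] by simp
  then have "min_displacement F S N \<le> 2 * (card B - 1) + 1"
    using w(3) k(2) cardR by simp
  moreover have "card B > 0"
    using assms(1,3) by (auto simp: card_gt_0_iff)
  ultimately show ?thesis by linarith
qed

lemma card_arcs_within:
  assumes "planar (quotient_graph F S N)" "finite X" "X \<subseteq> rcosets N"
    and l: "l = min_displacement F S N div 2" "l \<ge> 2"
  shows "real (card {(C, s) \<in> X \<times> S. C #> s \<in> X}) * (real l - 2) \<le> real (card X) * real l"
proof (rule planar_edge_bound[OF _ assms(1,2)])
  let ?A = "{(C, s) \<in> X \<times> S. C #> s \<in> X}"
  show "wf_digraph (quotient_graph F S N)"
    using wf_quotient_graph S_subset subgroup_N by blast
  show "X \<subseteq> verts (quotient_graph F S N)" "?A \<subseteq> arcs (quotient_graph F S N)"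
    using assms(3) by (auto simp: quotient_graph_def)
  show fin: "finite ?A"
    using assms(2) finite_S by (auto intro: finite_subset[of _ "X \<times> S"])
  show "tail (quotient_graph F S N) e \<in> X \<and> head (quotient_graph F S N) e \<in> X" if "e \<in> ?A" for e
    using that by (auto simp: quotient_graph_def)
  show "l \<le> card B" if "B \<subseteq> ?A" "e \<in> B" "(tail (quotient_graph F S N) e, head (quotient_graph F S N) e)
      \<in> (adjacency (quotient_graph F S N) (B - {e}))\<^sup>*" for B e
    unfolding l(1)
  proof (rule girth_bound[OF _ _ that(2,3)])
    show "finite B" using that(1) fin finite_subset by blast
    show "B \<subseteq> arcs (quotient_graph F S N)"
      using that(1) assms(3) by (auto simp: quotient_graph_def)
  qed
qed (rule l(2))

text \<open>Every dart inside \<open>X\<close> is an arc or the reversal of one, so there are at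
  most twice as many darts as arcs; \<open>l \<ge> 3\<close> makes the denominator positive.\<close>

lemma quotient_sparse:
  assumes "planar (quotient_graph F S N)" and l: "l = min_displacement F S N div 2" "l \<ge> 3"
  shows "sparse_graph (rcosets N) letters (\<lambda>C l. C #> letter_val F l) inv_letter (real l / (real l - 2))"
proof unfold_locales
  fix X assume X: "finite X" "X \<subseteq> rcosets N"
  let ?A = "{(C, s) \<in> X \<times> S. C #> s \<in> X}"
  let ?T = "(\<lambda>(C, s). (C, (s, True))) ` ?A"
  have finA: "finite ?A"
    using X(1) finite_S by (auto intro: finite_subset[of _ "X \<times> S"])
  have "quo.darts X \<subseteq> ?T \<union> quo.flip ` ?T"
  proof
    fix p assume p: "p \<in> quo.darts X"
    then obtain C s b where Cs: "p = (C, (s, b))" "C \<in> X" "s \<in> S" "C #> letter_val F (s, b) \<in> X"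
      by (auto simp: quo.darts_def)
    show "p \<in> ?T \<union> quo.flip ` ?T"
    proof (cases b)
      case True
      then have "(C, s) \<in> ?A"
        using Cs by (simp add: letter_val_def)
      then have "p \<in> ?T"
        by (rule rev_image_eqI) (use True Cs in simp)
      then show ?thesis by (rule UnI1)
    next
      case False
      define D where "D = C #> letter_val F (s, False)"
      have C: "C \<in> rcosets N" "(s, False) \<in> letters"
        using Cs X(2) by auto
      have p_eq: "p = (C, (s, False))" and D: "D \<in> X"
        using Cs False by (simp_all add: D_def)
      have DC: "D #> s = C"
        using quo.act_bar[OF C] by (simp add: D_def inv_letter_def letter_val_def)
      have "D #> letter_val F (s, True) = C"
        using DC by (simp add: letter_val_def)
      then have "p = quo.flip (D, (s, True))"
        by (simp add: p_eq quo.flip_def inv_letter_def)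
      moreover have "(D, s) \<in> ?A"
        using D DC Cs by simp
      then have "(D, (s, True)) \<in> ?T"
        by (rule rev_image_eqI) simp
      ultimately have "p \<in> quo.flip ` ?T"
        by (rule image_eqI)
      then show ?thesis by (rule UnI2)
    qed
  qed
  then have "card (quo.darts X) \<le> card (?T \<union> quo.flip ` ?T)"
    using finA by (intro card_mono) auto
  also have "\<dots> \<le> card ?T + card (quo.flip ` ?T)"
    by (rule card_Un_le)
  also have "\<dots> \<le> card ?A + card ?A"
    using finA by (intro add_mono order_trans[OF card_image_le] card_image_le) auto
  finally have "real (card (quo.darts X)) \<le> 2 * real (card ?A)"
    by simp
  moreover have "real (card ?A) \<le> real l / (real l - 2) * real (card X)"
    using card_arcs_within[OF assms(1) X l(1)] l(2) by (simp add: field_simps)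
  ultimately show "real (card (quo.darts X)) \<le> 2 * (real l / (real l - 2)) * real (card X)"
    by simp
qed

section \<open>Growth of the quotient graph\<close>

lemma symcl_arcs_ends_quotient_graph: "symcl (arcs_ends (quotient_graph F S N)) = quo.steps"
  by (rule symcl_arcs_ends_eq_steps[OF quo.labelled_graph_axioms])
    (auto simp: quotient_graph_def letter_val_def)

lemma growth_quotient_graph_eq:
  assumes "C \<in> rcosets N"
  shows "growth (quotient_graph F S N) C = limsup (\<lambda>m. ereal (root m (real (card (quo.ball_at C m)))))"
  using quo.growth_eq_ball_at[OF _ symcl_arcs_ends_quotient_graph assms] by (simp add: quotient_graph_def)

lemma quotient_ball_at_subset:
  assumes "C \<in> rcosets N"
  shows "quo.ball_at C m \<subseteq> (\<lambda>g. C #> g) ` len_ball m"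
proof (induction m)
  case 0
  have "\<one> \<in> len_ball 0" by (simp add: len_ball_def)
  then show ?case using rcosets_subset[OF assms] by (auto intro: rev_image_eqI)
next
  case (Suc m)
  show ?case
  proof
    fix x assume "x \<in> quo.ball_at C (Suc m)"
    then consider "x \<in> quo.ball_at C m"
      | y l where "y \<in> quo.ball_at C m" "l \<in> letters" "x = y #> letter_val F l"
      by auto
    then show "x \<in> (\<lambda>g. C #> g) ` len_ball (Suc m)"
    proof cases
      case 1
      moreover have "len_ball m \<subseteq> len_ball (Suc m)"
        by (auto simp: len_ball_def)
      ultimately show ?thesis using Suc.IH by blast
    next
      case 2
      then obtain g where g: "g \<in> len_ball m" "y = C #> g"
        using Suc.IH by blast
      then have gF: "g \<in> carrier F" "len g \<le> m" by (auto simp: len_ball_def)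
      have "g \<otimes> letter_val F l \<in> len_ball (Suc m)"
        using len_mult_letter_le[OF gF(1) 2(2)] gF 2(2) by (simp add: len_ball_def)
      moreover have "x = C #> (g \<otimes> letter_val F l)"
        using 2 g gF rcosets_mult[OF assms] by simp
      ultimately show ?thesis by (rule rev_image_eqI)
    qed
  qed
qed

lemma growth_quotient_graph_le:
  assumes "C \<in> rcosets N"
  shows "growth (quotient_graph F S N) C \<le> ereal q"
  unfolding growth_quotient_graph_eq[OF assms]
proof (rule limsup_root_le)
  fix m
  have "card (quo.ball_at C m) \<le> card (len_ball m)"
    using surj_card_le[OF finite_len_ball quotient_ball_at_subset[OF assms]] .
  then show "real (card (quo.ball_at C m)) \<le> 2 * (real m + 1) * q ^ m"
    using card_len_ball_le[of m] by linarith
qed (use q_pos in simp)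

lemma growth_quotient_graph_ge:
  assumes "sparse_graph (rcosets N) letters (\<lambda>C l. C #> letter_val F l) inv_letter \<kappa>"
    and "0 < \<kappa>" "\<kappa> \<le> q + 1" and C: "C \<in> rcosets N"
  shows "ereal ((q + 1 - \<kappa>) / \<kappa>) \<le> growth (quotient_graph F S N) C"
proof -
  interpret sp: sparse_graph "rcosets N" letters "\<lambda>C l. C #> letter_val F l" inv_letter \<kappa>
    by fact
  show ?thesis
    unfolding growth_quotient_graph_eq[OF C]
  proof (rule limsup_root_ge)
    show "((q + 1 - \<kappa>) / \<kappa>) ^ m \<le> real (card (quo.ball_at C m))" for m
      using sp.card_ball_at_ge[OF C assms(2), of m] assms(3) unfolding card_letters by blast
    show "0 \<le> (q + 1 - \<kappa>) / \<kappa>"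
      using assms(2,3) by simp
  qed
qed

end

theorem theorem1p3:
  fixes F :: "('a, 'm) monoid_scheme"
    and S :: "'a set"
    and n :: nat
    and N :: "nat \<Rightarrow> 'a set"
    and \<gamma> :: "nat \<Rightarrow> 'a set"
    and \<gamma>\<^sub>0 :: 'a
  assumes "n \<ge> 2"
    and "free_generating_set F S"
    and "card S = n"
    and "\<And>k. N k \<lhd> F"
    and "\<And>k. N k \<noteq> {\<one>\<^bsub>F\<^esub>}"
    and "\<And>k. planar (quotient_graph F S (N k))"
    and "filterlim (\<lambda>k. min_displacement F S (N k)) at_top sequentially"
    and "\<And>k. \<gamma> k \<in> verts (quotient_graph F S (N k))"
    and "\<gamma>\<^sub>0 \<in> verts (cayley_graph F S)"
  shows "(\<lambda>k. poincare_exponent F S (N k))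
           \<longlonglongrightarrow> ereal (1 / 2) * poincare_exponent F S (carrier F)
       \<and> (\<lambda>k. growth (quotient_graph F S (N k)) (\<gamma> k))
           \<longlonglongrightarrow> growth (cayley_graph F S) \<gamma>\<^sub>0"
proof -
  have "group F"
    using assms(2) by (simp add: free_generating_set_def)
  then interpret free_basis F S
    using assms(1-3) by (simp add: free_basis_def free_basis_axioms_def)
  have quotient: "free_quotient F S (N k)" for k
    using free_basis_axioms assms(4) by (simp add: free_quotient_def free_quotient_axioms_def)
  have \<gamma>: "\<gamma> k \<in> rcosets\<^bsub>F\<^esub> (N k)" for k
    using assms(8)[of k] by (simp add: quotient_graph_def)
  \<comment> \<open>Half the minimal displacement is the cycle bound of \<open>girth_bound\<close>;
    it still tends to infinity.\<close>
  define l where "l k = min_displacement F S (N k) div 2" for k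
  define \<kappa> where "\<kappa> k = real (l k) / (real (l k) - 2)" for k
  have "filterlim (\<lambda>m::nat. m div 2) at_top at_top"
    unfolding filterlim_at_top eventually_at_top_linorder
    by (metis div_le_mono nonzero_mult_div_cancel_left zero_neq_numeral)
  then have l: "filterlim l at_top sequentially"
    unfolding l_def using assms(7) by (rule filterlim_compose)
  have "((\<lambda>m. real m / (real m - 2)) \<longlongrightarrow> 1) at_top"
    by real_asymp
  then have \<kappa>: "\<kappa> \<longlonglongrightarrow> 1"
    unfolding \<kappa>_def using l by (rule filterlim_compose)
  have "eventually (\<lambda>k. l k \<ge> 3) sequentially"
    using l by (simp add: filterlim_at_top)
  then have sparse: "eventually (\<lambda>k. sparse_graph (rcosets\<^bsub>F\<^esub> (N k)) letters (\<lambda>C l. C #>\<^bsub>F\<^esub> letter_val F l) inv_letter (\<kappa> k)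
      \<and> 0 < \<kappa> k) sequentially"
  proof eventually_elim
    case (elim k)
    then show ?case
      using free_quotient.quotient_sparse[OF quotient assms(6) l_def] by (simp add: \<kappa>_def)
  qed
  have "(\<lambda>k. poincare_exponent F S (N k)) \<longlonglongrightarrow> ereal (ln q / 2)"
  proof (rule order_tendstoI)
    fix a assume "a < ereal (ln q / 2)"
    then have "a < poincare_exponent F S (N k)" for k
      using poincare_exponent_normal_ge[OF assms(4,5)] less_le_trans by blast
    then show "eventually (\<lambda>k. a < poincare_exponent F S (N k)) sequentially"
      by simp
  next
    fix a assume "ereal (ln q / 2) < a"
    then obtain b where b: "ln q / 2 < b" "ereal b < a"
      using ereal_dense2 by (metis less_ereal.simps(1))
    \<comment> \<open>Chosen so that the resulting bound \<open>ln (1 / t)\<close> equals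
      \<open>b\<close>; \<open>b > ln q / 2\<close> becomes t < 1 / sqrt q.\<close>
    define t where "t = exp (- b)"
    have sqrt_q: "sqrt q = exp (ln q / 2)"
      using q_pos by (simp add: ln_sqrt[symmetric])
    have t: "0 < t" "t < 1 / sqrt q"
      using b(1) unfolding sqrt_q by (simp_all add: t_def exp_minus field_simps flip: exp_add)
    have "0 < (sqrt q * t - 1)\<^sup>2 / t"
    proof -
      have "sqrt q * t < 1" using t q_pos by (simp add: field_simps)
      then show ?thesis using t by simp
    qed
    also have "\<dots> = q * t + 1 / t - 2 * sqrt q"
      using t q_pos by (simp add: power2_eq_square field_simps)
    finally have gap: "2 * sqrt q < q * t + 1 / t" by simp
    have "(\<lambda>k. (sqrt q - 1 / sqrt q) * \<kappa> k + (q + 1) / sqrt q) \<longlonglongrightarrow> (sqrt q - 1 / sqrt q) * 1 + (q + 1) / sqrt q"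
      by (intro tendsto_intros \<kappa>)
    \<comment> \<open>The limit is the spectral radius of the tree, strictly below q t + 1 / t, so
      the required gap holds for all large k.\<close>
    also have "(sqrt q - 1 / sqrt q) * 1 + (q + 1) / sqrt q = 2 * sqrt q"
      using q_pos by (simp add: add_divide_distrib real_div_sqrt)
    finally have "eventually (\<lambda>k. (sqrt q - 1 / sqrt q) * \<kappa> k + (q + 1) / sqrt q < q * t + 1 / t) sequentially"
      using gap by (rule order_tendstoD)
    then show "eventually (\<lambda>k. poincare_exponent F S (N k) < a) sequentially"
      using sparse
    proof eventually_elim
      case (elim k)
      then have "poincare_exponent F S (N k) \<le> ereal (ln (1 / t))"
        using free_quotient.poincare_exponent_le_of_sparse[OF quotient] t by blast
      also have "ln (1 / t) = b"
        by (simp add: t_def exp_minus ln_inverse divide_inverse)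
      finally show ?case
        using b(2) by simp
    qed
  qed
  moreover have "ereal (1 / 2) * poincare_exponent F S (carrier F) = ereal (ln q / 2)"
    by (simp add: poincare_exponent_carrier)
  moreover have "(\<lambda>k. growth (quotient_graph F S (N k)) (\<gamma> k)) \<longlonglongrightarrow> ereal q"
  proof (rule tendsto_sandwich)
    have "(\<lambda>k. (q + 1 - \<kappa> k) / \<kappa> k) \<longlonglongrightarrow> (q + 1 - 1) / 1"
      by (intro tendsto_intros \<kappa>) simp
    then show "(\<lambda>k. ereal ((q + 1 - \<kappa> k) / \<kappa> k)) \<longlonglongrightarrow> ereal q"
      by simp
    have "eventually (\<lambda>k. \<kappa> k < q + 1) sequentially"
      using \<kappa> q_pos by (intro order_tendstoD) auto
    then show "eventually (\<lambda>k. ereal ((q + 1 - \<kappa> k) / \<kappa> k) \<le> growth (quotient_graph F S (N k)) (\<gamma> k)) sequentially"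
      using sparse
    proof eventually_elim
      case (elim k)
      then show ?case
        using free_quotient.growth_quotient_graph_ge[OF quotient _ _ _ \<gamma>] by simp
    qed
    show "eventually (\<lambda>k. growth (quotient_graph F S (N k)) (\<gamma> k) \<le> ereal q) sequentially"
      using free_quotient.growth_quotient_graph_le[OF quotient \<gamma>] by simp
  qed simp
  moreover have "growth (cayley_graph F S) \<gamma>\<^sub>0 = ereal q"
    using growth_cayley_graph assms(9) by (simp add: cayley_graph_def)
  ultimately show ?thesis by simp
qed

end
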